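(* Let $\mathfrak{g}$ be a 3-dimensional real Lie algebra with basis $\xi_1,\xi_2,\xi_3$, let $G$ be the simply connected Lie group with Lie algebra $\mathfrak{g}$, and let $(M,\phi,\xi_1^*,\xi_2^*,\xi_3^* )$ be an f.pk-$\mathfrak{g}$-structure on a smooth manifold $M$ of dimension $2n+3$. Let $\hat\phi$ be the associated $(1,1)$-tensor on $M$ and $\hat J$ the associated almost complex structure on $M\times G$ (both defined in the context). Then $\hat J$ is integrable if and only if $$[\hat\phi,\hat\phi]+d\eta_3\otimes\xi_3^*=0 .$$
   Context: Let $M$ be a smooth manifold of dimension $2n+p$ (here $p=3$). An f-structure on $M$ is a tensor field $\phi$ of type $(1,1)$ with $\phi^3+\phi=0$. Write $D=\operatorname{im}\phi$. If $\ker\phi$ is a $p$-dimensional parallelisable distribution and a parallelism (global frame) $\xi_1^*,\dots,\xi_p^*$ of $\ker\phi$ is chosen, $(M,\phi,\xi_i^* )$ is called an f.pk-structure. It is an f.pk-$\mathfrak{g}$-structure if the parallelism spans a Lie algebra $\mathfrak{g}$: there is an injective Lie algebra homomorphism ${}^*:\mathfrak{g}\to\chi(M)$ from a $p$-dimensional real Lie algebra $\mathfrak{g}$ into the vector fields on $M$, whose image spans $\ker\phi$, with ${}^*(\xi_i)=\xi_i^*$ for the basis $\xi_1,\dots,\xi_p$ of $\mathfrak{g}$. Then $TM=\ker\phi\oplus D$, and one-forms $\eta_i$ are defined by $\eta_i(\xi_j^* )=\delta_{ij}$ and $\eta_i|_D=0$. The convention for the exterior derivative is $d\eta_i(Z,T)=Z(\eta_i(T))-T(\eta_i(Z))-\eta_i([Z,T])$,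 and $(d\eta_3\otimes\xi_3^* )(Z,T)=d\eta_3(Z,T)\,\xi_3^*$. For $p=3$, define the $(1,1)$-tensor $\hat\phi$ on $M$ by $\hat\phi|_D=\phi|_D$, $\hat\phi\xi_1^*=\xi_2^*$, $\hat\phi\xi_2^*=-\xi_1^*$, $\hat\phi\xi_3^*=0$. Regard $\xi_1,\xi_2,\xi_3$ as left-invariant vector fields on $G$, with dual left-invariant one-forms $\lambda_1,\lambda_2,\lambda_3$, and define the $(1,1)$-tensor $\psi$ on $G$ by $\psi\xi_1=\xi_2$, $\psi\xi_2=-\xi_1$, $\psi\xi_3=0$. The almost complex structure $\hat J$ on $M\times G$ is $$\hat J(X,Y)=\big(\hat\phi(X)-\lambda_3(Y)\,\xi_3^*,\ \psi(Y)+\eta_3(X)\,\xi_3\big),$$ where $(X,Y)$ denotes the $TM$- and $TG$-parts of a vector field on $M\times G$. For a $(1,1)$-tensor $A$, the Nijenhuis tensor is $[A,A](X,Y)=A^2[X,Y]+[AX,AY]-A[AX,Y]-A[X,AY]$; an almost complex structure $J$ is integrable if it comes from a complex structure, equivalently $[J,J]=0$. *)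

theory Defs
  imports "HOL-Analysis.Analysis" "HOL-Library.Function_Algebras"
begin

section \<open>Pointwise real vector space structure on functions\<close>

instantiation "fun" :: (type, real_vector) real_vector
begin

definition scaleR_fun_def: "c *\<^sub>R f = (\<lambda>x. c *\<^sub>R f x)"

instance
  by standard (auto simp: scaleR_fun_def fun_eq_iff algebra_simps)

end

section \<open>Smooth manifolds\<close>

primrec Ck_on :: "nat \<Rightarrow> 'a::real_normed_vector set \<Rightarrow> ('a \<Rightarrow> 'b::real_normed_vector) \<Rightarrow> bool" where
  "Ck_on 0 S f \<longleftrightarrow> continuous_on S f"
| "Ck_on (Suc k) S f \<longleftrightarrow> (\<forall>x\<in>S. f differentiable (at x)) \<and>
     (\<forall>v. Ck_on k S (\<lambda>x. frechet_derivative f (at x) v))"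

text \<open>Only used for open sets \<open>S\<close>.\<close>

definition smooth_on :: "'a::real_normed_vector set \<Rightarrow> ('a \<Rightarrow> 'b::real_normed_vector) \<Rightarrow> bool" where
  "smooth_on S f \<longleftrightarrow> (\<forall>k. Ck_on k S f)"

text \<open>A chart is a pair of its domain and its coordinate map; an atlas need not be maximal.\<close>

type_synonym ('m, 'e) chart = "'m set \<times> ('m \<Rightarrow> 'e)"
type_synonym ('m, 'e) atlas = "('m, 'e) chart set"

definition is_chart :: "('m::topological_space, 'e::euclidean_space) chart \<Rightarrow> bool" where
  "is_chart c \<longleftrightarrow> (case c of (U, x) \<Rightarrow>
     open U \<and> open (x ` U) \<and> inj_on x U \<and> continuous_on U x \<and> continuous_on (x ` U) (inv_into U x))"

definition smooth_manifold ::
  "('m::{t2_space,second_countable_topology}, 'e::euclidean_space) atlas \<Rightarrow> bool" where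
  "smooth_manifold \<A> \<longleftrightarrow>
     (\<forall>c\<in>\<A>. is_chart c) \<and> (\<Union>(U, x)\<in>\<A>. U) = UNIV \<and>
     (\<forall>(U, x)\<in>\<A>. \<forall>(V, y)\<in>\<A>. smooth_on (x ` (U \<inter> V)) (y \<circ> inv_into U x))"

definition smooth_map ::
  "('m::topological_space, 'e::euclidean_space) atlas \<Rightarrow>
   ('n::topological_space, 'f::euclidean_space) atlas \<Rightarrow> ('m \<Rightarrow> 'n) \<Rightarrow> bool" where
  "smooth_map \<A> \<B> F \<longleftrightarrow> continuous_on UNIV F \<and>
     (\<forall>(U, x)\<in>\<A>. \<forall>(V, y)\<in>\<B>. smooth_on (x ` (U \<inter> F -` V)) (y \<circ> F \<circ> inv_into U x))"

definition smooth_fun ::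
  "('m::topological_space, 'e::euclidean_space) atlas \<Rightarrow> ('m \<Rightarrow> real) set" where
  "smooth_fun \<A> = {f. \<forall>(U, x)\<in>\<A>. smooth_on (x ` U) (f \<circ> inv_into U x)}"

definition prod_atlas ::
  "('m, 'e) atlas \<Rightarrow> ('n, 'f) atlas \<Rightarrow> ('m \<times> 'n, 'e \<times> 'f) atlas" where
  "prod_atlas \<A> \<B> = {(U \<times> V, map_prod x y) | U x V y. (U, x) \<in> \<A> \<and> (V, y) \<in> \<B>}"

section \<open>Tangent vectors, vector fields and tensors\<close>

text \<open>
  Tangent vectors at \<open>p\<close> are the derivations at \<open>p\<close> of the algebra of smooth functions. They are
  functionals on all functions, normalised to vanish on the non-smooth ones.
\<close>

type_synonym 'm tvec = "('m \<Rightarrow> real) \<Rightarrow> real"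
type_synonym 'm vfield = "'m \<Rightarrow> 'm tvec"
type_synonym 'm tensor11 = "'m \<Rightarrow> 'm tvec \<Rightarrow> 'm tvec"
type_synonym 'm form1 = "'m \<Rightarrow> 'm tvec \<Rightarrow> real"

definition tangent_space ::
  "('m::topological_space, 'e::euclidean_space) atlas \<Rightarrow> 'm \<Rightarrow> 'm tvec set" where
  "tangent_space \<A> p = {v.
     (\<forall>f. f \<notin> smooth_fun \<A> \<longrightarrow> v f = 0) \<and>
     (\<forall>f\<in>smooth_fun \<A>. \<forall>g\<in>smooth_fun \<A>. v (\<lambda>x. f x + g x) = v f + v g) \<and>
     (\<forall>c. \<forall>f\<in>smooth_fun \<A>. v (\<lambda>x. c * f x) = c * v f) \<and>
     (\<forall>f\<in>smooth_fun \<A>. \<forall>g\<in>smooth_fun \<A>. v (\<lambda>x. f x * g x) = v f * g p + f p * v g)}"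

definition smooth_vfield ::
  "('m::topological_space, 'e::euclidean_space) atlas \<Rightarrow> 'm vfield \<Rightarrow> bool" where
  "smooth_vfield \<A> X \<longleftrightarrow> (\<forall>p. X p \<in> tangent_space \<A> p) \<and>
     (\<forall>f\<in>smooth_fun \<A>. (\<lambda>p. X p f) \<in> smooth_fun \<A>)"

definition lie_bracket :: "'m vfield \<Rightarrow> 'm vfield \<Rightarrow> 'm vfield" where
  "lie_bracket X Y = (\<lambda>p f. X p (\<lambda>q. Y q f) - Y p (\<lambda>q. X q f))"

definition differential ::
  "('m::topological_space, 'e::euclidean_space) atlas \<Rightarrow>
   ('n::topological_space, 'f::euclidean_space) atlas \<Rightarrow> ('m \<Rightarrow> 'n) \<Rightarrow> 'm tvec \<Rightarrow> 'n tvec" where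
  "differential \<A> \<B> F v = (\<lambda>f. if f \<in> smooth_fun \<B> then v (f \<circ> F) else 0)"

definition smooth_tensor11 ::
  "('m::topological_space, 'e::euclidean_space) atlas \<Rightarrow> 'm tensor11 \<Rightarrow> bool" where
  "smooth_tensor11 \<A> A \<longleftrightarrow>
     (\<forall>p. \<forall>u\<in>tangent_space \<A> p. A p u \<in> tangent_space \<A> p) \<and>
     (\<forall>p. \<forall>u\<in>tangent_space \<A> p. \<forall>v\<in>tangent_space \<A> p. A p (u + v) = A p u + A p v) \<and>
     (\<forall>p c. \<forall>u\<in>tangent_space \<A> p. A p (c *\<^sub>R u) = c *\<^sub>R A p u) \<and>
     (\<forall>X. smooth_vfield \<A> X \<longrightarrow> smooth_vfield \<A> (\<lambda>p. A p (X p)))"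

definition apply_tensor :: "'m tensor11 \<Rightarrow> 'm vfield \<Rightarrow> 'm vfield" (infixr "\<cdot>" 75) where
  "A \<cdot> X = (\<lambda>p. A p (X p))"

definition nijenhuis :: "'m tensor11 \<Rightarrow> 'm vfield \<Rightarrow> 'm vfield \<Rightarrow> 'm vfield" where
  "nijenhuis A X Y = A \<cdot> A \<cdot> lie_bracket X Y + lie_bracket (A \<cdot> X) (A \<cdot> Y)
     - A \<cdot> lie_bracket (A \<cdot> X) Y - A \<cdot> lie_bracket X (A \<cdot> Y)"

definition ext_deriv :: "'m form1 \<Rightarrow> 'm vfield \<Rightarrow> 'm vfield \<Rightarrow> 'm \<Rightarrow> real" where
  "ext_deriv \<omega> Z T p = Z p (\<lambda>q. \<omega> q (T q)) - T p (\<lambda>q. \<omega> q (Z q)) - \<omega> p (lie_bracket Z T p)"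

definition almost_complex ::
  "('m::topological_space, 'e::euclidean_space) atlas \<Rightarrow> 'm tensor11 \<Rightarrow> bool" where
  "almost_complex \<A> J \<longleftrightarrow> smooth_tensor11 \<A> J \<and>
     (\<forall>p. \<forall>v\<in>tangent_space \<A> p. J p (J p v) = - v)"

text \<open>
  Integrability is taken in the sense of a vanishing Nijenhuis tensor, which by the
  Newlander--Nirenberg theorem amounts to \<open>J\<close> coming from a complex structure.
\<close>

definition integrable_structure ::
  "('m::topological_space, 'e::euclidean_space) atlas \<Rightarrow> 'm tensor11 \<Rightarrow> bool" where
  "integrable_structure \<A> J \<longleftrightarrow> almost_complex \<A> J \<and>
     (\<forall>X Y. smooth_vfield \<A> X \<longrightarrow> smooth_vfield \<A> Y \<longrightarrow> nijenhuis J X Y = 0)"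

section \<open>Lie algebras and Lie groups\<close>

definition lie_algebra :: "('l::real_vector \<Rightarrow> 'l \<Rightarrow> 'l) \<Rightarrow> bool" where
  "lie_algebra br \<longleftrightarrow> bilinear br \<and> (\<forall>a. br a a = 0) \<and>
     (\<forall>a b c. br a (br b c) + br b (br c a) + br c (br a b) = 0)"

definition is_basis :: "('k \<Rightarrow> 'l::real_vector) \<Rightarrow> bool" where
  "is_basis \<xi> \<longleftrightarrow> inj \<xi> \<and> independent (range \<xi>) \<and> span (range \<xi>) = UNIV"

definition lie_algebra_hom ::
  "('l::real_vector \<Rightarrow> 'l \<Rightarrow> 'l) \<Rightarrow> ('m::topological_space, 'e::euclidean_space) atlas \<Rightarrow>
   ('l \<Rightarrow> 'm vfield) \<Rightarrow> bool" where
  "lie_algebra_hom br \<A> h \<longleftrightarrow> linear h \<and> (\<forall>a. smooth_vfield \<A> (h a)) \<and>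
     (\<forall>a b. h (br a b) = lie_bracket (h a) (h b))"

definition lie_group ::
  "('g::{t2_space,second_countable_topology}, 'f::euclidean_space) atlas \<Rightarrow>
   ('g \<Rightarrow> 'g \<Rightarrow> 'g) \<Rightarrow> 'g \<Rightarrow> ('g \<Rightarrow> 'g) \<Rightarrow> bool" where
  "lie_group \<G> mul e iv \<longleftrightarrow> smooth_manifold \<G> \<and> group mul e iv \<and>
     smooth_map (prod_atlas \<G> \<G>) \<G> (\<lambda>(g, h). mul g h) \<and> smooth_map \<G> \<G> iv"

definition left_invariant_fields ::
  "('g::topological_space, 'f::euclidean_space) atlas \<Rightarrow> ('g \<Rightarrow> 'g \<Rightarrow> 'g) \<Rightarrow> 'g vfield set" where
  "left_invariant_fields \<G> mul = {X. smooth_vfield \<G> X \<and>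
     (\<forall>g h. differential \<G> \<G> (mul g) (X h) = X (mul g h))}"

text \<open>\<open>\<iota>\<close> identifies the abstract Lie algebra with the Lie algebra of left-invariant vector fields.\<close>

definition has_lie_algebra ::
  "('g::topological_space, 'f::euclidean_space) atlas \<Rightarrow> ('g \<Rightarrow> 'g \<Rightarrow> 'g) \<Rightarrow>
   ('l::real_vector \<Rightarrow> 'l \<Rightarrow> 'l) \<Rightarrow> ('l \<Rightarrow> 'g vfield) \<Rightarrow> bool" where
  "has_lie_algebra \<G> mul br \<iota> \<longleftrightarrow> lie_algebra_hom br \<G> \<iota> \<and>
     bij_betw \<iota> UNIV (left_invariant_fields \<G> mul)"

section \<open>f-structures with parallelisable kernel\<close>

definition ker_at ::
  "('m::topological_space, 'e::euclidean_space) atlas \<Rightarrow> 'm tensor11 \<Rightarrow> 'm \<Rightarrow> 'm tvec set" where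
  "ker_at \<A> \<phi> p = {v \<in> tangent_space \<A> p. \<phi> p v = 0}"

definition im_at ::
  "('m::topological_space, 'e::euclidean_space) atlas \<Rightarrow> 'm tensor11 \<Rightarrow> 'm \<Rightarrow> 'm tvec set" where
  "im_at \<A> \<phi> p = \<phi> p ` tangent_space \<A> p"

definition f_structure ::
  "('m::topological_space, 'e::euclidean_space) atlas \<Rightarrow> 'm tensor11 \<Rightarrow> bool" where
  "f_structure \<A> \<phi> \<longleftrightarrow> smooth_tensor11 \<A> \<phi> \<and>
     (\<forall>p. \<forall>v\<in>tangent_space \<A> p. \<phi> p (\<phi> p (\<phi> p v)) + \<phi> p v = 0)"

definition f_pk_structure ::
  "('m::topological_space, 'e::euclidean_space) atlas \<Rightarrow> 'm tensor11 \<Rightarrow>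
   ('k::finite \<Rightarrow> 'm vfield) \<Rightarrow> bool" where
  "f_pk_structure \<A> \<phi> \<Xi> \<longleftrightarrow> f_structure \<A> \<phi> \<and> (\<forall>i. smooth_vfield \<A> (\<Xi> i)) \<and>
     (\<forall>p. inj (\<lambda>i. \<Xi> i p) \<and> independent (range (\<lambda>i. \<Xi> i p)) \<and>
        span (range (\<lambda>i. \<Xi> i p)) = ker_at \<A> \<phi> p)"

definition f_pk_g_structure ::
  "('m::topological_space, 'e::euclidean_space) atlas \<Rightarrow> 'm tensor11 \<Rightarrow>
   ('l::real_vector \<Rightarrow> 'l \<Rightarrow> 'l) \<Rightarrow> ('k::finite \<Rightarrow> 'l) \<Rightarrow> ('l \<Rightarrow> 'm vfield) \<Rightarrow>
   ('k \<Rightarrow> 'm vfield) \<Rightarrow> bool" where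
  "f_pk_g_structure \<A> \<phi> br \<xi> star \<Xi> \<longleftrightarrow> f_pk_structure \<A> \<phi> \<Xi> \<and>
     lie_algebra br \<and> is_basis \<xi> \<and> lie_algebra_hom br \<A> star \<and> inj star \<and>
     (\<forall>p. span (range (\<lambda>a. star a p)) = ker_at \<A> \<phi> p) \<and> (\<forall>i. star (\<xi> i) = \<Xi> i)"

text \<open>
  If the tangent spaces split as the span of the frame \<open>\<Xi>\<close> plus a distribution \<open>D\<close>, then
  \<open>coframe \<Xi> D i\<close> is the one-form dual to \<open>\<Xi> i\<close> that vanishes on \<open>D\<close>.
\<close>

definition coframe ::
  "('k::finite \<Rightarrow> 'm vfield) \<Rightarrow> ('m \<Rightarrow> 'm tvec set) \<Rightarrow> 'k \<Rightarrow> 'm form1" where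
  "coframe \<Xi> D i p v = (THE a. \<exists>c. c i = a \<and> v - (\<Sum>j\<in>UNIV. c j *\<^sub>R \<Xi> j p) \<in> D p)"

definition eta ::
  "('m::topological_space, 'e::euclidean_space) atlas \<Rightarrow> 'm tensor11 \<Rightarrow>
   ('k::finite \<Rightarrow> 'm vfield) \<Rightarrow> 'k \<Rightarrow> 'm form1" where
  "eta \<A> \<phi> \<Xi> = coframe \<Xi> (im_at \<A> \<phi>)"

definition lambda :: "('k::finite \<Rightarrow> 'g vfield) \<Rightarrow> 'k \<Rightarrow> 'g form1" where
  "lambda \<Lambda> = coframe \<Lambda> (\<lambda>_. {0})"

text \<open>As \<open>\<phi>\<close> vanishes on the frame, \<open>phi_hat\<close> is \<open>\<phi>\<close> on \<open>im \<phi>\<close> and the rotation on the frame.\<close>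

definition phi_hat ::
  "('m::topological_space, 'e::euclidean_space) atlas \<Rightarrow> 'm tensor11 \<Rightarrow>
   (3 \<Rightarrow> 'm vfield) \<Rightarrow> 'm tensor11" where
  "phi_hat \<A> \<phi> \<Xi> p v =
     \<phi> p v + eta \<A> \<phi> \<Xi> 1 p v *\<^sub>R \<Xi> 2 p - eta \<A> \<phi> \<Xi> 2 p v *\<^sub>R \<Xi> 1 p"

definition psi :: "(3 \<Rightarrow> 'g vfield) \<Rightarrow> 'g tensor11" where
  "psi \<Lambda> g w = lambda \<Lambda> 1 g w *\<^sub>R \<Lambda> 2 g - lambda \<Lambda> 2 g w *\<^sub>R \<Lambda> 1 g"

definition pair_tvec ::
  "('m::topological_space, 'e::euclidean_space) atlas \<Rightarrow>
   ('g::topological_space, 'f::euclidean_space) atlas \<Rightarrow>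
   'm \<times> 'g \<Rightarrow> 'm tvec \<Rightarrow> 'g tvec \<Rightarrow> ('m \<times> 'g) tvec" where
  "pair_tvec \<A> \<G> = (\<lambda>(p, g) v w.
     differential \<A> (prod_atlas \<A> \<G>) (\<lambda>q. (q, g)) v +
     differential \<G> (prod_atlas \<A> \<G>) (\<lambda>h. (p, h)) w)"

definition J_hat ::
  "('m::topological_space, 'e::euclidean_space) atlas \<Rightarrow>
   ('g::topological_space, 'f::euclidean_space) atlas \<Rightarrow>
   'm tensor11 \<Rightarrow> (3 \<Rightarrow> 'm vfield) \<Rightarrow> (3 \<Rightarrow> 'g vfield) \<Rightarrow> ('m \<times> 'g) tensor11" where
  "J_hat \<A> \<G> \<phi> \<Xi> \<Lambda> = (\<lambda>(p, g) u.
     let v = differential (prod_atlas \<A> \<G>) \<A> fst u;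
         w = differential (prod_atlas \<A> \<G>) \<G> snd u
     in pair_tvec \<A> \<G> (p, g)
          (phi_hat \<A> \<phi> \<Xi> p v - lambda \<Lambda> 3 g w *\<^sub>R \<Xi> 3 p)
          (psi \<Lambda> g w + eta \<A> \<phi> \<Xi> 3 p v *\<^sub>R \<Lambda> 3 g))"

section \<open>The defining properties of the coframe and of the tensors\<close>

lemma coframe_eqI:
  fixes \<Xi> :: "'k::finite \<Rightarrow> 'm vfield"
  assumes inj: "inj (\<lambda>i. \<Xi> i p)" and indep: "independent (range (\<lambda>i. \<Xi> i p))"
    and D: "subspace (D p)" and int: "D p \<inter> span (range (\<lambda>i. \<Xi> i p)) = {0}"
    and v: "v - (\<Sum>j\<in>UNIV. c j *\<^sub>R \<Xi> j p) \<in> D p"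
  shows "coframe \<Xi> D i p v = c i"
  unfolding coframe_def
proof (rule the_equality)
  show "\<exists>c'. c' i = c i \<and> v - (\<Sum>j\<in>UNIV. c' j *\<^sub>R \<Xi> j p) \<in> D p" using v by blast
next
  fix a assume "\<exists>c'. c' i = a \<and> v - (\<Sum>j\<in>UNIV. c' j *\<^sub>R \<Xi> j p) \<in> D p"
  then obtain c' where a: "c' i = a" and c': "v - (\<Sum>j\<in>UNIV. c' j *\<^sub>R \<Xi> j p) \<in> D p" by blast
  let ?s = "\<Sum>j\<in>UNIV. (c' j - c j) *\<^sub>R \<Xi> j p"
  have "?s = (v - (\<Sum>j\<in>UNIV. c j *\<^sub>R \<Xi> j p)) - (v - (\<Sum>j\<in>UNIV. c' j *\<^sub>R \<Xi> j p))"
    by (simp add: scaleR_left_diff_distrib sum_subtractf)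
  then have "?s \<in> D p" using subspace_diff[OF D v c'] by simp
  moreover have "?s \<in> span (range (\<lambda>i. \<Xi> i p))"
    by (intro span_sum span_scale span_base) auto
  ultimately have s0: "?s = 0" using int by blast
  let ?k = "\<lambda>x. c' (inv (\<lambda>i. \<Xi> i p) x) - c (inv (\<lambda>i. \<Xi> i p) x)"
  have "(\<Sum>x\<in>range (\<lambda>i. \<Xi> i p). ?k x *\<^sub>R x) = ?s"
    by (subst sum.reindex[OF inj]) (simp add: inv_f_f[OF inj])
  then have "?k (\<Xi> i p) = 0"
    using s0 independentD[OF indep, where u = ?k and t = "range (\<lambda>i. \<Xi> i p)" and v = "\<Xi> i p"]
    by simp
  then show "a = c i" using a inv_f_f[OF inj, of i] by simp
qed

lemma subspace_tangent_space: "subspace (tangent_space \<A> p)"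
  by (rule subspaceI)
     (auto simp: tangent_space_def zero_fun_def plus_fun_def scaleR_fun_def algebra_simps)

context
  fixes \<A> :: "('m::topological_space, 'e::euclidean_space) atlas" and \<phi> :: "'m tensor11"
    and \<Xi> :: "'k::finite \<Rightarrow> 'm vfield"
  assumes fpk: "f_pk_structure \<A> \<phi> \<Xi>"
begin

lemma fpk_facts:
  shows "inj (\<lambda>i. \<Xi> i p)" "independent (range (\<lambda>i. \<Xi> i p))"
    "span (range (\<lambda>i. \<Xi> i p)) = ker_at \<A> \<phi> p"
    "u \<in> tangent_space \<A> p \<Longrightarrow> \<phi> p u \<in> tangent_space \<A> p"
    "u \<in> tangent_space \<A> p \<Longrightarrow> v \<in> tangent_space \<A> p \<Longrightarrow> \<phi> p (u + v) = \<phi> p u + \<phi> p v"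
    "u \<in> tangent_space \<A> p \<Longrightarrow> \<phi> p (c *\<^sub>R u) = c *\<^sub>R \<phi> p u"
    "u \<in> tangent_space \<A> p \<Longrightarrow> \<phi> p (\<phi> p (\<phi> p u)) + \<phi> p u = 0"
  using fpk unfolding f_pk_structure_def f_structure_def smooth_tensor11_def by auto

lemma subspace_im_at: "subspace (im_at \<A> \<phi> p)"
proof (rule subspaceI)
  have z: "0 \<in> tangent_space \<A> p" using subspace_tangent_space by (rule subspace_0)
  show "0 \<in> im_at \<A> \<phi> p" using fpk_facts(6)[OF z, of 0] z by (auto simp: im_at_def)
next
  fix x y assume "x \<in> im_at \<A> \<phi> p" "y \<in> im_at \<A> \<phi> p"
  then obtain u v where "u \<in> tangent_space \<A> p" "v \<in> tangent_space \<A> p" "x = \<phi> p u" "y = \<phi> p v"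
    by (auto simp: im_at_def)
  then show "x + y \<in> im_at \<A> \<phi> p"
    using fpk_facts(5)[of u p v] subspace_add[OF subspace_tangent_space, of u \<A> p v]
    unfolding im_at_def by (metis image_eqI)
next
  fix c x assume "x \<in> im_at \<A> \<phi> p"
  then obtain u where "u \<in> tangent_space \<A> p" "x = \<phi> p u" by (auto simp: im_at_def)
  then show "c *\<^sub>R x \<in> im_at \<A> \<phi> p"
    using fpk_facts(6)[of u p c] subspace_scale[OF subspace_tangent_space, of u \<A> p c]
    unfolding im_at_def by (metis image_eqI)
qed

lemma im_inter_ker: "im_at \<A> \<phi> p \<inter> span (range (\<lambda>i. \<Xi> i p)) = {0}"
proof -
  have "x = 0" if x: "x \<in> im_at \<A> \<phi> p" "x \<in> ker_at \<A> \<phi> p" for x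
  proof -
    obtain u where u: "u \<in> tangent_space \<A> p" "x = \<phi> p u" using x(1) by (auto simp: im_at_def)
    have z: "\<phi> p 0 = 0"
      using fpk_facts(6)[OF subspace_0[OF subspace_tangent_space], of p 0] by simp
    have "\<phi> p x = 0" using x(2) by (simp add: ker_at_def)
    then show "x = 0" using fpk_facts(7)[OF u(1)] u(2) z by simp
  qed
  then show ?thesis
    using fpk_facts(3) subspace_0[OF subspace_im_at] span_0 by blast
qed

lemma eta_eqI:
  assumes "v - (\<Sum>j\<in>UNIV. c j *\<^sub>R \<Xi> j p) \<in> im_at \<A> \<phi> p"
  shows "eta \<A> \<phi> \<Xi> i p v = c i"
  unfolding eta_def
  by (rule coframe_eqI[where \<Xi> = \<Xi> and p = p and c = c])
     (rule fpk_facts subspace_im_at im_inter_ker assms)+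

lemma eta_frame: "eta \<A> \<phi> \<Xi> i p (\<Xi> j p) = (if i = j then 1 else 0)"
proof -
  have "(\<Sum>l\<in>UNIV. (if l = j then 1 else 0::real) *\<^sub>R \<Xi> l p) = \<Xi> j p"
    by (subst sum.remove[of UNIV j]) auto
  then show ?thesis
    using eta_eqI[of "\<Xi> j p" "\<lambda>l. if l = j then 1 else 0" p i] subspace_0[OF subspace_im_at]
    by simp
qed

lemma eta_im: "v \<in> im_at \<A> \<phi> p \<Longrightarrow> eta \<A> \<phi> \<Xi> i p v = 0"
  using eta_eqI[of v "\<lambda>_. 0" p i] by simp

lemma eta_decomp:
  assumes v: "v \<in> tangent_space \<A> p"
  shows "v - (\<Sum>j\<in>UNIV. eta \<A> \<phi> \<Xi> j p v *\<^sub>R \<Xi> j p) \<in> im_at \<A> \<phi> p"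
proof -
  let ?T = "tangent_space \<A> p"
  let ?w = "v + \<phi> p (\<phi> p v)"
  have t: "\<phi> p v \<in> ?T" "\<phi> p (\<phi> p v) \<in> ?T" using v fpk_facts(4) by blast+
  have "?w \<in> ?T" using subspace_add[OF subspace_tangent_space v t(2)] .
  moreover have "\<phi> p ?w = 0"
    using fpk_facts(5)[OF v t(2)] fpk_facts(7)[OF v] by (simp add: add.commute)
  ultimately have "?w \<in> span (range (\<lambda>i. \<Xi> i p))" by (simp add: fpk_facts(3) ker_at_def)
  then obtain k where k: "?w = (\<Sum>x\<in>range (\<lambda>i. \<Xi> i p). k x *\<^sub>R x)"
    by (auto simp: span_finite)
  define c where "c j = k (\<Xi> j p)" for j
  have w: "?w = (\<Sum>j\<in>UNIV. c j *\<^sub>R \<Xi> j p)"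
    using k by (subst (asm) sum.reindex[OF fpk_facts(1)]) (simp add: c_def)
  have "v - (\<Sum>j\<in>UNIV. c j *\<^sub>R \<Xi> j p) = (-1) *\<^sub>R \<phi> p (\<phi> p v)"
    unfolding w[symmetric] by simp
  also have "\<dots> \<in> im_at \<A> \<phi> p"
    by (rule subspace_scale[OF subspace_im_at]) (use t(1) in \<open>auto simp: im_at_def\<close>)
  finally have *: "v - (\<Sum>j\<in>UNIV. c j *\<^sub>R \<Xi> j p) \<in> im_at \<A> \<phi> p" .
  then show ?thesis using eta_eqI[OF *] by simp
qed

end

lemma phi_hat_im:
  assumes "f_pk_structure \<A> \<phi> \<Xi>" "v \<in> im_at \<A> \<phi> p"
  shows "phi_hat \<A> \<phi> \<Xi> p v = \<phi> p v"
  using eta_im[OF assms] by (simp add: phi_hat_def)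

lemma phi_hat_frame:
  assumes "f_pk_structure \<A> \<phi> \<Xi>"
  shows "phi_hat \<A> \<phi> \<Xi> p (\<Xi> 1 p) = \<Xi> 2 p" "phi_hat \<A> \<phi> \<Xi> p (\<Xi> 2 p) = - \<Xi> 1 p"
    "phi_hat \<A> \<phi> \<Xi> p (\<Xi> 3 p) = 0"
proof -
  have "\<Xi> i p \<in> ker_at \<A> \<phi> p" for i
    using span_base[of "\<Xi> i p" "range (\<lambda>i. \<Xi> i p)"] fpk_facts(3)[OF assms] by auto
  then have "\<phi> p (\<Xi> i p) = 0" for i by (simp add: ker_at_def)
  then show "phi_hat \<A> \<phi> \<Xi> p (\<Xi> 1 p) = \<Xi> 2 p" "phi_hat \<A> \<phi> \<Xi> p (\<Xi> 2 p) = - \<Xi> 1 p"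
    "phi_hat \<A> \<phi> \<Xi> p (\<Xi> 3 p) = 0"
    by (simp_all add: phi_hat_def eta_frame[OF assms])
qed

lemma psi_frame:
  assumes "inj (\<lambda>i. \<Lambda> i g)" "independent (range (\<lambda>i. \<Lambda> i g))"
  shows "psi \<Lambda> g (\<Lambda> 1 g) = \<Lambda> 2 g" "psi \<Lambda> g (\<Lambda> 2 g) = - \<Lambda> 1 g" "psi \<Lambda> g (\<Lambda> 3 g) = 0"
proof -
  have "lambda \<Lambda> i g (\<Lambda> j g) = (if i = j then 1 else 0)" for i j
  proof -
    have s: "(\<Sum>l\<in>UNIV. (if l = j then 1 else 0::real) *\<^sub>R \<Lambda> l g) = \<Lambda> j g"
      by (subst sum.remove[of UNIV j]) auto
    show ?thesis unfolding lambda_def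
      by (subst coframe_eqI[where c = "\<lambda>l. if l = j then 1 else 0"])
         (use assms s in \<open>auto simp: span_0 subspace_def\<close>)
  qed
  then show "psi \<Lambda> g (\<Lambda> 1 g) = \<Lambda> 2 g" "psi \<Lambda> g (\<Lambda> 2 g) = - \<Lambda> 1 g" "psi \<Lambda> g (\<Lambda> 3 g) = 0"
    by (simp_all add: psi_def)
qed

end

theory Submission
  imports Defs
begin

text \<open>
  Both \<open>(phi_hat, \<eta>\<^sub>3, \<Xi>\<^sub>3)\<close> on \<open>M\<close> and \<open>(\<psi>, \<lambda>\<^sub>3, \<Lambda>\<^sub>3)\<close> on \<open>G\<close> are almost contact structures, and \<open>J_hat\<close> is
  the almost complex structure of their product. For fields \<open>X, Y\<close> on \<open>M\<close> one finds
  \<open>[J,J](X, Y) = S(X, Y) + T(X, Y) \<Lambda>\<^sub>3\<close> with \<open>S = [phi_hat,phi_hat] + d\<eta>\<^sub>3 \<otimes> \<Xi>\<^sub>3\<close> and a function \<open>T(X, Y)\<close>, so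
  integrability forces \<open>S = 0\<close>. Conversely let \<open>S = 0\<close>. From \<open>[J,J](J X, Y) = - J [J,J](X, Y)\<close> and
  \<open>J \<Xi>\<^sub>3 = \<Lambda>\<^sub>3\<close> it follows that \<open>T(X, Y) = \<eta>\<^sub>3(X) T(\<Xi>\<^sub>3, Y)\<close>, and \<open>T = 0\<close> by skew symmetry. As also
  \<open>\<Lambda>\<^sub>2 = J \<Lambda>\<^sub>1\<close>, only \<open>[J,J](X, \<Lambda>\<^sub>1) = \<eta>\<^sub>3(X) ([\<Lambda>\<^sub>3,\<Lambda>\<^sub>2] - J [\<Lambda>\<^sub>3,\<Lambda>\<^sub>1])\<close> remains. It vanishes because
  \<open>S(\<Xi>\<^sub>3, \<Xi>\<^sub>1) = S(\<Xi>\<^sub>3, \<Xi>\<^sub>2) = 0\<close> constrains the structure constants, which the frames \<open>\<Xi>\<close> and \<open>\<Lambda>\<close> share.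

  Tangent vectors are derivations of globally defined smooth functions. Hadamard's lemma and cut-off
  functions provide local frames, which give the smoothness of \<open>J_hat\<close> and of the lifts to \<open>M \<times> G\<close>, and
  reduce the vanishing of \<open>[J,J]\<close> to lifted fields.
\<close>

section \<open>Calculus of smooth functions on open sets\<close>

text \<open>Why one commutator decides the converse: for fixed \<open>V\<close> the fields
  \<open>U\<close> with \<open>[J,J](U, V) = 0\<close> form a function module closed under
  \<open>J\<close>. Since \<open>\<Lambda>\<^sub>2 = J \<Lambda>\<^sub>1\<close> and
  \<open>\<Lambda>\<^sub>3 = J \<Xi>\<^sub>3\<close>, dimension three of G leaves
  \<open>\<Lambda>\<^sub>1\<close> as the only complex direction that lifts from M do not reach, and
  skew symmetry settles \<open>\<Lambda>\<^sub>1\<close> against itself. The constraint on the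
  structure constants is that ad \<open>\<xi>\<^sub>3\<close> maps the plane of
  \<open>\<xi>\<^sub>1, \<xi>\<^sub>2\<close> into itself and commutes there with the quarter turn.
  Being a property of the Lie algebra, it can be read off at one point of M and used on all of G.
  The obstacle on the analytic side is that coordinates and coordinate fields exist only locally,
  while derivations accept only global functions. Expansions are therefore cleared of denominators:
  the expanded object is multiplied by a function that is nonzero at the point considered, and
  linearity over functions allows division by it afterwards.\<close>

lemma Ck_on_cong:
  assumes "open S" "\<And>x. x \<in> S \<Longrightarrow> f x = g x"
  shows "Ck_on k S f \<longleftrightarrow> Ck_on k S g"
  using assms(2)
proof (induction k arbitrary: f g)
  case 0 then show ?case by (auto intro: continuous_on_cong)
next
  case (Suc k)
  have d: "f differentiable (at x) \<longleftrightarrow> g differentiable (at x)" if "x \<in> S" for x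
    unfolding differentiable_def
    using has_derivative_transform_within_open[OF _ assms(1) that, of f _ UNIV g]
      has_derivative_transform_within_open[OF _ assms(1) that, of g _ UNIV f] Suc.prems by metis
  have "Ck_on k S (\<lambda>x. frechet_derivative f (at x) v) \<longleftrightarrow>
        Ck_on k S (\<lambda>x. frechet_derivative g (at x) v)" if "\<forall>x\<in>S. f differentiable (at x)" for v
    by (rule Suc.IH, subst frechet_derivative_transform_within_open[of f _ S g])
       (use that assms(1) Suc.prems in auto)
  then show ?case using d by auto
qed

lemma Ck_on_subset: "Ck_on k S f \<Longrightarrow> T \<subseteq> S \<Longrightarrow> Ck_on k T f"
  by (induction k arbitrary: f) (auto intro: continuous_on_subset)

lemma Ck_on_local:
  assumes "\<And>x. x \<in> S \<Longrightarrow> \<exists>T. open T \<and> x \<in> T \<and> Ck_on k T f"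
  shows "Ck_on k S f"
  using assms
proof (induction k arbitrary: f)
  case 0
  have "isCont f x" if "x \<in> S" for x
    using 0[OF that] continuous_on_eq_continuous_at by auto
  then show ?case by (simp add: continuous_at_imp_continuous_on)
next
  case (Suc k)
  have "Ck_on k S (\<lambda>x. frechet_derivative f (at x) v)" for v
    by (rule Suc.IH) (use Suc.prems in fastforce)
  moreover have "f differentiable (at x)" if "x \<in> S" for x
    using Suc.prems[OF that] by auto
  ultimately show ?case by auto
qed

text \<open>Accepts any family of derivatives, so that inductions on \<open>k\<close> can work with
  the formula that a differentiation rule produces instead of
  \<open>frechet_derivative\<close>.\<close>

lemma Ck_on_SucI:
  assumes "open S" "\<And>x. x \<in> S \<Longrightarrow> (f has_derivative f' x) (at x)"
    and "\<And>v. Ck_on k S (\<lambda>x. f' x v)"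
  shows "Ck_on (Suc k) S f"
proof -
  have "Ck_on k S (\<lambda>x. frechet_derivative f (at x) v)" for v
    using assms(3)[of v]
    by (rule Ck_on_cong[OF assms(1), THEN iffD1, rotated]) (simp add: frechet_derivative_at[OF assms(2)])
  then show ?thesis using assms(2) by (auto simp: differentiable_def)
qed

lemma Ck_on_SucD:
  assumes "Ck_on (Suc k) S f"
  shows "Ck_on k S f" "x \<in> S \<Longrightarrow> (f has_derivative frechet_derivative f (at x)) (at x)"
    "Ck_on k S (\<lambda>x. frechet_derivative f (at x) v)"
proof -
  show "Ck_on k S f" using assms
  proof (induction k arbitrary: f)
    case 0 then show ?case
      by (auto intro!: continuous_at_imp_continuous_on differentiable_imp_continuous_within)
  next
    case (Suc k) then show ?case by (metis Ck_on.simps(2))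
  qed
qed (use assms in \<open>auto simp: frechet_derivative_works[symmetric]\<close>)

lemma Ck_on_continuous: "Ck_on k S f \<Longrightarrow> continuous_on S f"
  by (induction k) (auto dest: Ck_on_SucD(1) simp del: Ck_on.simps(2))

lemma Ck_on_const: "open S \<Longrightarrow> Ck_on k S (\<lambda>x. c)"
proof (induction k arbitrary: c)
  case (Suc k) then show ?case by (auto intro!: Ck_on_SucI[where f' = "\<lambda>_ _. 0"])
qed auto

lemma Ck_on_bounded_linear: "open S \<Longrightarrow> bounded_linear f \<Longrightarrow> Ck_on k S f"
proof (cases k)
  case (Suc k)
  assume "open S" "bounded_linear f"
  then show ?thesis unfolding Suc
    by (intro Ck_on_SucI[where f' = "\<lambda>_. f"] Ck_on_const bounded_linear_imp_has_derivative)
qed (auto intro: linear_continuous_on)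

lemma Ck_on_add: "open S \<Longrightarrow> Ck_on k S f \<Longrightarrow> Ck_on k S g \<Longrightarrow> Ck_on k S (\<lambda>x. f x + g x)"
proof (induction k arbitrary: f g)
  case (Suc k)
  show ?case
    by (rule Ck_on_SucI[where f' = "\<lambda>x v. frechet_derivative f (at x) v + frechet_derivative g (at x) v"])
       (intro has_derivative_add Suc.IH Suc.prems(1) Ck_on_SucD(2,3)[OF Suc.prems(2)]
          Ck_on_SucD(2,3)[OF Suc.prems(3)]; assumption)+
qed (auto intro: continuous_on_add)

lemma Ck_on_sum:
  assumes "open S" "\<And>i. i \<in> I \<Longrightarrow> Ck_on k S (f i)"
  shows "Ck_on k S (\<lambda>x. \<Sum>i\<in>I. f i x)"
  using assms(2) by (induction I rule: infinite_finite_induct) (auto intro!: Ck_on_const Ck_on_add assms(1))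

text \<open>Both summands of the product rule have the shape \<open>B _ _\<close> again, so an
  induction hypothesis for arbitrary factors applies to them. Products, scalar multiples and inner
  products are instances.\<close>

lemma Ck_on_bilinear:
  assumes "bounded_bilinear B" "open S" "Ck_on k S f" "Ck_on k S g"
  shows "Ck_on k S (\<lambda>x. B (f x) (g x))"
  using assms(3,4)
proof (induction k arbitrary: f g)
  case 0 then show ?case by (auto intro: bounded_bilinear.continuous_on[OF assms(1)])
next
  case (Suc k)
  show ?case
  proof (rule Ck_on_SucI[OF assms(2)])
    show "((\<lambda>x. B (f x) (g x)) has_derivative
        (\<lambda>v. B (f x) (frechet_derivative g (at x) v) + B (frechet_derivative f (at x) v) (g x))) (at x)"
      if "x \<in> S" for x
      by (intro bounded_bilinear.FDERIV[OF assms(1)] Ck_on_SucD(2)[OF Suc.prems(1) that]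
          Ck_on_SucD(2)[OF Suc.prems(2) that])
    show "Ck_on k S (\<lambda>x. B (f x) (frechet_derivative g (at x) v) + B (frechet_derivative f (at x) v) (g x))" for v
      by (intro Ck_on_add[OF assms(2)] Suc.IH Ck_on_SucD(1)[OF Suc.prems(1)] Ck_on_SucD(1)[OF Suc.prems(2)]
          Ck_on_SucD(3)[OF Suc.prems(1)] Ck_on_SucD(3)[OF Suc.prems(2)])
  qed
qed

text \<open>\<open>Ck_on\<close> controls derivatives in fixed directions only, whereas the chain
  rule produces the derivative of \<open>f\<close> in a direction that moves with \<open>x\<close>.
  Expanding this direction in the basis of the middle space leaves products of fixed-direction
  derivatives, which the bilinear case handles.\<close>

lemma Ck_on_compose:
  fixes g :: "'a::real_normed_vector \<Rightarrow> 'b::euclidean_space"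
  assumes "open S" "open T" "g ` S \<subseteq> T" "Ck_on k T f" "Ck_on k S g"
  shows "Ck_on k S (\<lambda>x. f (g x))"
  using assms(4,5)
proof (induction k arbitrary: f)
  case 0
  then show ?case using assms(3) by (auto intro: continuous_on_compose2)
next
  case (Suc k)
  let ?Df = "\<lambda>y. frechet_derivative f (at y)" and ?Dg = "\<lambda>x. frechet_derivative g (at x)"
  have lin: "linear (?Df (g x))" if "x \<in> S" for x
    using Suc.prems(1) assms(3) that by (auto intro!: linear_frechet_derivative)
  show ?case
  proof (rule Ck_on_SucI[OF assms(1)])
    fix x assume x: "x \<in> S"
    then have gx: "g x \<in> T" using assms(3) by auto
    have "((\<lambda>x. f (g x)) has_derivative (\<lambda>v. ?Df (g x) (?Dg x v))) (at x)"
      using diff_chain_at[OF Ck_on_SucD(2)[OF Suc.prems(2) x] Ck_on_SucD(2)[OF Suc.prems(1) gx]]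
      by (simp add: o_def)
    moreover have "?Df (g x) (?Dg x v) = (\<Sum>b\<in>Basis. (?Dg x v \<bullet> b) *\<^sub>R ?Df (g x) b)" for v
    proof -
      have "?Df (g x) (?Dg x v) = ?Df (g x) (\<Sum>b\<in>Basis. (?Dg x v \<bullet> b) *\<^sub>R b)"
        by (simp add: euclidean_representation)
      then show ?thesis by (simp add: linear_sum[OF lin[OF x]] linear_scale[OF lin[OF x]])
    qed
    ultimately show "((\<lambda>x. f (g x)) has_derivative
        (\<lambda>v. \<Sum>b\<in>Basis. (?Dg x v \<bullet> b) *\<^sub>R ?Df (g x) b)) (at x)" by simp
  next
    fix v
    show "Ck_on k S (\<lambda>x. \<Sum>b\<in>Basis. (?Dg x v \<bullet> b) *\<^sub>R ?Df (g x) b)"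
    proof (intro Ck_on_sum Ck_on_bilinear[OF bounded_bilinear_scaleR] assms(1))
      fix b :: 'b
      show "Ck_on k S (\<lambda>x. ?Dg x v \<bullet> b)"
        by (intro Ck_on_bilinear[OF bounded_bilinear_inner] assms(1) Ck_on_const Ck_on_SucD(3)[OF Suc.prems(2)])
      show "Ck_on k S (\<lambda>x. ?Df (g x) b)"
        by (rule Suc.IH[OF Ck_on_SucD(3)[OF Suc.prems(1)] Ck_on_SucD(1)[OF Suc.prems(2)]])
    qed
  qed
qed

text \<open>The derivative of 1/f is built from 1/f and one derivative of f, so order k for 1/f
  yields order k + 1.\<close>

lemma Ck_on_inverse:
  fixes f :: "'a::real_normed_vector \<Rightarrow> real"
  assumes "open S" "Ck_on k S f" "\<And>x. x \<in> S \<Longrightarrow> f x \<noteq> 0"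
  shows "Ck_on k S (\<lambda>x. inverse (f x))"
  using assms(2)
proof (induction k)
  case 0 then show ?case using assms(3) by (auto intro!: continuous_on_inverse)
next
  case (Suc k)
  note IH = Suc.IH[OF Ck_on_SucD(1)[OF Suc.prems]]
  show ?case
  proof (rule Ck_on_SucI[OF assms(1)])
    show "((\<lambda>x. inverse (f x)) has_derivative
        (\<lambda>v. (- 1 * (inverse (f x) * inverse (f x))) * frechet_derivative f (at x) v)) (at x)" if "x \<in> S" for x
      using has_derivative_inverse'[OF assms(3)[OF that], THEN has_derivative_compose[OF Ck_on_SucD(2)[OF Suc.prems that]]]
      by (simp add: algebra_simps)
    show "Ck_on k S (\<lambda>x. (- 1 * (inverse (f x) * inverse (f x))) * frechet_derivative f (at x) v)" for v
      by (intro Ck_on_bilinear[OF bounded_bilinear_mult] IH Ck_on_const assms(1) Ck_on_SucD(3)[OF Suc.prems])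
  qed
qed

lemma smooth_on_cong: "open S \<Longrightarrow> (\<And>x. x \<in> S \<Longrightarrow> f x = g x) \<Longrightarrow> smooth_on S f \<longleftrightarrow> smooth_on S g"
  unfolding smooth_on_def using Ck_on_cong by blast

lemma smooth_on_subset: "smooth_on S f \<Longrightarrow> T \<subseteq> S \<Longrightarrow> smooth_on T f"
  unfolding smooth_on_def using Ck_on_subset by blast

lemma smooth_on_local:
  assumes "\<And>x. x \<in> S \<Longrightarrow> \<exists>T. open T \<and> x \<in> T \<and> smooth_on T f"
  shows "smooth_on S f"
  unfolding smooth_on_def
proof (intro allI Ck_on_local)
  show "\<exists>T. open T \<and> x \<in> T \<and> Ck_on k T f" if "x \<in> S" for x k
    using assms[OF that] by (auto simp: smooth_on_def)
qed

lemma smooth_on_const: "open S \<Longrightarrow> smooth_on S (\<lambda>x. c)"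
  by (simp add: smooth_on_def Ck_on_const)

lemma smooth_on_bounded_linear: "open S \<Longrightarrow> bounded_linear f \<Longrightarrow> smooth_on S f"
  by (simp add: smooth_on_def Ck_on_bounded_linear)

lemma smooth_on_add: "open S \<Longrightarrow> smooth_on S f \<Longrightarrow> smooth_on S g \<Longrightarrow> smooth_on S (\<lambda>x. f x + g x)"
  by (simp add: smooth_on_def Ck_on_add)

lemma smooth_on_mult:
  fixes f g :: "'a::real_normed_vector \<Rightarrow> real"
  shows "open S \<Longrightarrow> smooth_on S f \<Longrightarrow> smooth_on S g \<Longrightarrow> smooth_on S (\<lambda>x. f x * g x)"
  by (simp add: smooth_on_def Ck_on_bilinear[OF bounded_bilinear_mult])

lemma smooth_on_inner:
  "open S \<Longrightarrow> smooth_on S f \<Longrightarrow> smooth_on S g \<Longrightarrow> smooth_on S (\<lambda>x. f x \<bullet> g x)"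
  by (simp add: smooth_on_def Ck_on_bilinear[OF bounded_bilinear_inner])

lemma smooth_on_compose:
  fixes g :: "'a::real_normed_vector \<Rightarrow> 'b::euclidean_space"
  shows "open S \<Longrightarrow> open T \<Longrightarrow> g ` S \<subseteq> T \<Longrightarrow> smooth_on T f \<Longrightarrow> smooth_on S g
    \<Longrightarrow> smooth_on S (\<lambda>x. f (g x))"
  by (simp add: smooth_on_def Ck_on_compose)

lemma smooth_on_inverse:
  fixes f :: "'a::real_normed_vector \<Rightarrow> real"
  shows "open S \<Longrightarrow> smooth_on S f \<Longrightarrow> (\<And>x. x \<in> S \<Longrightarrow> f x \<noteq> 0) \<Longrightarrow> smooth_on S (\<lambda>x. inverse (f x))"
  by (simp add: smooth_on_def Ck_on_inverse)

lemma smooth_on_continuous: "smooth_on S f \<Longrightarrow> continuous_on S f"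
  unfolding smooth_on_def by (metis Ck_on.simps(1))

lemma smooth_on_derivative: "smooth_on S f \<Longrightarrow> smooth_on S (\<lambda>x. frechet_derivative f (at x) v)"
  unfolding smooth_on_def using Ck_on_SucD(3) by blast

lemma smooth_on_has_derivative:
  "smooth_on S f \<Longrightarrow> x \<in> S \<Longrightarrow> (f has_derivative frechet_derivative f (at x)) (at x)"
  unfolding smooth_on_def using Ck_on_SucD(2) by blast

text \<open>Each derivative of \<open>exp (- 1 / t)\<close>, extended by zero to \<open>t \<le> 0\<close>, is a combination of these functions.\<close>

definition flat_exp :: "nat \<Rightarrow> real \<Rightarrow> real" where
  "flat_exp n t = (if t \<le> 0 then 0 else inverse t ^ n * exp (- inverse t))"

lemma flat_exp_tendsto_0: "((\<lambda>t. inverse t ^ n * exp (- inverse t)) \<longlongrightarrow> (0::real)) (at_right 0)"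
proof -
  have "((\<lambda>t. inverse t ^ n / exp (inverse t)) \<longlongrightarrow> (0::real)) (at_right 0)"
    using filterlim_compose[OF tendsto_power_div_exp_0 filterlim_inverse_at_top_right] .
  then show ?thesis by (simp add: exp_minus divide_inverse)
qed

text \<open>With s = 1/t the function is s^n exp(-s), and ds/dt = -s^2 gives the two terms; the
  family is thus closed under differentiation up to linear combinations. At 0 the left difference
  quotient is zero and the right one is \<open>flat_exp (Suc n)\<close>, which tends to
  zero.\<close>

lemma flat_exp_has_derivative:
  "(flat_exp n has_field_derivative (flat_exp (n + 2) t - real n * flat_exp (n + 1) t)) (at t)"
proof (cases t "0::real" rule: linorder_cases)
  case less
  have "((\<lambda>_. 0) has_field_derivative 0) (at t)" by simp
  then have "(flat_exp n has_field_derivative 0) (at t)"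
    by (rule has_field_derivative_transform_within_open[of _ _ _ "{..<0}"])
       (use less in \<open>auto simp: flat_exp_def\<close>)
  then show ?thesis using less by (simp add: flat_exp_def)
next
  case greater
  let ?s = "inverse t"
  have "((\<lambda>s. s ^ n * exp (- s)) has_field_derivative
      real n * ?s ^ (n - Suc 0) * exp (- ?s) - ?s ^ n * exp (- ?s)) (at ?s)"
    by (auto intro!: derivative_eq_intros)
  from DERIV_chain2[OF this DERIV_inverse]
  have "((\<lambda>t. inverse t ^ n * exp (- inverse t)) has_field_derivative
      (real n * ?s ^ (n - Suc 0) * exp (- ?s) - ?s ^ n * exp (- ?s)) * - (?s ^ Suc (Suc 0))) (at t)"
    using greater by simp
  also have "(real n * ?s ^ (n - Suc 0) * exp (- ?s) - ?s ^ n * exp (- ?s)) * - (?s ^ Suc (Suc 0))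
      = flat_exp (n + 2) t - real n * flat_exp (n + 1) t"
    \<comment> \<open>The case split deals with the truncated exponent
      \<open>n - Suc 0\<close>.\<close>
    using greater by (cases n) (simp_all add: flat_exp_def algebra_simps)
  finally have "((\<lambda>t. inverse t ^ n * exp (- inverse t)) has_field_derivative
      flat_exp (n + 2) t - real n * flat_exp (n + 1) t) (at t)" .
  then show ?thesis
    by (rule has_field_derivative_transform_within_open[of _ _ _ "{0<..}"])
       (use greater in \<open>auto simp: flat_exp_def\<close>)
next
  case equal
  have "((\<lambda>y. (flat_exp n y - flat_exp n 0) / (y - 0)) \<longlongrightarrow> 0) (at 0)"
  proof (rule filterlim_split_at)
    show "((\<lambda>y. (flat_exp n y - flat_exp n 0) / (y - 0)) \<longlongrightarrow> 0) (at_left 0)"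
      by (rule tendsto_eventually) (auto simp: eventually_at_filter flat_exp_def)
    have "\<forall>\<^sub>F y in at_right 0. inverse y ^ Suc n * exp (- inverse y) = (flat_exp n y - flat_exp n 0) / (y - 0)"
      by (auto simp: eventually_at_filter flat_exp_def divide_inverse)
    then show "((\<lambda>y. (flat_exp n y - flat_exp n 0) / (y - 0)) \<longlongrightarrow> 0) (at_right 0)"
      using flat_exp_tendsto_0[of "Suc n"] by (rule Lim_transform_eventually[rotated])
  qed
  then show ?thesis by (simp add: has_field_derivative_iff equal flat_exp_def)
qed

lemma smooth_on_flat_exp: "smooth_on UNIV (flat_exp n)"
proof -
  have "Ck_on k UNIV (flat_exp n)" for k
  proof (induction k arbitrary: n)
    case 0 then show ?case
      using flat_exp_has_derivative DERIV_isCont by (auto intro!: continuous_at_imp_continuous_on) blast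
  next
    case (Suc k)
    show ?case
    proof (rule Ck_on_SucI)
      show "(flat_exp n has_derivative (\<lambda>v. (flat_exp (n + 2) t + - real n * flat_exp (n + 1) t) * v)) (at t)" for t
        using flat_exp_has_derivative[of n t] by (simp add: has_field_derivative_def)
      show "Ck_on k UNIV (\<lambda>t. (flat_exp (n + 2) t + - real n * flat_exp (n + 1) t) * v)" for v
        by (intro Ck_on_bilinear[OF bounded_bilinear_mult] Ck_on_add Suc.IH Ck_on_const open_UNIV)
    qed simp
  qed
  then show ?thesis by (simp add: smooth_on_def)
qed

lemma smooth_bump_exists:
  fixes p :: "'a::euclidean_space"
  assumes "r > 0"
  obtains b :: "'a \<Rightarrow> real" where "smooth_on UNIV b" "b p = 1" "\<And>x. x \<notin> cball p r \<Longrightarrow> b x = 0"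
proof -
  \<comment> \<open>The argument r^2 - |x - p|^2 is positive exactly inside the ball; the last
    factor normalises the value at the centre to 1. Differences are written as sums so that the
    closure rules apply.\<close>
  let ?b = "\<lambda>x. flat_exp 0 (r\<^sup>2 + - 1 * ((x + - p) \<bullet> (x + - p))) * inverse (flat_exp 0 (r\<^sup>2))"
  have "smooth_on UNIV ?b"
    by (intro smooth_on_mult smooth_on_const
          smooth_on_compose[of UNIV UNIV "\<lambda>x. r\<^sup>2 + - 1 * ((x + - p) \<bullet> (x + - p))" "flat_exp 0"]
          smooth_on_flat_exp smooth_on_add smooth_on_inner smooth_on_bounded_linear[OF _ bounded_linear_ident]
          open_UNIV subset_UNIV)
  moreover have "?b p = 1" using assms by (auto simp: flat_exp_def)
  moreover have "?b x = 0" if "x \<notin> cball p r" for x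
  proof -
    have "r < norm (x - p)" using that by (simp add: dist_norm norm_minus_commute)
    then have "r\<^sup>2 < (norm (x - p))\<^sup>2" using assms by (intro power_strict_mono) auto
    then show ?thesis by (simp add: flat_exp_def power2_norm_eq_inner)
  qed
  ultimately show ?thesis using that by blast
qed

section \<open>Hadamard's lemma with smooth remainder functions\<close>

lemma radial_mem_ball:
  fixes p :: "'a::real_normed_vector"
  assumes "x \<in> ball p r" "t \<in> cbox 0 (1::real)"
  shows "p + t *\<^sub>R (x - p) \<in> ball p r"
proof -
  have "norm (t *\<^sub>R (x - p)) \<le> 1 * norm (x - p)"
    unfolding norm_scaleR by (intro mult_right_mono) (use assms(2) in auto)
  then show ?thesis using assms(1) by (simp add: dist_norm norm_minus_commute)
qed

text \<open>Each derivative in \<open>x\<close> passes under the integral and, by the chain rule for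
  \<open>p + t *\<^sub>R (x - p)\<close>, brings out one factor \<open>t\<close>. The power
  \<open>t ^ j\<close> is carried along so that the induction hypothesis covers the differentiated
  integrand.\<close>

lemma Ck_on_radial_integral:
  fixes h :: "'a::euclidean_space \<Rightarrow> real"
  assumes "Ck_on k (ball p r) h"
  shows "Ck_on k (ball p r) (\<lambda>x. integral (cbox 0 1) (\<lambda>t. t ^ j * h (p + t *\<^sub>R (x - p))))"
  using assms
proof (induction k arbitrary: h j)
  case 0
  have "continuous_on (ball p r \<times> cbox 0 1) (\<lambda>(x, t). t ^ j * h (p + t *\<^sub>R (x - p)))"
    unfolding split_beta using 0
    by (auto intro!: continuous_intros continuous_on_compose2[of "ball p r" h] radial_mem_ball simp del: mem_ball)
  then show ?case unfolding Ck_on.simps by (rule integral_continuous_on_param)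
next
  case (Suc k)
  let ?Dh = "\<lambda>y. frechet_derivative h (at y)"
  \<comment> \<open>\<open>leibniz_rule\<close> asks for a continuous derivative with values in the
    bounded linear maps. Pairing with the gradient provides one, and its continuity reduces to that
    of the partial derivatives.\<close>
  let ?D = "\<lambda>x t. blinfun_inner_left (\<Sum>b\<in>Basis. (t ^ Suc j * ?Dh (p + t *\<^sub>R (x - p)) b) *\<^sub>R b)"
  have D: "?D x t v = t ^ Suc j * ?Dh (p + t *\<^sub>R (x - p)) v"
    if "x \<in> ball p r" "t \<in> cbox 0 1" for x t v
  proof -
    have "h differentiable (at (p + t *\<^sub>R (x - p)))"
      using Suc.prems radial_mem_ball[OF that] by simp
    then have lin: "linear (?Dh (p + t *\<^sub>R (x - p)))" by (rule linear_frechet_derivative)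
    have "?Dh (p + t *\<^sub>R (x - p)) v = ?Dh (p + t *\<^sub>R (x - p)) (\<Sum>b\<in>Basis. (v \<bullet> b) *\<^sub>R b)"
      by (simp add: euclidean_representation)
    also have "\<dots> = (\<Sum>b\<in>Basis. (v \<bullet> b) * ?Dh (p + t *\<^sub>R (x - p)) b)"
      by (simp add: linear_sum[OF lin] linear_scale[OF lin])
    finally show ?thesis by (simp add: inner_sum_right sum_distrib_left mult_ac)
  qed
  have cont: "continuous_on (ball p r \<times> cbox 0 1) (\<lambda>(x, t). ?D x t)"
    unfolding split_beta
  proof (intro bounded_linear.continuous_on[OF bounded_linear_blinfun_inner_left] continuous_intros)
    fix b :: 'a
    have "continuous_on (ball p r) (\<lambda>x. ?Dh x b)"
      using Ck_on_SucD(3)[OF Suc.prems] by (rule Ck_on_continuous)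
    then show "continuous_on (ball p r \<times> cbox 0 1) (\<lambda>x. ?Dh (p + snd x *\<^sub>R (fst x - p)) b)"
      by (rule continuous_on_compose2)
         (auto intro!: continuous_intros radial_mem_ball simp del: mem_ball)
  qed
  have int: "(\<lambda>t. ?D x t) integrable_on cbox 0 1" if "x \<in> ball p r" for x
  proof (intro integrable_continuous)
    have "continuous_on (cbox 0 1) (\<lambda>t. (\<lambda>(x, t). ?D x t) (x, t))"
      by (rule continuous_on_compose2[OF cont]) (use that in \<open>auto intro!: continuous_intros\<close>)
    then show "continuous_on (cbox 0 1) (\<lambda>t. ?D x t)" unfolding prod.case .
  qed
  show ?case
  proof (rule Ck_on_SucI)
    fix x assume x: "x \<in> ball p r"
    have "((\<lambda>x. integral (cbox 0 1) (\<lambda>t. t ^ j * h (p + t *\<^sub>R (x - p)))) has_derivative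
        integral (cbox 0 1) (?D x)) (at x within ball p r)"
    proof (rule leibniz_rule[OF _ _ cont x convex_ball])
      fix y t assume y: "y \<in> ball p r" and t: "t \<in> cbox 0 (1::real)"
      have "((\<lambda>y. t ^ j * h (p + t *\<^sub>R (y - p))) has_derivative
          (\<lambda>v. t ^ j * ?Dh (p + t *\<^sub>R (y - p)) (t *\<^sub>R v))) (at y within ball p r)"
        by (intro has_derivative_mult_right has_derivative_compose[where g = h and f = "\<lambda>y. p + t *\<^sub>R (y - p)",
              OF _ Ck_on_SucD(2)[OF Suc.prems radial_mem_ball[OF y t]]])
           (auto intro!: derivative_eq_intros)
      moreover have "linear (?Dh (p + t *\<^sub>R (y - p)))"
        using Suc.prems radial_mem_ball[OF y t] by (intro linear_frechet_derivative) auto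
      ultimately show "((\<lambda>y. t ^ j * h (p + t *\<^sub>R (y - p))) has_derivative blinfun_apply (?D y t)) (at y within ball p r)"
        using D[OF y t] by (simp add: linear_scale mult_ac)
    next
      fix y assume y: "y \<in> ball p r"
      have "continuous_on (cbox 0 1) (\<lambda>t. h (p + t *\<^sub>R (y - p)))"
      proof (rule continuous_on_compose2[OF Ck_on_continuous[OF Suc.prems]])
        show "(\<lambda>t. p + t *\<^sub>R (y - p)) ` cbox 0 1 \<subseteq> ball p r"
          using radial_mem_ball[OF y] by blast
      qed (intro continuous_intros)
      then show "(\<lambda>t. t ^ j * h (p + t *\<^sub>R (y - p))) integrable_on cbox 0 1"
        by (intro integrable_continuous continuous_intros)
    qed
    moreover have "blinfun_apply (integral (cbox 0 1) (?D x)) =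
        (\<lambda>v. integral (cbox 0 1) (\<lambda>t. t ^ Suc j * ?Dh (p + t *\<^sub>R (x - p)) v))"
    proof (rule ext)
      fix v
      have "blinfun_apply (integral (cbox 0 1) (?D x)) v = integral (cbox 0 1) (\<lambda>t. ?D x t v)"
        by (rule blinfun_apply_integral[OF int[OF x]])
      also have "\<dots> = integral (cbox 0 1) (\<lambda>t. t ^ Suc j * ?Dh (p + t *\<^sub>R (x - p)) v)"
        by (rule integral_cong) (rule D[OF x])
      finally show "blinfun_apply (integral (cbox 0 1) (?D x)) v = \<dots>" .
    qed
    ultimately show "((\<lambda>x. integral (cbox 0 1) (\<lambda>t. t ^ j * h (p + t *\<^sub>R (x - p)))) has_derivative
        (\<lambda>v. integral (cbox 0 1) (\<lambda>t. t ^ Suc j * ?Dh (p + t *\<^sub>R (x - p)) v))) (at x)"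
      using at_within_open[OF x open_ball] by simp
  next
    show "Ck_on k (ball p r) (\<lambda>x. integral (cbox 0 1) (\<lambda>t. t ^ Suc j * ?Dh (p + t *\<^sub>R (x - p)) v))" for v
      by (rule Suc.IH[OF Ck_on_SucD(3)[OF Suc.prems]])
  qed (rule open_ball)
qed

text \<open>Integrate the derivative of \<open>F\<close> along the segment from \<open>p\<close> to
  \<open>x\<close> and expand the direction \<open>x - p\<close> in the basis; \<open>G b\<close> is
  the mean of the partial derivative in direction \<open>b\<close> over the segment.\<close>

lemma Hadamard:
  fixes F :: "'a::euclidean_space \<Rightarrow> real"
  assumes F: "smooth_on (ball p r) F"
  obtains G where "\<And>b. smooth_on (ball p r) (G b)"
    "\<And>x. x \<in> ball p r \<Longrightarrow> F x = F p + (\<Sum>b\<in>Basis. ((x - p) \<bullet> b) * G b x)"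
    "\<And>b. G b p = frechet_derivative F (at p) b"
proof
  let ?D = "\<lambda>y. frechet_derivative F (at y)"
  \<comment> \<open>The factor \<open>t ^ 0\<close> gives the integrand the form required by
    \<open>Ck_on_radial_integral\<close>.\<close>
  let ?G = "\<lambda>b x. integral (cbox 0 1) (\<lambda>t. t ^ 0 * ?D (p + t *\<^sub>R (x - p)) b)"
  show "smooth_on (ball p r) (?G b)" for b
    using smooth_on_derivative[OF F, of b] unfolding smooth_on_def
    by (intro allI Ck_on_radial_integral) blast
  show "?G b p = ?D p b" for b by simp
  show "F x = F p + (\<Sum>b\<in>Basis. ((x - p) \<bullet> b) * ?G b x)" if x: "x \<in> ball p r" for x
  proof -
    let ?y = "\<lambda>t. p + t *\<^sub>R (x - p)"
    have D: "(F has_derivative ?D (?y t)) (at (?y t))" if "t \<in> cbox 0 1" for t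
      by (rule smooth_on_has_derivative[OF F radial_mem_ball[OF x that]])
    have "((\<lambda>t. ?D (?y t) (x - p)) has_integral (F (?y 1) - F (?y 0))) {0..1}"
    proof (rule fundamental_theorem_of_calculus)
      fix t :: real assume t: "t \<in> {0..1}"
      have "((\<lambda>t. F (?y t)) has_derivative (\<lambda>s. ?D (?y t) (s *\<^sub>R (x - p)))) (at t within {0..1})"
        by (rule has_derivative_compose[where g = F and f = ?y, OF _ D])
           (use t in \<open>auto intro!: derivative_eq_intros\<close>)
      then show "((\<lambda>t. F (?y t)) has_vector_derivative ?D (?y t) (x - p)) (at t within {0..1})"
        using linear_scale[OF has_derivative_linear[OF D]] t by (simp add: has_vector_derivative_def)
    qed simp
    moreover have "((\<lambda>t. ?D (?y t) (x - p)) has_integral (\<Sum>b\<in>Basis. ((x - p) \<bullet> b) * ?G b x)) {0..1}"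
    proof (rule has_integral_cong[THEN iffD1])
      have int: "(\<lambda>t. ?D (?y t) b) integrable_on cbox 0 1" for b
        by (intro integrable_continuous continuous_on_compose2[OF smooth_on_continuous[OF smooth_on_derivative[OF F]]]
            continuous_intros) (use radial_mem_ball[OF x] in auto)
      show "((\<lambda>t. \<Sum>b\<in>Basis. ((x - p) \<bullet> b) * ?D (?y t) b) has_integral (\<Sum>b\<in>Basis. ((x - p) \<bullet> b) * ?G b x)) {0..1}"
        using int by (intro has_integral_sum has_integral_mult_right) (auto simp: integrable_integral)
      show "(\<Sum>b\<in>Basis. ((x - p) \<bullet> b) * ?D (?y t) b) = ?D (?y t) (x - p)" if "t \<in> {0..1}" for t
      proof -
        have lin: "linear (?D (?y t))" using D that has_derivative_linear by auto
        have "?D (?y t) (x - p) = ?D (?y t) (\<Sum>b\<in>Basis. ((x - p) \<bullet> b) *\<^sub>R b)"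
          by (simp add: euclidean_representation)
        then show ?thesis by (simp add: linear_sum[OF lin] linear_scale[OF lin])
      qed
    qed
    ultimately have "F (?y 1) - F (?y 0) = (\<Sum>b\<in>Basis. ((x - p) \<bullet> b) * ?G b x)"
      by (rule has_integral_unique)
    then show ?thesis by simp
  qed
qed

section \<open>Smooth functions and tangent vectors on a manifold\<close>

text \<open>The functions stay total, and their values off \<open>W\<close> are left free.
  Coordinates belong to this class over their chart and enter the global algebra only after
  multiplication by a cut-off function.\<close>

definition smooth_fun_on ::
  "('m::topological_space, 'e::euclidean_space) atlas \<Rightarrow> 'm set \<Rightarrow> ('m \<Rightarrow> real) set" where
  "smooth_fun_on \<A> W = {f. \<forall>(U, x)\<in>\<A>. smooth_on (x ` (U \<inter> W)) (f \<circ> inv_into U x)}"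

lemma smooth_fun_on_UNIV: "smooth_fun_on \<A> UNIV = smooth_fun \<A>"
  by (simp add: smooth_fun_on_def smooth_fun_def)

text \<open>The coordinate field in direction \<open>b\<close>, cut off by \<beta> and extended by
  zero. The value 0 on non-smooth functions is the normalisation demanded by
  \<open>tangent_space\<close>.\<close>

definition coord_field :: "('m::topological_space, 'e::euclidean_space) atlas \<Rightarrow> 'm set \<Rightarrow> ('m \<Rightarrow> 'e) \<Rightarrow>
   ('m \<Rightarrow> real) \<Rightarrow> 'e \<Rightarrow> 'm vfield" where
  "coord_field \<A> U x \<beta> b q f = (if q \<in> U \<and> f \<in> smooth_fun \<A>
     then \<beta> q * frechet_derivative (f \<circ> inv_into U x) (at (x q)) b else 0)"

lemma sum_fun_apply: "(\<Sum>i\<in>I. f i) x = (\<Sum>i\<in>I. f i x)"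
  by (induction I rule: infinite_finite_induct) auto

lemma tangent_space_eqI:
  assumes "u \<in> tangent_space \<A> p" "v \<in> tangent_space \<A> p" "\<And>f. f \<in> smooth_fun \<A> \<Longrightarrow> u f = v f"
  shows "u = v"
proof
  fix f show "u f = v f"
    by (cases "f \<in> smooth_fun \<A>") (use assms in \<open>auto simp: tangent_space_def\<close>)
qed

lemma
  assumes "v \<in> tangent_space \<A> p"
  shows tangent_nonsmooth: "f \<notin> smooth_fun \<A> \<Longrightarrow> v f = 0"
    and tangent_add: "f \<in> smooth_fun \<A> \<Longrightarrow> g \<in> smooth_fun \<A> \<Longrightarrow> v (\<lambda>x. f x + g x) = v f + v g"
    and tangent_scale: "f \<in> smooth_fun \<A> \<Longrightarrow> v (\<lambda>x. c * f x) = c * v f"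
    and tangent_mult: "f \<in> smooth_fun \<A> \<Longrightarrow> g \<in> smooth_fun \<A> \<Longrightarrow>
      v (\<lambda>x. f x * g x) = v f * g p + f p * v g"
  using assms unfolding tangent_space_def by blast+

locale manifold =
  fixes \<A> :: "('m::{t2_space,second_countable_topology}, 'e::euclidean_space) atlas"
  assumes manifold: "smooth_manifold \<A>"
begin

lemma chart_at: obtains U x where "(U, x) \<in> \<A>" "p \<in> U"
  using manifold unfolding smooth_manifold_def by blast

context
  fixes U x assumes chart: "(U, x) \<in> \<A>"
begin

lemma chart_props: "open U" "open (x ` U)" "inj_on x U" "continuous_on U x"
    "continuous_on (x ` U) (inv_into U x)"
  using manifold chart unfolding smooth_manifold_def is_chart_def by auto

lemma chart_inv [simp]: "q \<in> U \<Longrightarrow> inv_into U x (x q) = q"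
  by (simp add: chart_props)

lemma chart_open: "open W \<Longrightarrow> open (x ` (U \<inter> W))"
proof -
  assume "open W"
  have "x ` (U \<inter> W) = inv_into U x -` W \<inter> x ` U" by auto
  then show ?thesis
    using continuous_on_open_vimage[OF chart_props(2), THEN iffD1, OF chart_props(5)] \<open>open W\<close> by auto
qed

lemma chart_preimage_open: "open B \<Longrightarrow> open {q \<in> U. x q \<in> B}"
proof -
  assume "open B"
  moreover have "{q \<in> U. x q \<in> B} = x -` B \<inter> U" by auto
  ultimately show ?thesis
    using continuous_on_open_vimage[OF chart_props(1), THEN iffD1, OF chart_props(4)] by auto
qed

text \<open>In any other chart the representation of \<open>f\<close> is the given one composed with
  a transition map, so a single chart around \<open>W\<close> suffices.\<close>

lemma smooth_fun_onI_chart: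
  assumes W: "open W" "W \<subseteq> U" and f: "smooth_on (x ` W) (f \<circ> inv_into U x)"
  shows "f \<in> smooth_fun_on \<A> W"
  unfolding smooth_fun_on_def
proof (safe)
  fix V y assume V: "(V, y) \<in> \<A>"
  have o: "open (y ` (V \<inter> W))"
    using manifold V W(1) by (rule_tac manifold.chart_open) unfold_locales
  have inv: "inv_into V y (y q) = q" if "q \<in> V" for q
    using V manifold that unfolding smooth_manifold_def is_chart_def by fastforce
  have "smooth_on (y ` (V \<inter> U)) (x \<circ> inv_into V y)"
    using manifold V chart unfolding smooth_manifold_def by blast
  then have "smooth_on (y ` (V \<inter> W)) (x \<circ> inv_into V y)"
    by (rule smooth_on_subset) (use W in auto)
  then have "smooth_on (y ` (V \<inter> W)) (\<lambda>z. (f \<circ> inv_into U x) ((x \<circ> inv_into V y) z))"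
    using chart_open[OF W(1)] W(2) inv
    by (intro smooth_on_compose[OF o _ _ f]) (auto simp: inf_absorb2 comp_def)
  then show "smooth_on (y ` (V \<inter> W)) (f \<circ> inv_into V y)"
    by (rule smooth_on_cong[OF o, THEN iffD1, rotated]) (use W inv in auto)
qed

lemma smooth_fun_onD_chart:
  "f \<in> smooth_fun_on \<A> W \<Longrightarrow> smooth_on (x ` (U \<inter> W)) (f \<circ> inv_into U x)"
  using chart by (auto simp: smooth_fun_on_def)

lemma coordinate_smooth: "(\<lambda>q. x q \<bullet> b) \<in> smooth_fun_on \<A> U"
proof (rule smooth_fun_onI_chart[OF chart_props(1)])
  have "smooth_on (x ` U) (\<lambda>z. z \<bullet> b)"
    by (intro smooth_on_bounded_linear chart_props bounded_linear_inner_left)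
  then show "smooth_on (x ` U) ((\<lambda>q. x q \<bullet> b) \<circ> inv_into U x)"
    by (rule smooth_on_cong[OF chart_props(2), THEN iffD1, rotated]) auto
qed simp

lemma partial_smooth:
  assumes "open W" "W \<subseteq> U" "f \<in> smooth_fun_on \<A> W"
  shows "(\<lambda>q. frechet_derivative (f \<circ> inv_into U x) (at (x q)) b) \<in> smooth_fun_on \<A> W"
proof (rule smooth_fun_onI_chart[OF assms(1,2)])
  have W: "U \<inter> W = W" using assms(2) by auto
  have "smooth_on (x ` W) (\<lambda>z. frechet_derivative (f \<circ> inv_into U x) (at z) b)"
    using smooth_fun_onD_chart[OF assms(3)] by (intro smooth_on_derivative) (simp add: W)
  then show "smooth_on (x ` W) ((\<lambda>q. frechet_derivative (f \<circ> inv_into U x) (at (x q)) b) \<circ> inv_into U x)"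
    by (rule smooth_on_cong[OF chart_open[OF assms(1), unfolded W], THEN iffD1, rotated])
       (use assms(2) in auto)
qed

end

section \<open>The algebra of smooth functions on an open set\<close>

lemma smooth_fun_on_cong:
  assumes "open W" "\<And>q. q \<in> W \<Longrightarrow> f q = g q" "f \<in> smooth_fun_on \<A> W"
  shows "g \<in> smooth_fun_on \<A> W"
  unfolding smooth_fun_on_def
proof safe
  fix U x assume c: "(U, x) \<in> \<A>"
  show "smooth_on (x ` (U \<inter> W)) (g \<circ> inv_into U x)"
    using smooth_fun_onD_chart[OF c assms(3)]
    by (rule smooth_on_cong[OF chart_open[OF c assms(1)], THEN iffD1, rotated])
       (use c assms(2) in auto)
qed

lemma smooth_fun_on_subset: "f \<in> smooth_fun_on \<A> W \<Longrightarrow> W' \<subseteq> W \<Longrightarrow> f \<in> smooth_fun_on \<A> W'"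
  unfolding smooth_fun_on_def by (fastforce elim!: smooth_on_subset)

lemma smooth_fun_on_smooth: "f \<in> smooth_fun \<A> \<Longrightarrow> f \<in> smooth_fun_on \<A> W"
  unfolding smooth_fun_on_UNIV[symmetric] by (erule smooth_fun_on_subset) simp

lemma smooth_fun_on_local:
  assumes "\<And>p. p \<in> W \<Longrightarrow> \<exists>W'. open W' \<and> p \<in> W' \<and> f \<in> smooth_fun_on \<A> W'"
  shows "f \<in> smooth_fun_on \<A> W"
  unfolding smooth_fun_on_def
proof safe
  fix U x assume c: "(U, x) \<in> \<A>"
  show "smooth_on (x ` (U \<inter> W)) (f \<circ> inv_into U x)"
  proof (rule smooth_on_local)
    fix z assume "z \<in> x ` (U \<inter> W)"
    then obtain p where p: "p \<in> U" "p \<in> W" "z = x p" by auto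
    then obtain W' where W': "open W'" "p \<in> W'" "f \<in> smooth_fun_on \<A> W'" using assms by blast
    show "\<exists>T. open T \<and> z \<in> T \<and> smooth_on T (f \<circ> inv_into U x)"
      using chart_open[OF c W'(1)] smooth_fun_onD_chart[OF c W'(3)] p W'(2) by blast
  qed
qed

lemma smooth_fun_local:
  assumes "\<And>p. \<exists>W'. open W' \<and> p \<in> W' \<and> f \<in> smooth_fun_on \<A> W'"
  shows "f \<in> smooth_fun \<A>"
  unfolding smooth_fun_on_UNIV[symmetric] by (rule smooth_fun_on_local) (use assms in blast)

lemma smooth_fun_on_const: "open W \<Longrightarrow> (\<lambda>q. c) \<in> smooth_fun_on \<A> W"
  unfolding smooth_fun_on_def using chart_open by (auto simp: comp_def intro!: smooth_on_const)

lemma smooth_fun_on_add: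
  "open W \<Longrightarrow> f \<in> smooth_fun_on \<A> W \<Longrightarrow> g \<in> smooth_fun_on \<A> W \<Longrightarrow> (\<lambda>q. f q + g q) \<in> smooth_fun_on \<A> W"
  unfolding smooth_fun_on_def using chart_open by (auto simp: comp_def intro!: smooth_on_add)

lemma smooth_fun_on_mult:
  "open W \<Longrightarrow> f \<in> smooth_fun_on \<A> W \<Longrightarrow> g \<in> smooth_fun_on \<A> W \<Longrightarrow> (\<lambda>q. f q * g q) \<in> smooth_fun_on \<A> W"
  unfolding smooth_fun_on_def using chart_open by (auto simp: comp_def intro!: smooth_on_mult)

lemma smooth_fun_on_inverse:
  assumes "open W" "f \<in> smooth_fun_on \<A> W" "\<And>q. q \<in> W \<Longrightarrow> f q \<noteq> 0"
  shows "(\<lambda>q. inverse (f q)) \<in> smooth_fun_on \<A> W"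
  unfolding smooth_fun_on_def
proof safe
  fix U x assume c: "(U, x) \<in> \<A>"
  show "smooth_on (x ` (U \<inter> W)) ((\<lambda>q. inverse (f q)) \<circ> inv_into U x)"
    unfolding comp_def
    using smooth_on_inverse[OF chart_open[OF c assms(1)] smooth_fun_onD_chart[OF c assms(2)]] assms(3) c
    by (fastforce simp: comp_def)
qed

lemmas smooth_fun_const = smooth_fun_on_const[OF open_UNIV, unfolded smooth_fun_on_UNIV]
  and smooth_fun_add = smooth_fun_on_add[OF open_UNIV, unfolded smooth_fun_on_UNIV]
  and smooth_fun_mult = smooth_fun_on_mult[OF open_UNIV, unfolded smooth_fun_on_UNIV]

lemma smooth_fun_on_scale: "open W \<Longrightarrow> f \<in> smooth_fun_on \<A> W \<Longrightarrow> (\<lambda>q. c * f q) \<in> smooth_fun_on \<A> W"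
  by (intro smooth_fun_on_mult smooth_fun_on_const)

lemma smooth_fun_scale: "f \<in> smooth_fun \<A> \<Longrightarrow> (\<lambda>q. c * f q) \<in> smooth_fun \<A>"
  by (intro smooth_fun_mult smooth_fun_const)

lemma smooth_fun_on_diff:
  "open W \<Longrightarrow> f \<in> smooth_fun_on \<A> W \<Longrightarrow> g \<in> smooth_fun_on \<A> W \<Longrightarrow> (\<lambda>q. f q - g q) \<in> smooth_fun_on \<A> W"
  using smooth_fun_on_add[of W f "\<lambda>q. - 1 * g q"] smooth_fun_on_scale[of W g "- 1"] by simp

lemmas smooth_fun_diff = smooth_fun_on_diff[OF open_UNIV, unfolded smooth_fun_on_UNIV]

lemma smooth_fun_on_sum:
  "open W \<Longrightarrow> (\<And>i. i \<in> I \<Longrightarrow> f i \<in> smooth_fun_on \<A> W) \<Longrightarrow> (\<lambda>q. \<Sum>i\<in>I. f i q) \<in> smooth_fun_on \<A> W"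
  by (induction I rule: infinite_finite_induct) (auto intro!: smooth_fun_on_const smooth_fun_on_add)

lemma smooth_fun_on_prod:
  "open W \<Longrightarrow> (\<And>i. i \<in> I \<Longrightarrow> f i \<in> smooth_fun_on \<A> W) \<Longrightarrow> (\<lambda>q. \<Prod>i\<in>I. f i q) \<in> smooth_fun_on \<A> W"
  by (induction I rule: infinite_finite_induct) (auto intro!: smooth_fun_on_const smooth_fun_on_mult)

lemmas smooth_fun_sum = smooth_fun_on_sum[OF open_UNIV, unfolded smooth_fun_on_UNIV]

lemma smooth_fun_continuous: "f \<in> smooth_fun \<A> \<Longrightarrow> continuous_on UNIV f"
proof (rule continuous_at_imp_continuous_on, safe)
  fix p assume f: "f \<in> smooth_fun \<A>"
  obtain U x where c: "(U, x) \<in> \<A>" "p \<in> U" using chart_at .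
  have "continuous_on U (\<lambda>q. (f \<circ> inv_into U x) (x q))"
    by (rule continuous_on_compose2[OF
          smooth_on_continuous[OF smooth_fun_onD_chart[OF c(1) smooth_fun_on_smooth[OF f, of UNIV]]]
          chart_props(4)[OF c(1)]]) auto
  then have "continuous_on U f" by (rule continuous_on_eq) (use c in auto)
  then show "isCont f p" using chart_props(1)[OF c(1)] c(2) by (simp add: continuous_on_eq_continuous_at)
qed

text \<open>Extension by zero: the open sets \<open>W\<close> and \<open>- K\<close> cover the
  manifold, the product is smooth on the first and zero on the second.\<close>

lemma bump_mult:
  assumes "\<beta> \<in> smooth_fun \<A>" "closed K" "K \<subseteq> W" "open W" "\<And>q. q \<notin> K \<Longrightarrow> \<beta> q = 0"
    and f: "f \<in> smooth_fun_on \<A> W"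
  shows "(\<lambda>q. \<beta> q * f q) \<in> smooth_fun \<A>"
proof (rule smooth_fun_local)
  fix p
  show "\<exists>W'. open W' \<and> p \<in> W' \<and> (\<lambda>q. \<beta> q * f q) \<in> smooth_fun_on \<A> W'"
  proof (cases "p \<in> W")
    case True
    have "(\<lambda>q. \<beta> q * f q) \<in> smooth_fun_on \<A> W"
      by (intro smooth_fun_on_mult smooth_fun_on_smooth assms)
    then show ?thesis using True assms(4) by blast
  next
    case False
    have "(\<lambda>q. \<beta> q * f q) \<in> smooth_fun_on \<A> (- K)"
      by (rule smooth_fun_on_cong[OF _ _ smooth_fun_on_const[of _ 0]]) (use assms in auto)
    moreover have "open (- K)" "p \<in> - K" using False assms(2,3) by auto
    ultimately show ?thesis by blast
  qed
qed

text \<open>A Euclidean bump is transported through a chart. Its support is the preimage of a closed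
  ball, hence compact, and closed because the manifold is Hausdorff; this makes the extension by
  zero smooth.\<close>

lemma bump_exists:
  assumes "open W" "p \<in> W"
  obtains \<beta> K where "\<beta> \<in> smooth_fun \<A>" "\<beta> p = 1" "closed K" "K \<subseteq> W" "\<And>q. q \<notin> K \<Longrightarrow> \<beta> q = 0"
proof -
  obtain U x where c: "(U, x) \<in> \<A>" "p \<in> U" using chart_at .
  have "open (x ` (U \<inter> W))" "x p \<in> x ` (U \<inter> W)" using chart_open[OF c(1) assms(1)] c assms by auto
  then obtain r where r: "r > 0" "cball (x p) r \<subseteq> x ` (U \<inter> W)" using open_contains_cball by blast
  obtain b where b: "smooth_on UNIV b" "b (x p) = (1::real)" "\<And>z. z \<notin> cball (x p) r \<Longrightarrow> b z = 0"
    using smooth_bump_exists[OF r(1), of "x p"] by blast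
  define K where "K = inv_into U x ` cball (x p) r"
  have sub: "cball (x p) r \<subseteq> x ` U" using r by auto
  have "compact K" unfolding K_def
    by (rule compact_continuous_image[OF continuous_on_subset[OF chart_props(5)[OF c(1)] sub] compact_cball])
  then have K: "closed K" by (rule compact_imp_closed)
  have KW: "K \<subseteq> W" "K \<subseteq> U" using r(2) c(1) unfolding K_def by (fastforce)+
  have nK: "x q \<notin> cball (x p) r" if "q \<in> U" "q \<notin> K" for q
    using that c(1) unfolding K_def by (metis chart_inv image_eqI)
  define \<beta> where "\<beta> q = (if q \<in> U then b (x q) else 0)" for q
  have off: "\<beta> q = 0" if "q \<notin> K" for q using that nK b(3) by (auto simp: \<beta>_def)
  have "\<beta> \<in> smooth_fun \<A>"
  proof (rule smooth_fun_local)
    fix q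
    show "\<exists>W'. open W' \<and> q \<in> W' \<and> \<beta> \<in> smooth_fun_on \<A> W'"
    proof (cases "q \<in> U")
      case True
      have "smooth_on (x ` U) b" using b(1) by (rule smooth_on_subset) simp
      then have "smooth_on (x ` U) (\<beta> \<circ> inv_into U x)"
        by (rule smooth_on_cong[OF chart_props(2)[OF c(1)], THEN iffD1, rotated]) (use c in \<open>auto simp: \<beta>_def\<close>)
      from smooth_fun_onI_chart[OF c(1) chart_props(1)[OF c(1)] order_refl this]
      show ?thesis using True chart_props(1)[OF c(1)] by blast
    next
      case False
      have "\<beta> \<in> smooth_fun_on \<A> (- K)"
        by (rule smooth_fun_on_cong[OF _ _ smooth_fun_on_const[of _ 0]]) (use K off in auto)
      moreover have "open (- K)" "q \<in> - K" using False KW K by auto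
      ultimately show ?thesis by blast
    qed
  qed
  moreover have "\<beta> p = 1" using b c by (simp add: \<beta>_def)
  ultimately show ?thesis using that K KW off by blast
qed

section \<open>Tangent vectors in coordinates\<close>

lemma tangent_const:
  assumes v: "v \<in> tangent_space \<A> p" shows "v (\<lambda>x. c) = 0"
proof -
  have "v (\<lambda>x. 1 * 1) = v (\<lambda>x. 1) * 1 + 1 * v (\<lambda>x. 1)"
    by (rule tangent_mult[OF v]) (rule smooth_fun_const)+
  then have "v (\<lambda>x. 1) = 0" by simp
  then show ?thesis using tangent_scale[OF v smooth_fun_const, of c 1] by simp
qed

lemma tangent_diff:
  "v \<in> tangent_space \<A> p \<Longrightarrow> f \<in> smooth_fun \<A> \<Longrightarrow> g \<in> smooth_fun \<A> \<Longrightarrow> v (\<lambda>x. f x - g x) = v f - v g"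
  using tangent_add[of v \<A> p f "\<lambda>x. - 1 * g x"] tangent_scale[of v \<A> p g "- 1"] smooth_fun_scale[of g "- 1"]
  by simp

lemma tangent_sum:
  assumes v: "v \<in> tangent_space \<A> p" and "\<And>i. i \<in> I \<Longrightarrow> f i \<in> smooth_fun \<A>"
  shows "v (\<lambda>x. \<Sum>i\<in>I. f i x) = (\<Sum>i\<in>I. v (f i))"
  using assms(2)
  by (induction I rule: infinite_finite_induct) (auto simp: tangent_const[OF v] tangent_add[OF v] smooth_fun_sum)

text \<open>Hadamard's lemma expands \<open>f\<close> on a small ball; multiplied by two cut-off
  functions, the expansion becomes an identity between global smooth functions, to which
  \<open>v\<close> applies. One cut-off globalises the coordinates, the other the functions
  \<open>G b\<close>. The former is prescribed in advance, so the coefficients of \<open>v\<close>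
  do not depend on \<open>f\<close>.\<close>

lemma tangent_coords:
  assumes c: "(U, x) \<in> \<A>" and q: "q \<in> U" and v: "v \<in> tangent_space \<A> q" and f: "f \<in> smooth_fun \<A>"
    and \<gamma>: "\<gamma> \<in> smooth_fun \<A>" "\<gamma> q = 1" "closed K" "K \<subseteq> U" "\<And>r. r \<notin> K \<Longrightarrow> \<gamma> r = 0"
  shows "v f = (\<Sum>b\<in>Basis. v (\<lambda>r. \<gamma> r * (x r \<bullet> b - x q \<bullet> b)) * frechet_derivative (f \<circ> inv_into U x) (at (x q)) b)"
proof -
  obtain d where d: "d > 0" "ball (x q) d \<subseteq> x ` U"
    using chart_props(2)[OF c] q open_contains_ball by blast
  define W where "W = {r \<in> U. x r \<in> ball (x q) d}"
  have W: "open W" "q \<in> W" "W \<subseteq> U"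
    using chart_preimage_open[OF c open_ball] q d unfolding W_def by auto
  have "smooth_on (ball (x q) d) (f \<circ> inv_into U x)"
    using smooth_fun_onD_chart[OF c smooth_fun_on_smooth[OF f, of UNIV]] d by (auto elim: smooth_on_subset)
  from Hadamard[OF this] obtain G where G: "\<And>b. smooth_on (ball (x q) d) (G b)"
    "\<And>z. z \<in> ball (x q) d \<Longrightarrow> (f \<circ> inv_into U x) z = (f \<circ> inv_into U x) (x q) + (\<Sum>b\<in>Basis. ((z - x q) \<bullet> b) * G b z)"
    "\<And>b. G b (x q) = frechet_derivative (f \<circ> inv_into U x) (at (x q)) b" by blast
  have fW: "f r = f q + (\<Sum>b\<in>Basis. (x r \<bullet> b - x q \<bullet> b) * G b (x r))" if "r \<in> W" for r
    using G(2)[of "x r"] that c q unfolding W_def by (auto simp: inner_diff_left)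
  obtain \<delta> L where \<delta>: "\<delta> \<in> smooth_fun \<A>" "\<delta> q = 1" "closed L" "L \<subseteq> W" "\<And>r. r \<notin> L \<Longrightarrow> \<delta> r = 0"
    using bump_exists[OF W(1,2)] by blast
  define g where "g b r = \<delta> r * G b (x r)" for b r
  define h where "h b r = \<gamma> r * (x r \<bullet> b - x q \<bullet> b)" for b r
  have xW: "x ` W = ball (x q) d" using d unfolding W_def by auto
  have Gx: "(\<lambda>r. G b (x r)) \<in> smooth_fun_on \<A> W" for b
  proof (rule smooth_fun_onI_chart[OF c W(1,3)])
    show "smooth_on (x ` W) ((\<lambda>r. G b (x r)) \<circ> inv_into U x)"
      using G(1)[of b] unfolding xW
      by (rule smooth_on_cong[OF open_ball, THEN iffD1, rotated]) (use d c in auto)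
  qed
  have g: "g b \<in> smooth_fun \<A>" for b
    unfolding g_def by (rule bump_mult[OF \<delta>(1,3,4) W(1) \<delta>(5) Gx])
  have xb: "(\<lambda>r. x r \<bullet> b - x q \<bullet> b) \<in> smooth_fun_on \<A> U" for b
    by (rule smooth_fun_on_diff[OF chart_props(1)[OF c] coordinate_smooth[OF c]
        smooth_fun_on_const[OF chart_props(1)[OF c]]])
  have h: "h b \<in> smooth_fun \<A>" for b
    unfolding h_def by (rule bump_mult[OF \<gamma>(1,3,4) chart_props(1)[OF c] \<gamma>(5) xb])
  have \<delta>\<gamma>: "(\<lambda>r. \<delta> r * \<gamma> r) \<in> smooth_fun \<A>" by (intro smooth_fun_mult \<delta> \<gamma>)
  \<comment> \<open>After \<open>v\<close> is applied, the term with \<open>v\<close> of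
    \<delta>\<gamma> occurs on both sides and cancels. Each \<open>h b\<close> vanishes at
    \<open>q\<close>, so only its derivative times \<open>g b q\<close> survives.\<close>
  have "(\<lambda>r. (\<delta> r * \<gamma> r) * f r) = (\<lambda>r. f q * (\<delta> r * \<gamma> r) + (\<Sum>b\<in>Basis. h b r * g b r))"
  proof
    fix r show "(\<delta> r * \<gamma> r) * f r = f q * (\<delta> r * \<gamma> r) + (\<Sum>b\<in>Basis. h b r * g b r)"
    proof (cases "r \<in> W")
      case True then show ?thesis
        by (simp add: fW[OF True] h_def g_def sum_distrib_left algebra_simps)
    next
      case False then have "\<delta> r = 0" using \<delta> by blast
      then show ?thesis by (simp add: g_def)
    qed
  qed
  then have "v (\<lambda>r. (\<delta> r * \<gamma> r) * f r) = v (\<lambda>r. f q * (\<delta> r * \<gamma> r) + (\<Sum>b\<in>Basis. h b r * g b r))" by simp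
  also have "\<dots> = f q * v (\<lambda>r. \<delta> r * \<gamma> r) + (\<Sum>b\<in>Basis. v (h b) * g b q + h b q * v (g b))"
    using \<delta>\<gamma> h g by (simp add: tangent_add[OF v] tangent_scale[OF v] tangent_sum[OF v] tangent_mult[OF v]
      smooth_fun_scale smooth_fun_sum smooth_fun_mult)
  also have "v (\<lambda>r. (\<delta> r * \<gamma> r) * f r) = v (\<lambda>r. \<delta> r * \<gamma> r) * f q + v f"
    using tangent_mult[OF v \<delta>\<gamma> f] \<delta>(2) \<gamma>(2) by simp
  finally show ?thesis using \<delta>(2) G(3) by (simp add: g_def h_def)
qed

lemma tangent_eq_0I:
  assumes c: "(U, x) \<in> \<A>" and q: "q \<in> U" and v: "v \<in> tangent_space \<A> q"
    and \<gamma>: "\<gamma> \<in> smooth_fun \<A>" "\<gamma> q = 1" "closed K" "K \<subseteq> U" "\<And>r. r \<notin> K \<Longrightarrow> \<gamma> r = 0"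
    and 0: "\<And>b. b \<in> Basis \<Longrightarrow> v (\<lambda>r. \<gamma> r * (x r \<bullet> b - x q \<bullet> b)) = 0"
  shows "v = 0"
  by (rule tangent_space_eqI[OF v subspace_0[OF subspace_tangent_space]])
     (simp add: tangent_coords[OF c q v _ \<gamma>] 0)

lemma coord_field_smooth:
  assumes c: "(U, x) \<in> \<A>" and \<beta>: "\<beta> \<in> smooth_fun \<A>" "closed K" "K \<subseteq> U" "\<And>r. r \<notin> K \<Longrightarrow> \<beta> r = 0"
  shows "smooth_vfield \<A> (coord_field \<A> U x \<beta> b)"
  unfolding smooth_vfield_def
proof safe
  fix q
  show "coord_field \<A> U x \<beta> b q \<in> tangent_space \<A> q"
  proof (cases "q \<in> U")
    case True
    have d: "(f \<circ> inv_into U x has_derivative frechet_derivative (f \<circ> inv_into U x) (at (x q))) (at (x q))"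
      if "f \<in> smooth_fun \<A>" for f
      using smooth_fun_onD_chart[OF c smooth_fun_on_smooth[OF that, of UNIV]] True
      by (intro smooth_on_has_derivative) auto
    have add: "frechet_derivative ((\<lambda>x. f x + g x) \<circ> inv_into U x) (at (x q)) b =
       frechet_derivative (f \<circ> inv_into U x) (at (x q)) b + frechet_derivative (g \<circ> inv_into U x) (at (x q)) b"
      if "f \<in> smooth_fun \<A>" "g \<in> smooth_fun \<A>" for f g
      using fun_cong[OF frechet_derivative_at[OF has_derivative_add[OF d[OF that(1)] d[OF that(2)]]], of b]
      by (simp add: comp_def)
    have mult: "frechet_derivative ((\<lambda>x. f x * g x) \<circ> inv_into U x) (at (x q)) b =
       frechet_derivative (f \<circ> inv_into U x) (at (x q)) b * g q + f q * frechet_derivative (g \<circ> inv_into U x) (at (x q)) b"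
      if "f \<in> smooth_fun \<A>" "g \<in> smooth_fun \<A>" for f g
      using fun_cong[OF frechet_derivative_at[OF has_derivative_mult[OF d[OF that(1)] d[OF that(2)]]], of b] True c
      by (simp add: comp_def)
    have scale: "frechet_derivative ((\<lambda>x. k * f x) \<circ> inv_into U x) (at (x q)) b =
       k * frechet_derivative (f \<circ> inv_into U x) (at (x q)) b" if "f \<in> smooth_fun \<A>" for f k
      using fun_cong[OF frechet_derivative_at[OF has_derivative_mult_right[OF d[OF that], of k]], of b]
      by (simp add: comp_def)
    show ?thesis
      unfolding tangent_space_def coord_field_def using True
      by (auto simp: add scale mult smooth_fun_add smooth_fun_scale smooth_fun_mult algebra_simps)
  next
    case False
    then have "coord_field \<A> U x \<beta> b q = 0" by (auto simp: coord_field_def)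
    then show ?thesis using subspace_0[OF subspace_tangent_space] by simp
  qed
next
  fix f assume f: "f \<in> smooth_fun \<A>"
  have "(\<lambda>q. \<beta> q * frechet_derivative (f \<circ> inv_into U x) (at (x q)) b) \<in> smooth_fun \<A>"
    by (intro bump_mult[OF \<beta>(1-3) chart_props(1)[OF c] \<beta>(4)] partial_smooth[OF c chart_props(1)[OF c]]
        smooth_fun_on_smooth f order_refl)
  also have "(\<lambda>q. \<beta> q * frechet_derivative (f \<circ> inv_into U x) (at (x q)) b) = (\<lambda>q. coord_field \<A> U x \<beta> b q f)"
    using \<beta>(3,4) f by (fastforce simp: coord_field_def)
  finally show "(\<lambda>q. coord_field \<A> U x \<beta> b q f) \<in> smooth_fun \<A>" .
qed

text \<open>Clearing the cut-off function \<open>\<beta>\<close> from the coordinate expansion of \<open>v\<close> gives an identity that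
  holds on the whole manifold and involves globally defined smooth objects only.\<close>

lemma local_frame:
  assumes c: "(U, x) \<in> \<A>" and \<beta>: "\<beta> \<in> smooth_fun \<A>" "closed K" "K \<subseteq> U" "\<And>r. r \<notin> K \<Longrightarrow> \<beta> r = 0"
    and v: "v \<in> tangent_space \<A> q"
  defines "w \<equiv> \<lambda>b r. \<beta> r * (x r \<bullet> b)"
  shows "(\<beta> q)^3 *\<^sub>R v = (\<Sum>b\<in>Basis. (\<beta> q * v (w b) - w b q * v \<beta>) *\<^sub>R coord_field \<A> U x \<beta> b q)"
proof (cases "\<beta> q = 0")
  case True
  then have "coord_field \<A> U x \<beta> b q = 0" for b by (auto simp: coord_field_def)
  then show ?thesis using True by simp
next
  case False
  then have q: "q \<in> U" using \<beta> by blast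
  have w: "w b \<in> smooth_fun \<A>" for b
    unfolding w_def by (rule bump_mult[OF \<beta>(1-3) chart_props(1)[OF c] \<beta>(4) coordinate_smooth[OF c]])
  obtain \<gamma> L where \<gamma>: "\<gamma> \<in> smooth_fun \<A>" "\<gamma> q = 1" "closed L" "L \<subseteq> U" "\<And>r. r \<notin> L \<Longrightarrow> \<gamma> r = 0"
    using bump_exists[OF chart_props(1)[OF c] q] by blast
  have h: "(\<lambda>r. \<gamma> r * (x r \<bullet> b - x q \<bullet> b)) \<in> smooth_fun \<A>" for b
    by (rule bump_mult[OF \<gamma>(1,3,4) chart_props(1)[OF c] \<gamma>(5) smooth_fun_on_diff[OF chart_props(1)[OF c] coordinate_smooth[OF c]
        smooth_fun_on_const[OF chart_props(1)[OF c]]]])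
  \<comment> \<open>Apply \<open>v\<close> to one function, \<beta>\<gamma> times the centred
    coordinate, factored in two ways: as \<beta> times the cut-off coordinate, and as \<gamma> times
    a combination of \<open>w b\<close> and \<beta>. In both factorings the second factor vanishes
    at \<open>q\<close>.\<close>
  have key: "\<beta> q * v (\<lambda>r. \<gamma> r * (x r \<bullet> b - x q \<bullet> b)) = v (w b) - (x q \<bullet> b) * v \<beta>" for b
  proof -
    have "v (\<lambda>r. \<beta> r * (\<gamma> r * (x r \<bullet> b - x q \<bullet> b))) = \<beta> q * v (\<lambda>r. \<gamma> r * (x r \<bullet> b - x q \<bullet> b))"
      using tangent_mult[OF v \<beta>(1) h[of b]] by simp
    moreover have "v (\<lambda>r. \<gamma> r * (w b r - (x q \<bullet> b) * \<beta> r)) = v (w b) - (x q \<bullet> b) * v \<beta>"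
      using tangent_mult[OF v \<gamma>(1) smooth_fun_diff[OF w smooth_fun_scale[OF \<beta>(1)]], of b "x q \<bullet> b"]
      by (simp add: \<gamma>(2) tangent_diff[OF v] w smooth_fun_scale \<beta>(1) tangent_scale[OF v]) (simp add: w_def)
    moreover have "(\<lambda>r. \<beta> r * (\<gamma> r * (x r \<bullet> b - x q \<bullet> b))) = (\<lambda>r. \<gamma> r * (w b r - (x q \<bullet> b) * \<beta> r))"
      by (simp add: w_def fun_eq_iff algebra_simps)
    ultimately show ?thesis by simp
  qed
  show ?thesis
  proof
    fix f
    show "((\<beta> q)^3 *\<^sub>R v) f = (\<Sum>b\<in>Basis. (\<beta> q * v (w b) - w b q * v \<beta>) *\<^sub>R coord_field \<A> U x \<beta> b q) f"
    proof (cases "f \<in> smooth_fun \<A>")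
      case False
      then show ?thesis
        by (simp add: tangent_nonsmooth[OF v] scaleR_fun_def coord_field_def sum_fun_apply)
    next
      case True
      let ?F = "\<lambda>b. frechet_derivative (f \<circ> inv_into U x) (at (x q)) b"
      have vf: "v f = (\<Sum>b\<in>Basis. v (\<lambda>r. \<gamma> r * (x r \<bullet> b - x q \<bullet> b)) * ?F b)"
        by (rule tangent_coords[OF c q v True \<gamma>(1-4)]) (rule \<gamma>(5))
      \<comment> \<open>The three factors \<beta> have separate tasks: one is the factor in
        \<open>key\<close>, one turns the coordinate \<open>x q \<bullet> b\<close> into
        \<open>w b q\<close>, and one is contained in \<open>coord_field\<close>.\<close>
      have "(\<beta> q)^3 * v f = (\<Sum>b\<in>Basis. (\<beta> q)\<^sup>2 * ((\<beta> q * v (\<lambda>r. \<gamma> r * (x r \<bullet> b - x q \<bullet> b))) * ?F b))"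
        unfolding vf sum_distrib_left
        by (rule sum.cong) (simp_all add: power3_eq_cube power2_eq_square mult_ac)
      also have "\<dots> = (\<Sum>b\<in>Basis. (\<beta> q * v (w b) - w b q * v \<beta>) * (\<beta> q * ?F b))"
        unfolding key by (simp add: w_def power2_eq_square algebra_simps)
      finally show ?thesis
        using q True by (simp add: scaleR_fun_def coord_field_def sum_fun_apply)
    qed
  qed
qed

end

section \<open>Smooth vector fields and their brackets\<close>

context manifold
begin

lemma vfield_tangent: "smooth_vfield \<A> X \<Longrightarrow> X p \<in> tangent_space \<A> p"
  and vfield_smooth: "smooth_vfield \<A> X \<Longrightarrow> f \<in> smooth_fun \<A> \<Longrightarrow> (\<lambda>p. X p f) \<in> smooth_fun \<A>"
  by (auto simp: smooth_vfield_def)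

lemma vfield_eqI:
  assumes "smooth_vfield \<A> X" "smooth_vfield \<A> Y" "\<And>p f. f \<in> smooth_fun \<A> \<Longrightarrow> X p f = Y p f"
  shows "X = Y"
  by (rule ext, rule tangent_space_eqI[OF vfield_tangent[OF assms(1)] vfield_tangent[OF assms(2)] assms(3)])

lemma vfield_add: "smooth_vfield \<A> X \<Longrightarrow> smooth_vfield \<A> Y \<Longrightarrow> smooth_vfield \<A> (X + Y)"
  unfolding smooth_vfield_def
  by (auto intro: subspace_add[OF subspace_tangent_space] smooth_fun_add)

lemma vfield_scale:
  "f \<in> smooth_fun \<A> \<Longrightarrow> smooth_vfield \<A> X \<Longrightarrow> smooth_vfield \<A> (\<lambda>p. f p *\<^sub>R X p)"
  unfolding smooth_vfield_def
  by (simp add: subspace_scale[OF subspace_tangent_space]) (simp add: scaleR_fun_def smooth_fun_mult)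

lemma vfield_zero: "smooth_vfield \<A> 0"
  unfolding smooth_vfield_def
  by (auto intro: subspace_0[OF subspace_tangent_space] smooth_fun_const)

lemma vfield_uminus: "smooth_vfield \<A> X \<Longrightarrow> smooth_vfield \<A> (- X)"
proof -
  assume "smooth_vfield \<A> X"
  moreover have "- X = (\<lambda>p. - 1 *\<^sub>R X p)" by (simp add: fun_eq_iff)
  ultimately show ?thesis using vfield_scale[OF smooth_fun_const, of X "- 1"] by simp
qed

lemma vfield_diff: "smooth_vfield \<A> X \<Longrightarrow> smooth_vfield \<A> Y \<Longrightarrow> smooth_vfield \<A> (X - Y)"
  using vfield_add[of X "- Y"] vfield_uminus[of Y] by simp

lemma vfield_sum:
  "(\<And>i. i \<in> I \<Longrightarrow> smooth_vfield \<A> (X i)) \<Longrightarrow> smooth_vfield \<A> (\<Sum>i\<in>I. X i)"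
  by (induction I rule: infinite_finite_induct) (auto intro: vfield_zero vfield_add)

lemma bracket_smooth:
  assumes X: "smooth_vfield \<A> X" and Y: "smooth_vfield \<A> Y"
  shows "smooth_vfield \<A> (lie_bracket X Y)"
  unfolding smooth_vfield_def
proof safe
  fix p
  note tX = vfield_tangent[OF X] and tY = vfield_tangent[OF Y]
  note sX = vfield_smooth[OF X] and sY = vfield_smooth[OF Y]
  show "lie_bracket X Y p \<in> tangent_space \<A> p"
    unfolding tangent_space_def lie_bracket_def
  proof (intro CollectI conjI ballI allI impI)
    \<comment> \<open>On a non-smooth \<open>f\<close> both inner functions are constantly zero, and
      derivations annihilate constants.\<close>
    fix f assume "f \<notin> smooth_fun \<A>"
    then show "X p (\<lambda>q. Y q f) - Y p (\<lambda>q. X q f) = 0"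
      by (simp add: tangent_nonsmooth[OF tX] tangent_nonsmooth[OF tY] tangent_const[OF tX] tangent_const[OF tY])
  next
    fix f g assume "f \<in> smooth_fun \<A>" "g \<in> smooth_fun \<A>"
    then show "X p (\<lambda>q. Y q (\<lambda>x. f x + g x)) - Y p (\<lambda>q. X q (\<lambda>x. f x + g x)) =
        X p (\<lambda>q. Y q f) - Y p (\<lambda>q. X q f) + (X p (\<lambda>q. Y q g) - Y p (\<lambda>q. X q g))"
      by (simp add: tangent_add[OF tX] tangent_add[OF tY] sX sY)
  next
    fix k f assume "f \<in> smooth_fun \<A>"
    then show "X p (\<lambda>q. Y q (\<lambda>x. k * f x)) - Y p (\<lambda>q. X q (\<lambda>x. k * f x)) =
        k * (X p (\<lambda>q. Y q f) - Y p (\<lambda>q. X q f))"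
      by (simp add: tangent_scale[OF tX] tangent_scale[OF tY] sX sY right_diff_distrib)
  next
    fix f g assume "f \<in> smooth_fun \<A>" "g \<in> smooth_fun \<A>"
    then show "X p (\<lambda>q. Y q (\<lambda>x. f x * g x)) - Y p (\<lambda>q. X q (\<lambda>x. f x * g x)) =
        (X p (\<lambda>q. Y q f) - Y p (\<lambda>q. X q f)) * g p + f p * (X p (\<lambda>q. Y q g) - Y p (\<lambda>q. X q g))"
      by (simp add: tangent_mult[OF tX] tangent_mult[OF tY] tangent_add[OF tX] tangent_add[OF tY]
          sX sY smooth_fun_mult) (simp add: algebra_simps)
  qed
next
  fix f assume "f \<in> smooth_fun \<A>"
  then show "(\<lambda>p. lie_bracket X Y p f) \<in> smooth_fun \<A>"
    unfolding lie_bracket_def by (intro smooth_fun_diff vfield_smooth[OF X] vfield_smooth[OF Y])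
qed

lemma bracket_skew: "lie_bracket Y X = - lie_bracket X Y"
  by (simp add: lie_bracket_def fun_eq_iff)

lemma bracket_add_left:
  assumes "smooth_vfield \<A> X" "smooth_vfield \<A> X'" "smooth_vfield \<A> Y"
  shows "lie_bracket (X + X') Y = lie_bracket X Y + lie_bracket X' Y"
proof (rule vfield_eqI)
  fix p f assume f: "f \<in> smooth_fun \<A>"
  show "lie_bracket (X + X') Y p f = (lie_bracket X Y + lie_bracket X' Y) p f"
    using tangent_add[OF vfield_tangent[OF assms(3)] vfield_smooth[OF assms(1) f] vfield_smooth[OF assms(2) f]]
    by (simp add: lie_bracket_def)
qed (intro bracket_smooth vfield_add assms)+

lemma bracket_scale_left:
  assumes X: "smooth_vfield \<A> X" and Y: "smooth_vfield \<A> Y" and a: "a \<in> smooth_fun \<A>"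
  shows "lie_bracket (\<lambda>p. a p *\<^sub>R X p) Y = (\<lambda>p. a p *\<^sub>R lie_bracket X Y p) - (\<lambda>p. Y p a *\<^sub>R X p)"
proof (rule vfield_eqI)
  fix p f assume f: "f \<in> smooth_fun \<A>"
  show "lie_bracket (\<lambda>p. a p *\<^sub>R X p) Y p f = ((\<lambda>p. a p *\<^sub>R lie_bracket X Y p) - (\<lambda>p. Y p a *\<^sub>R X p)) p f"
    using tangent_mult[OF vfield_tangent[OF Y] a vfield_smooth[OF X f]]
    by (simp add: lie_bracket_def scaleR_fun_def algebra_simps)
qed (intro bracket_smooth vfield_scale vfield_diff vfield_smooth[OF Y] X Y a)+

lemma bracket_add_right:
  assumes "smooth_vfield \<A> X" "smooth_vfield \<A> X'" "smooth_vfield \<A> Y"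
  shows "lie_bracket Y (X + X') = lie_bracket Y X + lie_bracket Y X'"
  using bracket_add_left[OF assms] by (simp add: bracket_skew[of Y])

lemma bracket_scale_right:
  assumes X: "smooth_vfield \<A> X" and Y: "smooth_vfield \<A> Y" and a: "a \<in> smooth_fun \<A>"
  shows "lie_bracket Y (\<lambda>p. a p *\<^sub>R X p) = (\<lambda>p. a p *\<^sub>R lie_bracket Y X p) + (\<lambda>p. Y p a *\<^sub>R X p)"
  using bracket_scale_left[OF assms] by (simp add: bracket_skew[of Y] fun_eq_iff)

end

section \<open>Product manifolds\<close>

lemma smooth_on_Pair:
  fixes f :: "'a::real_normed_vector \<Rightarrow> 'e::euclidean_space" and g :: "'a \<Rightarrow> 'f::euclidean_space"
  assumes "open S" "smooth_on S f" "smooth_on S g"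
  shows "smooth_on S (\<lambda>z. (f z, g z))"
proof -
  have "smooth_on S (\<lambda>z. (f z, 0::'f))" "smooth_on S (\<lambda>z. (0::'e, g z))"
    by (rule smooth_on_compose[OF assms(1) open_UNIV subset_UNIV
          smooth_on_bounded_linear[OF open_UNIV] assms(2)])
       (auto intro!: bounded_linear_Pair bounded_linear_ident bounded_linear_zero,
        rule smooth_on_compose[OF assms(1) open_UNIV subset_UNIV
          smooth_on_bounded_linear[OF open_UNIV] assms(3)],
        auto intro!: bounded_linear_Pair bounded_linear_ident bounded_linear_zero)
  from smooth_on_add[OF assms(1) this] show ?thesis by simp
qed

lemma map_prod_image: "map_prod x y ` (U \<times> V) = x ` U \<times> y ` V"
  by (fact map_prod_surj_on[OF refl refl])

lemma inv_into_map_prod: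
  assumes "inj_on x U" "inj_on y V" "a \<in> x ` U" "b \<in> y ` V"
  shows "inv_into (U \<times> V) (map_prod x y) (a, b) = (inv_into U x a, inv_into V y b)"
proof (rule inv_into_f_eq)
  show "inj_on (map_prod x y) (U \<times> V)" using assms(1,2) by (rule map_prod_inj_on)
qed (use assms in \<open>auto simp: inv_into_into f_inv_into_f\<close>)

locale two_manifolds = M: manifold \<A> + G: manifold \<G>
  for \<A> :: "('m::{t2_space,second_countable_topology}, 'e::euclidean_space) atlas"
    and \<G> :: "('g::{t2_space,second_countable_topology}, 'f::euclidean_space) atlas"
begin

abbreviation (input) product_atlas ("\<P>") where "\<P> \<equiv> prod_atlas \<A> \<G>"

lemma prod_chart: "(U, x) \<in> \<A> \<Longrightarrow> (V, y) \<in> \<G> \<Longrightarrow> (U \<times> V, map_prod x y) \<in> \<P>"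
  by (auto simp: prod_atlas_def)

lemma inv_prod_chart:
  assumes "(U, x) \<in> \<A>" "(V, y) \<in> \<G>" "a \<in> x ` U" "b \<in> y ` V"
  shows "inv_into (U \<times> V) (map_prod x y) (a, b) = (inv_into U x a, inv_into V y b)"
  by (rule inv_into_map_prod[OF M.chart_props(3)[OF assms(1)] G.chart_props(3)[OF assms(2)] assms(3,4)])

sublocale P: manifold \<P>
proof
  show "smooth_manifold \<P>" unfolding smooth_manifold_def
  proof (intro conjI ballI)
    fix c assume "c \<in> \<P>"
    then obtain U x V y where c: "c = (U \<times> V, map_prod x y)" "(U, x) \<in> \<A>" "(V, y) \<in> \<G>"
      by (auto simp: prod_atlas_def)
    have "continuous_on (x ` U \<times> y ` V) (\<lambda>z. (inv_into U x (fst z), inv_into V y (snd z)))"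
      by (intro continuous_on_Pair continuous_on_compose2[OF M.chart_props(5)[OF c(2)]]
          continuous_on_compose2[OF G.chart_props(5)[OF c(3)]] continuous_intros) auto
    then have "continuous_on (x ` U \<times> y ` V) (inv_into (U \<times> V) (map_prod x y))"
      by (rule continuous_on_eq) (use inv_prod_chart[OF c(2,3)] in auto)
    moreover have "continuous_on (U \<times> V) (map_prod x y)"
      unfolding map_prod_def split_beta
      by (intro continuous_on_Pair continuous_on_compose2[OF M.chart_props(4)[OF c(2)]]
          continuous_on_compose2[OF G.chart_props(4)[OF c(3)]] continuous_intros) auto
    ultimately show "is_chart c"
      unfolding is_chart_def c(1) prod.case map_prod_image
      using M.chart_props[OF c(2)] G.chart_props[OF c(3)]
      by (auto intro!: open_Times map_prod_inj_on)
  next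
    show "(\<Union>(U, x)\<in>\<P>. U) = UNIV"
    proof -
      have "z \<in> (\<Union>(U, x)\<in>\<P>. U)" for z
      proof -
        obtain U x where "(U, x) \<in> \<A>" "fst z \<in> U" using M.chart_at .
        moreover obtain V y where "(V, y) \<in> \<G>" "snd z \<in> V" using G.chart_at .
        ultimately show ?thesis by (intro UN_I[OF prod_chart]) (auto simp: mem_Times_iff)
      qed
      then show ?thesis by auto
    qed
  next
    have transition: "smooth_on (snd c ` (fst c \<inter> fst d)) (snd d \<circ> inv_into (fst c) (snd c))"
      if "c \<in> \<P>" "d \<in> \<P>" for c d
    proof -
      from that obtain U x V y U' x' V' y' where
        c: "c = (U \<times> V, map_prod x y)" "(U, x) \<in> \<A>" "(V, y) \<in> \<G>" and
        d: "d = (U' \<times> V', map_prod x' y')" "(U', x') \<in> \<A>" "(V', y') \<in> \<G>"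
        by (auto simp: prod_atlas_def)
      define S T where "S = x ` (U \<inter> U')" and "T = y ` (V \<inter> V')"
      have o: "open S" "open T" unfolding S_def T_def
        using M.chart_open[OF c(2) M.chart_props(1)[OF d(2)]] G.chart_open[OF c(3) G.chart_props(1)[OF d(3)]] .
      then have oST: "open (S \<times> T)" by (rule open_Times)
      have img: "map_prod x y ` ((U \<times> V) \<inter> (U' \<times> V')) = S \<times> T"
        unfolding S_def T_def map_prod_image[symmetric] by auto
      have s: "smooth_on S (x' \<circ> inv_into U x)" "smooth_on T (y' \<circ> inv_into V y)"
        using M.manifold G.manifold c d unfolding S_def T_def smooth_manifold_def by blast+
      have "smooth_on (S \<times> T) (\<lambda>z. (x' \<circ> inv_into U x) (fst z))"
        by (rule smooth_on_compose[OF oST o(1) _ s(1) smooth_on_bounded_linear[OF oST bounded_linear_fst]]) auto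
      moreover have "smooth_on (S \<times> T) (\<lambda>z. (y' \<circ> inv_into V y) (snd z))"
        by (rule smooth_on_compose[OF oST o(2) _ s(2) smooth_on_bounded_linear[OF oST bounded_linear_snd]]) auto
      ultimately have "smooth_on (S \<times> T) (\<lambda>z. ((x' \<circ> inv_into U x) (fst z), (y' \<circ> inv_into V y) (snd z)))"
        by (rule smooth_on_Pair[OF oST])
      then have "smooth_on (S \<times> T) (map_prod x' y' \<circ> inv_into (U \<times> V) (map_prod x y))"
        by (rule smooth_on_cong[OF oST, THEN iffD1, rotated])
           (auto simp: S_def T_def inv_prod_chart[OF c(2,3)])
      then show ?thesis unfolding c(1) d(1) fst_conv snd_conv img .
    qed
    fix c assume "c \<in> \<P>"
    then show "case c of (U, x) \<Rightarrow> \<forall>(V, y)\<in>\<P>. smooth_on (x ` (U \<inter> V)) (y \<circ> inv_into U x)"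
      using transition by (fastforce split: prod.split)
  qed
qed

lemma prod_chart_at:
  obtains U x V y where "(U, x) \<in> \<A>" "(V, y) \<in> \<G>" "fst z \<in> U" "snd z \<in> V"
  using M.chart_at G.chart_at by metis

lemma smooth_fun_prodI:
  assumes "\<And>U x V y. (U, x) \<in> \<A> \<Longrightarrow> (V, y) \<in> \<G> \<Longrightarrow>
    smooth_on (x ` U \<times> y ` V) (\<lambda>z. f (inv_into U x (fst z), inv_into V y (snd z)))"
  shows "f \<in> smooth_fun \<P>"
  unfolding smooth_fun_def
proof safe
  fix W z assume "(W, z) \<in> \<P>"
  then obtain U x V y where c: "W = U \<times> V" "z = map_prod x y" "(U, x) \<in> \<A>" "(V, y) \<in> \<G>"
    by (auto simp: prod_atlas_def)
  have "smooth_on (x ` U \<times> y ` V) (f \<circ> inv_into (U \<times> V) (map_prod x y))"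
    using assms[OF c(3,4)]
    by (rule smooth_on_cong[THEN iffD1, rotated -1])
       (use M.chart_props(2)[OF c(3)] G.chart_props(2)[OF c(4)] in \<open>auto simp: open_Times inv_prod_chart[OF c(3,4)]\<close>)
  then show "smooth_on (z ` W) (f \<circ> inv_into W z)" by (simp only: c(1,2) map_prod_image)
qed

lemma smooth_fun_prodD:
  assumes "f \<in> smooth_fun \<P>" and c: "(U, x) \<in> \<A>" "(V, y) \<in> \<G>"
  shows "smooth_on (x ` U \<times> y ` V) (\<lambda>z. f (inv_into U x (fst z), inv_into V y (snd z)))"
proof -
  have "smooth_on (x ` U \<times> y ` V) (f \<circ> inv_into (U \<times> V) (map_prod x y))"
    using assms(1) prod_chart[OF c] unfolding smooth_fun_def by (fastforce simp: map_prod_image)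
  then show ?thesis
    by (rule smooth_on_cong[THEN iffD1, rotated -1])
       (use M.chart_props(2)[OF c(1)] G.chart_props(2)[OF c(2)] in \<open>auto simp: open_Times inv_prod_chart[OF c]\<close>)
qed

lemma smooth_fun_fst: "f \<in> smooth_fun \<A> \<Longrightarrow> (\<lambda>z. f (fst z)) \<in> smooth_fun \<P>"
proof (rule smooth_fun_prodI)
  fix U x V y assume f: "f \<in> smooth_fun \<A>" and c: "(U, x) \<in> \<A>" "(V, y) \<in> \<G>"
  have "smooth_on (x ` U) (f \<circ> inv_into U x)" using f c by (auto simp: smooth_fun_def)
  from smooth_on_compose[OF open_Times[OF M.chart_props(2)[OF c(1)] G.chart_props(2)[OF c(2)]]
      M.chart_props(2)[OF c(1)] _ this, of fst]
  show "smooth_on (x ` U \<times> y ` V) (\<lambda>z. f (fst (inv_into U x (fst z), inv_into V y (snd z))))"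
    using M.chart_props(2)[OF c(1)] G.chart_props(2)[OF c(2)]
    by (auto simp: open_Times comp_def smooth_on_bounded_linear bounded_linear_fst)
qed

lemma smooth_fun_snd: "f \<in> smooth_fun \<G> \<Longrightarrow> (\<lambda>z. f (snd z)) \<in> smooth_fun \<P>"
proof (rule smooth_fun_prodI)
  fix U x V y assume f: "f \<in> smooth_fun \<G>" and c: "(U, x) \<in> \<A>" "(V, y) \<in> \<G>"
  have "smooth_on (y ` V) (f \<circ> inv_into V y)" using f c by (auto simp: smooth_fun_def)
  from smooth_on_compose[OF open_Times[OF M.chart_props(2)[OF c(1)] G.chart_props(2)[OF c(2)]]
      G.chart_props(2)[OF c(2)] _ this, of snd]
  show "smooth_on (x ` U \<times> y ` V) (\<lambda>z. f (snd (inv_into U x (fst z), inv_into V y (snd z))))"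
    using M.chart_props(2)[OF c(1)] G.chart_props(2)[OF c(2)]
    by (auto simp: open_Times comp_def smooth_on_bounded_linear bounded_linear_snd)
qed

lemma smooth_fun_section: "f \<in> smooth_fun \<P> \<Longrightarrow> (\<lambda>q. f (q, g)) \<in> smooth_fun \<A>"
  unfolding smooth_fun_def[of \<A>]
proof safe
  fix U x assume f: "f \<in> smooth_fun \<P>" and c: "(U, x) \<in> \<A>"
  obtain V y where V: "(V, y) \<in> \<G>" "g \<in> V" using G.chart_at .
  have "smooth_on (x ` U) (\<lambda>a. (a, y g))"
    by (intro smooth_on_Pair smooth_on_const smooth_on_bounded_linear bounded_linear_ident M.chart_props c)
  from smooth_on_compose[OF M.chart_props(2)[OF c]
     open_Times[OF M.chart_props(2)[OF c] G.chart_props(2)[OF V(1)]] _ smooth_fun_prodD[OF f c V(1)] this]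
  show "smooth_on (x ` U) ((\<lambda>q. f (q, g)) \<circ> inv_into U x)"
    using V by (auto simp: comp_def)
qed

text \<open>Transfers statements about the first factor to the second: they are applied in the
  locale with the factors exchanged and swapped back.\<close>

lemma smooth_fun_swap:
  assumes "f \<in> smooth_fun (prod_atlas \<G> \<A>)"
  shows "(\<lambda>z. f (snd z, fst z)) \<in> smooth_fun \<P>"
proof (rule smooth_fun_prodI)
  fix U x V y assume c: "(U, x) \<in> \<A>" "(V, y) \<in> \<G>"
  interpret S: two_manifolds \<G> \<A> by unfold_locales
  have o: "open (x ` U \<times> y ` V)" "open (y ` V \<times> x ` U)"
    using M.chart_props(2)[OF c(1)] G.chart_props(2)[OF c(2)] by (auto simp: open_Times)
  have "smooth_on (x ` U \<times> y ` V) (\<lambda>z. (snd z, fst z))"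
    by (intro smooth_on_Pair smooth_on_bounded_linear bounded_linear_fst bounded_linear_snd o)
  from smooth_on_compose[OF o _ S.smooth_fun_prodD[OF assms c(2,1)] this]
  show "smooth_on (x ` U \<times> y ` V) (\<lambda>z. f (snd (inv_into U x (fst z), inv_into V y (snd z)),
      fst (inv_into U x (fst z), inv_into V y (snd z))))"
    by (force simp: image_subset_iff)
qed

lemma smooth_fun_section': "f \<in> smooth_fun \<P> \<Longrightarrow> (\<lambda>h. f (p, h)) \<in> smooth_fun \<G>"
proof -
  assume f: "f \<in> smooth_fun \<P>"
  interpret S: two_manifolds \<G> \<A> by unfold_locales
  show ?thesis using S.smooth_fun_section[OF S.smooth_fun_swap[OF f]] by simp
qed

text \<open>Differentiating in the first factor only keeps smoothness in both: expand in a local frame.\<close>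

lemma smooth_fun_partial_vfield:
  assumes X: "smooth_vfield \<A> X" and f: "f \<in> smooth_fun \<P>"
  shows "(\<lambda>z. X (fst z) (\<lambda>q. f (q, snd z))) \<in> smooth_fun \<P>"
proof (rule P.smooth_fun_local)
  fix z0 :: "'m \<times> 'g"
  obtain U x V y where c: "(U, x) \<in> \<A>" "(V, y) \<in> \<G>" and z0: "fst z0 \<in> U" "snd z0 \<in> V"
    using prod_chart_at .
  obtain \<beta> K where \<beta>: "\<beta> \<in> smooth_fun \<A>" "\<beta> (fst z0) = 1" "closed K" "K \<subseteq> U" "\<And>q. q \<notin> K \<Longrightarrow> \<beta> q = 0"
    using M.bump_exists[OF M.chart_props(1)[OF c(1)] z0(1)] by blast
  define w where "w b r = \<beta> r * (x r \<bullet> b)" for b r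
  have w: "w b \<in> smooth_fun \<A>" for b
    unfolding w_def by (rule M.bump_mult[OF \<beta>(1,3,4) M.chart_props(1)[OF c(1)] \<beta>(5) M.coordinate_smooth[OF c(1)]])
  \<comment> \<open>On \<open>W\<close> the cut-off function has no zero, so the cleared expansion
    can be divided by its cube there.\<close>
  define W where "W = (\<beta> -` (- {0})) \<times> V"
  have oW: "open W" "z0 \<in> W"
    using M.smooth_fun_continuous[OF \<beta>(1)] continuous_on_open_vimage[of UNIV \<beta>] G.chart_props(1)[OF c(2)] z0 \<beta>(2)
    unfolding W_def by (auto intro!: open_Times open_vimage simp: mem_Times_iff)
  have WU: "fst z \<in> U" "snd z \<in> V" "\<beta> (fst z) \<noteq> 0" if "z \<in> W" for z
    using that \<beta>(5)[of "fst z"] \<beta>(4) unfolding W_def by (cases "fst z \<in> K"; auto dest: subsetD)+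
  let ?F = "f \<circ> inv_into (U \<times> V) (map_prod x y)"
  \<comment> \<open>A derivative of the representation of \<open>f\<close> in the product chart,
    hence smooth in both variables together; the slice derivative in \<open>coord_field\<close> is
    expressed through it below.\<close>
  define D where "D b z = frechet_derivative ?F (at (map_prod x y z)) (b, 0)" for b z
  have D: "D b \<in> smooth_fun_on \<P> W" for b
    unfolding D_def
    by (rule P.partial_smooth[OF prod_chart[OF c] oW(1) _ P.smooth_fun_on_smooth[OF f]]) (use WU in \<open>auto simp: mem_Times_iff\<close>)
  have cf: "coord_field \<A> U x \<beta> b (fst z) (\<lambda>q. f (q, snd z)) = \<beta> (fst z) * D b z" if z: "z \<in> W" for b z
  proof -
    have sm: "smooth_on (map_prod x y ` (U \<times> V)) ?F"
      using f prod_chart[OF c] unfolding smooth_fun_def by fastforce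
    have "(?F has_derivative frechet_derivative ?F (at (map_prod x y z))) (at (map_prod x y z))"
      by (rule smooth_on_has_derivative[OF sm]) (use WU[OF z] in \<open>auto simp: mem_Times_iff intro!: imageI\<close>)
    then have d: "(?F has_derivative frechet_derivative ?F (at (map_prod x y z))) (at (x (fst z), y (snd z)))"
      by (simp add: map_prod_def split_beta)
    have "((\<lambda>a. (a, y (snd z))) has_derivative (\<lambda>b. (b, 0))) (at (x (fst z)))"
      by (auto intro!: derivative_eq_intros)
    then have "((\<lambda>a. ?F (a, y (snd z))) has_derivative (\<lambda>b. D b z)) (at (x (fst z)))"
      unfolding D_def by (rule has_derivative_compose[where f = "\<lambda>a. (a, y (snd z))"]) (rule d)
    then have "((\<lambda>q. f (q, snd z)) \<circ> inv_into U x has_derivative (\<lambda>b. D b z)) (at (x (fst z)))"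
      by (rule has_derivative_transform_within_open[OF _ M.chart_props(2)[OF c(1)]])
         (use WU[OF z] c in \<open>auto simp: inv_prod_chart[OF c]\<close>)
    from frechet_derivative_at[OF this] show ?thesis
      using smooth_fun_section[OF f, of "snd z"] WU[OF z] by (simp add: coord_field_def fun_eq_iff)
  qed
  \<comment> \<open>The expansion of \<open>local_frame\<close> along the slice, divided by the cube
    of the cut-off. Every ingredient is now smooth on the product.\<close>
  define R where "R z = (\<Sum>b\<in>Basis. (\<beta> (fst z) * X (fst z) (w b) - w b (fst z) * X (fst z) \<beta>) * (\<beta> (fst z) * D b z))
     * inverse (\<beta> (fst z) * \<beta> (fst z) * \<beta> (fst z))" for z
  have "R \<in> smooth_fun_on \<P> W"
    unfolding R_def using WU
    by (intro P.smooth_fun_on_mult P.smooth_fun_on_sum P.smooth_fun_on_diff P.smooth_fun_on_inverse oW D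
        P.smooth_fun_on_smooth smooth_fun_fst[OF \<beta>(1)] smooth_fun_fst[OF w] smooth_fun_fst[OF M.vfield_smooth[OF X]] w \<beta>(1)) auto
  then have "(\<lambda>z. X (fst z) (\<lambda>q. f (q, snd z))) \<in> smooth_fun_on \<P> W"
  proof (rule P.smooth_fun_on_cong[OF oW(1), rotated])
    fix z assume z: "z \<in> W"
    have "((\<beta> (fst z))^3 *\<^sub>R X (fst z)) (\<lambda>q. f (q, snd z)) =
       (\<Sum>b\<in>Basis. (\<beta> (fst z) * X (fst z) (w b) - w b (fst z) * X (fst z) \<beta>) *\<^sub>R coord_field \<A> U x \<beta> b (fst z)) (\<lambda>q. f (q, snd z))"
      unfolding w_def
      by (subst M.local_frame[OF c(1) \<beta>(1,3,4) _ M.vfield_tangent[OF X]]) (use \<beta>(5) in auto)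
    then show "R z = X (fst z) (\<lambda>q. f (q, snd z))"
      using WU[OF z] by (simp add: sum_fun_apply scaleR_fun_def cf[OF z] R_def power3_eq_cube field_simps)
  qed
  then show "\<exists>W'. open W' \<and> z0 \<in> W' \<and> (\<lambda>z. X (fst z) (\<lambda>q. f (q, snd z))) \<in> smooth_fun_on \<P> W'"
    using oW by blast
qed

lemma smooth_fun_partial_vfield':
  assumes Y: "smooth_vfield \<G> Y" and f: "f \<in> smooth_fun \<P>"
  shows "(\<lambda>z. Y (snd z) (\<lambda>h. f (fst z, h))) \<in> smooth_fun \<P>"
proof -
  interpret S: two_manifolds \<G> \<A> by unfold_locales
  show ?thesis using smooth_fun_swap[OF S.smooth_fun_partial_vfield[OF Y S.smooth_fun_swap[OF f]]] by simp
qed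

end

section \<open>Splitting of the tangent spaces of a product\<close>

context two_manifolds
begin

abbreviation dfst :: "('m \<times> 'g) tvec \<Rightarrow> 'm tvec" where "dfst \<equiv> differential \<P> \<A> fst"
abbreviation dsnd :: "('m \<times> 'g) tvec \<Rightarrow> 'g tvec" where "dsnd \<equiv> differential \<P> \<G> snd"
abbreviation pair :: "'m \<times> 'g \<Rightarrow> 'm tvec \<Rightarrow> 'g tvec \<Rightarrow> ('m \<times> 'g) tvec" where "pair \<equiv> pair_tvec \<A> \<G>"

lemma dfst_apply: "f \<in> smooth_fun \<A> \<Longrightarrow> dfst u f = u (\<lambda>z. f (fst z))"
  and dsnd_apply: "h \<in> smooth_fun \<G> \<Longrightarrow> dsnd u h = u (\<lambda>z. h (snd z))"
  by (simp_all add: differential_def comp_def)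

lemma pair_apply: "f \<in> smooth_fun \<P> \<Longrightarrow>
    pair z v w f = v (\<lambda>q. f (q, snd z)) + w (\<lambda>h. f (fst z, h))"
  by (cases z) (simp add: pair_tvec_def differential_def comp_def)

lemma pair_nonsmooth: "f \<notin> smooth_fun \<P> \<Longrightarrow> pair z v w f = 0"
  by (cases z) (simp add: pair_tvec_def differential_def)

lemma pair_add: "pair z (v + v') (w + w') = pair z v w + pair z v' w'"
  by (rule ext, rename_tac f, case_tac "f \<in> smooth_fun \<P>") (simp_all add: pair_apply pair_nonsmooth)

lemma pair_scale: "pair z (c *\<^sub>R v) (c *\<^sub>R w) = c *\<^sub>R pair z v w"
  by (rule ext, rename_tac f, case_tac "f \<in> smooth_fun \<P>")
     (simp_all add: pair_apply pair_nonsmooth scaleR_fun_def algebra_simps)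

lemma dfst_tangent:
  assumes u: "u \<in> tangent_space \<P> z" shows "dfst u \<in> tangent_space \<A> (fst z)"
  unfolding tangent_space_def
  by (auto simp: differential_def comp_def tangent_add[OF u] tangent_scale[OF u] tangent_mult[OF u]
      smooth_fun_fst M.smooth_fun_add M.smooth_fun_mult M.smooth_fun_scale)

lemma dsnd_tangent:
  assumes u: "u \<in> tangent_space \<P> z" shows "dsnd u \<in> tangent_space \<G> (snd z)"
  unfolding tangent_space_def
  by (auto simp: differential_def comp_def tangent_add[OF u] tangent_scale[OF u] tangent_mult[OF u]
      smooth_fun_snd G.smooth_fun_add G.smooth_fun_mult G.smooth_fun_scale)

lemma pair_tangent:
  assumes v: "v \<in> tangent_space \<A> (fst z)" and w: "w \<in> tangent_space \<G> (snd z)"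
  shows "pair z v w \<in> tangent_space \<P> z"
  unfolding tangent_space_def
  by (auto simp: pair_nonsmooth pair_apply tangent_add[OF v] tangent_scale[OF v] tangent_mult[OF v]
      tangent_add[OF w] tangent_scale[OF w] tangent_mult[OF w] smooth_fun_section smooth_fun_section'
      P.smooth_fun_add P.smooth_fun_scale P.smooth_fun_mult algebra_simps)

lemma dfst_pair:
  assumes "v \<in> tangent_space \<A> (fst z)" "w \<in> tangent_space \<G> (snd z)"
  shows "dfst (pair z v w) = v"
  by (rule tangent_space_eqI[OF dfst_tangent[OF pair_tangent[OF assms]] assms(1)])
     (simp add: dfst_apply pair_apply smooth_fun_fst G.tangent_const[OF assms(2)])

lemma dsnd_pair:
  assumes "v \<in> tangent_space \<A> (fst z)" "w \<in> tangent_space \<G> (snd z)"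
  shows "dsnd (pair z v w) = w"
  by (rule tangent_space_eqI[OF dsnd_tangent[OF pair_tangent[OF assms]] assms(2)])
     (simp add: dsnd_apply pair_apply smooth_fun_snd M.tangent_const[OF assms(1)])

text \<open>The hypotheses say that \<open>u\<close> annihilates all functions pulled back from a
  factor. With a product cut-off, each centred coordinate of the product chart is a product of two
  such functions, so the product rule gives zero, and the coordinates determine
  \<open>u\<close>.\<close>

lemma tangent_prod_eq_0I:
  assumes u: "u \<in> tangent_space \<P> z" and "dfst u = 0" "dsnd u = 0"
  shows "u = 0"
proof -
  have u1: "u (\<lambda>z. f (fst z)) = 0" if "f \<in> smooth_fun \<A>" for f
    using dfst_apply[OF that, of u] assms(2) by simp
  have u2: "u (\<lambda>z. h (snd z)) = 0" if "h \<in> smooth_fun \<G>" for h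
    using dsnd_apply[OF that, of u] assms(3) by simp
  obtain U x V y where c: "(U, x) \<in> \<A>" "(V, y) \<in> \<G>" and z: "fst z \<in> U" "snd z \<in> V"
    using prod_chart_at .
  obtain \<gamma> K where \<gamma>: "\<gamma> \<in> smooth_fun \<A>" "\<gamma> (fst z) = 1" "closed K" "K \<subseteq> U" "\<And>q. q \<notin> K \<Longrightarrow> \<gamma> q = 0"
    using M.bump_exists[OF M.chart_props(1)[OF c(1)] z(1)] by blast
  obtain \<delta> L where \<delta>: "\<delta> \<in> smooth_fun \<G>" "\<delta> (snd z) = 1" "closed L" "L \<subseteq> V" "\<And>q. q \<notin> L \<Longrightarrow> \<delta> q = 0"
    using G.bump_exists[OF G.chart_props(1)[OF c(2)] z(2)] by blast
  have h1: "(\<lambda>r. \<gamma> r * (x r \<bullet> b - x (fst z) \<bullet> b)) \<in> smooth_fun \<A>" for b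
    by (rule M.bump_mult[OF \<gamma>(1,3,4) M.chart_props(1)[OF c(1)] \<gamma>(5) M.smooth_fun_on_diff[OF M.chart_props(1)[OF c(1)]
        M.coordinate_smooth[OF c(1)] M.smooth_fun_on_const[OF M.chart_props(1)[OF c(1)]]]])
  have h2: "(\<lambda>r. \<delta> r * (y r \<bullet> b - y (snd z) \<bullet> b)) \<in> smooth_fun \<G>" for b
    by (rule G.bump_mult[OF \<delta>(1,3,4) G.chart_props(1)[OF c(2)] \<delta>(5) G.smooth_fun_on_diff[OF G.chart_props(1)[OF c(2)]
        G.coordinate_smooth[OF c(2)] G.smooth_fun_on_const[OF G.chart_props(1)[OF c(2)]]]])
  show ?thesis
  proof (rule P.tangent_eq_0I[OF prod_chart[OF c] _ u])
    show "z \<in> U \<times> V" using z by (simp add: mem_Times_iff)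
    show "(\<lambda>r. \<gamma> (fst r) * \<delta> (snd r)) \<in> smooth_fun \<P>"
      by (intro P.smooth_fun_mult smooth_fun_fst smooth_fun_snd \<gamma> \<delta>)
    show "closed (K \<times> L)" using \<gamma> \<delta> by (intro closed_Times)
    show "K \<times> L \<subseteq> U \<times> V" using \<gamma> \<delta> by auto
    show "\<gamma> (fst r) * \<delta> (snd r) = 0" if "r \<notin> K \<times> L" for r
      using that \<gamma>(5) \<delta>(5) by (auto simp: mem_Times_iff)
  next
    fix b :: "'e \<times> 'f" assume "b \<in> Basis"
    then consider b1 where "b = (b1, 0)" | b2 where "b = (0, b2)" by (auto simp: Basis_prod_def)
    then show "u (\<lambda>r. \<gamma> (fst r) * \<delta> (snd r) * (map_prod x y r \<bullet> b - map_prod x y z \<bullet> b)) = 0"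
    proof cases
      case 1
      have "(\<lambda>r. \<gamma> (fst r) * \<delta> (snd r) * (map_prod x y r \<bullet> b - map_prod x y z \<bullet> b)) =
        (\<lambda>r. (\<gamma> (fst r) * (x (fst r) \<bullet> b1 - x (fst z) \<bullet> b1)) * \<delta> (snd r))"
        by (auto simp: 1 inner_prod_def)
      then show ?thesis
        using tangent_mult[OF u smooth_fun_fst[OF h1] smooth_fun_snd[OF \<delta>(1)], of b1] u1[OF h1] by simp
    next
      case 2
      have "(\<lambda>r. \<gamma> (fst r) * \<delta> (snd r) * (map_prod x y r \<bullet> b - map_prod x y z \<bullet> b)) =
        (\<lambda>r. \<gamma> (fst r) * (\<delta> (snd r) * (y (snd r) \<bullet> b2 - y (snd z) \<bullet> b2)))"
        by (auto simp: 2 inner_prod_def)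
      then show ?thesis
        using tangent_mult[OF u smooth_fun_fst[OF \<gamma>(1)] smooth_fun_snd[OF h2], of b2] u2[OF h2] by simp
    qed
  qed (use \<gamma> \<delta> in simp)
qed

lemma dfst_diff: "dfst (u - u') = dfst u - dfst u'"
  and dsnd_diff: "dsnd (u - u') = dsnd u - dsnd u'"
  and dfst_add: "dfst (u + u') = dfst u + dfst u'"
  and dsnd_add: "dsnd (u + u') = dsnd u + dsnd u'"
  and dfst_scale: "dfst (c *\<^sub>R u) = c *\<^sub>R dfst u"
  and dsnd_scale: "dsnd (c *\<^sub>R u) = c *\<^sub>R dsnd u"
  by (auto simp: differential_def fun_eq_iff scaleR_fun_def)

lemma tangent_prod_eqI:
  assumes "u \<in> tangent_space \<P> z" "u' \<in> tangent_space \<P> z" "dfst u = dfst u'" "dsnd u = dsnd u'"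
  shows "u = u'"
  using tangent_prod_eq_0I[OF subspace_diff[OF subspace_tangent_space assms(1,2)]] assms(3,4)
  by (simp add: dfst_diff dsnd_diff)

section \<open>Lifts of vector fields from the factors\<close>

definition lift_fst :: "'m vfield \<Rightarrow> ('m \<times> 'g) vfield" where
  "lift_fst X = (\<lambda>z. pair z (X (fst z)) 0)"

definition lift_snd :: "'g vfield \<Rightarrow> ('m \<times> 'g) vfield" where
  "lift_snd Y = (\<lambda>z. pair z 0 (Y (snd z)))"

lemma lift_fst_apply: "f \<in> smooth_fun \<P> \<Longrightarrow> lift_fst X z f = X (fst z) (\<lambda>q. f (q, snd z))"
  by (simp add: lift_fst_def pair_apply)

lemma lift_snd_apply: "f \<in> smooth_fun \<P> \<Longrightarrow> lift_snd Y z f = Y (snd z) (\<lambda>h. f (fst z, h))"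
  by (simp add: lift_snd_def pair_apply)

lemma lift_fst_smooth: assumes "smooth_vfield \<A> X" shows "smooth_vfield \<P> (lift_fst X)"
  unfolding smooth_vfield_def
proof safe
  fix p g show "lift_fst X (p, g) \<in> tangent_space \<P> (p, g)"
    unfolding lift_fst_def using M.vfield_tangent[OF assms]
    by (intro pair_tangent) (auto intro: subspace_0[OF subspace_tangent_space])
next
  fix f assume "f \<in> smooth_fun \<P>"
  then show "(\<lambda>z. lift_fst X z f) \<in> smooth_fun \<P>"
    using smooth_fun_partial_vfield[OF assms] by (simp add: lift_fst_apply)
qed

lemma lift_snd_smooth: assumes "smooth_vfield \<G> Y" shows "smooth_vfield \<P> (lift_snd Y)"
  unfolding smooth_vfield_def
proof safe
  fix p g show "lift_snd Y (p, g) \<in> tangent_space \<P> (p, g)"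
    unfolding lift_snd_def using G.vfield_tangent[OF assms]
    by (intro pair_tangent) (auto intro: subspace_0[OF subspace_tangent_space])
next
  fix f assume "f \<in> smooth_fun \<P>"
  then show "(\<lambda>z. lift_snd Y z f) \<in> smooth_fun \<P>"
    using smooth_fun_partial_vfield'[OF assms] by (simp add: lift_snd_apply)
qed

lemma dfst_lift_fst: "smooth_vfield \<A> X \<Longrightarrow> dfst (lift_fst X z) = X (fst z)"
  and dsnd_lift_fst: "smooth_vfield \<A> X \<Longrightarrow> dsnd (lift_fst X z) = 0"
  unfolding lift_fst_def
  using M.vfield_tangent[of X "fst z"] subspace_0[OF subspace_tangent_space, of \<G> "snd z"]
  by (auto intro: dfst_pair dsnd_pair)

lemma dfst_lift_snd: "smooth_vfield \<G> Y \<Longrightarrow> dfst (lift_snd Y z) = 0"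
  and dsnd_lift_snd: "smooth_vfield \<G> Y \<Longrightarrow> dsnd (lift_snd Y z) = Y (snd z)"
  unfolding lift_snd_def
  using G.vfield_tangent[of Y "snd z"] subspace_0[OF subspace_tangent_space, of \<A> "fst z"]
  by (auto intro: dfst_pair dsnd_pair)

lemma lift_fst_on_fst: "f \<in> smooth_fun \<A> \<Longrightarrow> lift_fst X z (\<lambda>z. f (fst z)) = X (fst z) f"
  by (simp add: lift_fst_apply smooth_fun_fst)

lemma lift_snd_on_snd: "f \<in> smooth_fun \<G> \<Longrightarrow> lift_snd Y z (\<lambda>z. f (snd z)) = Y (snd z) f"
  by (simp add: lift_snd_apply smooth_fun_snd)

lemma lift_snd_on_fst:
  assumes "smooth_vfield \<G> Y" "f \<in> smooth_fun \<A>" shows "lift_snd Y z (\<lambda>z. f (fst z)) = 0"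
  using G.tangent_const[OF G.vfield_tangent[OF assms(1)]] assms(2) by (simp add: lift_snd_apply smooth_fun_fst)

lemma lift_fst_on_snd:
  assumes "smooth_vfield \<A> X" "f \<in> smooth_fun \<G>" shows "lift_fst X z (\<lambda>z. f (snd z)) = 0"
  using M.tangent_const[OF M.vfield_tangent[OF assms(1)]] assms(2) by (simp add: lift_fst_apply smooth_fun_snd)

lemma bracket_lift_fst:
  assumes X: "smooth_vfield \<A> X" and Y: "smooth_vfield \<A> Y"
  shows "lie_bracket (lift_fst X) (lift_fst Y) = lift_fst (lie_bracket X Y)"
proof (rule P.vfield_eqI)
  fix z f assume f: "f \<in> smooth_fun \<P>"
  show "lie_bracket (lift_fst X) (lift_fst Y) z f = lift_fst (lie_bracket X Y) z f"
    using P.vfield_smooth[OF lift_fst_smooth[OF X] f] P.vfield_smooth[OF lift_fst_smooth[OF Y] f] f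
    by (simp add: lie_bracket_def lift_fst_apply)
qed (intro P.bracket_smooth M.bracket_smooth lift_fst_smooth X Y)+

lemma bracket_lift_snd:
  assumes X: "smooth_vfield \<G> X" and Y: "smooth_vfield \<G> Y"
  shows "lie_bracket (lift_snd X) (lift_snd Y) = lift_snd (lie_bracket X Y)"
proof (rule P.vfield_eqI)
  fix z f assume f: "f \<in> smooth_fun \<P>"
  show "lie_bracket (lift_snd X) (lift_snd Y) z f = lift_snd (lie_bracket X Y) z f"
    using P.vfield_smooth[OF lift_snd_smooth[OF X] f] P.vfield_smooth[OF lift_snd_smooth[OF Y] f] f
    by (simp add: lie_bracket_def lift_snd_apply)
qed (intro P.bracket_smooth G.bracket_smooth lift_snd_smooth X Y)+

text \<open>On a general function this is the symmetry of mixed partial derivatives. Testing the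
  bracket on pulled back functions avoids it: one of the two lifts annihilates such a function, and
  the other keeps it a pullback from the same factor.\<close>

lemma bracket_lift_fst_snd:
  assumes X: "smooth_vfield \<A> X" and Y: "smooth_vfield \<G> Y"
  shows "lie_bracket (lift_fst X) (lift_snd Y) = 0"
proof
  fix z
  note L = lift_fst_smooth[OF X] and R = lift_snd_smooth[OF Y]
  have L0: "lift_fst X z (\<lambda>q. 0) = 0" and R0: "lift_snd Y z (\<lambda>q. 0) = 0" for z
    using P.tangent_const[OF P.vfield_tangent[OF L]] P.tangent_const[OF P.vfield_tangent[OF R]] by auto
  have "lie_bracket (lift_fst X) (lift_snd Y) z = 0"
  proof (rule tangent_prod_eq_0I[OF P.vfield_tangent[OF P.bracket_smooth[OF L R]]])
    show "dfst (lie_bracket (lift_fst X) (lift_snd Y) z) = 0"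
    proof
      fix f show "dfst (lie_bracket (lift_fst X) (lift_snd Y) z) f = 0 f"
      proof (cases "f \<in> smooth_fun \<A>")
        case True
        then show ?thesis
          unfolding dfst_apply[OF True] lie_bracket_def lift_snd_on_fst[OF Y True] lift_fst_on_fst[OF True]
            lift_snd_on_fst[OF Y M.vfield_smooth[OF X True]] L0 by simp
      qed (simp add: differential_def)
    qed
    show "dsnd (lie_bracket (lift_fst X) (lift_snd Y) z) = 0"
    proof
      fix f show "dsnd (lie_bracket (lift_fst X) (lift_snd Y) z) f = 0 f"
      proof (cases "f \<in> smooth_fun \<G>")
        case True
        then show ?thesis
          unfolding dsnd_apply[OF True] lie_bracket_def lift_fst_on_snd[OF X True] lift_snd_on_snd[OF True]
            lift_fst_on_snd[OF X G.vfield_smooth[OF Y True]] R0 by simp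
      qed (simp add: differential_def)
    qed
  qed
  then show "lie_bracket (lift_fst X) (lift_snd Y) z = 0 z" by simp
qed

lemma lift_fst_add: "lift_fst (X + Y) = lift_fst X + lift_fst Y"
  using pair_add[of _ _ _ 0 0] by (auto simp: lift_fst_def fun_eq_iff)

lemma lift_snd_add: "lift_snd (X + Y) = lift_snd X + lift_snd Y"
  using pair_add[of _ 0 0] by (auto simp: lift_snd_def fun_eq_iff)

end

section \<open>Coefficients with respect to a smooth frame\<close>

lemma (in manifold) smooth_fun_on_det:
  fixes A :: "'k::finite \<Rightarrow> 'k \<Rightarrow> 'm \<Rightarrow> real"
  assumes "open W" "\<And>i j. A i j \<in> smooth_fun_on \<A> W"
  shows "(\<lambda>q. det (\<chi> i j. A i j q)) \<in> smooth_fun_on \<A> W"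
  unfolding det_def by (auto intro!: smooth_fun_on_sum smooth_fun_on_prod smooth_fun_on_scale assms)

text \<open>The values of the frame on smooth functions fill the whole coordinate space. Otherwise
  they lie in a hyperplane, and its normal vector is a linear relation between the frame
  vectors.\<close>

lemma (in manifold) dual_functions:
  fixes \<Lambda> :: "'k::finite \<Rightarrow> 'm vfield"
  assumes T: "\<And>j. \<Lambda> j p \<in> tangent_space \<A> p"
    and inj: "inj (\<lambda>j. \<Lambda> j p)" and indep: "independent (range (\<lambda>j. \<Lambda> j p))"
  obtains h where "\<And>i. h i \<in> smooth_fun \<A>" "\<And>i j. \<Lambda> j p (h i) = (if i = j then 1 else 0)"
proof -
  define \<Phi> where "\<Phi> f = (\<chi> j. \<Lambda> j p f)" for f
  define S where "S = \<Phi> ` smooth_fun \<A>"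
  have sub: "subspace S"
  proof (rule subspaceI)
    have "\<Phi> (\<lambda>_. 0) = 0" by (simp add: \<Phi>_def tangent_const[OF T] vec_eq_iff)
    then show "0 \<in> S" unfolding S_def using smooth_fun_const[of 0] by (metis imageI)
  next
    fix a b assume "a \<in> S" "b \<in> S"
    then obtain f g where f: "f \<in> smooth_fun \<A>" "g \<in> smooth_fun \<A>" "a = \<Phi> f" "b = \<Phi> g" by (auto simp: S_def)
    then have "a + b = \<Phi> (\<lambda>x. f x + g x)" by (simp add: \<Phi>_def tangent_add[OF T] vec_eq_iff)
    then show "a + b \<in> S" unfolding S_def using smooth_fun_add[OF f(1,2)] by blast
  next
    fix k a assume "a \<in> S"
    then obtain f where f: "f \<in> smooth_fun \<A>" "a = \<Phi> f" by (auto simp: S_def)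
    then have "k *\<^sub>R a = \<Phi> (\<lambda>x. k * f x)" by (simp add: \<Phi>_def tangent_scale[OF T] vec_eq_iff)
    then show "k *\<^sub>R a \<in> S" unfolding S_def using smooth_fun_scale[OF f(1)] by blast
  qed
  have "S = UNIV"
  proof (rule ccontr)
    assume "S \<noteq> UNIV"
    then have "dim S < DIM(real^'k)" using sub by (metis dim_eq_full less_le dim_subset_UNIV span_eq_iff)
    then obtain c where c: "c \<noteq> 0" "span S \<subseteq> {x. c \<bullet> x = 0}" using lowdim_subset_hyperplane by blast
    have 0: "(\<Sum>j\<in>UNIV. c $ j *\<^sub>R \<Lambda> j p) = 0"
    proof (rule tangent_space_eqI[OF _ subspace_0[OF subspace_tangent_space]])
      show "(\<Sum>j\<in>UNIV. c $ j *\<^sub>R \<Lambda> j p) \<in> tangent_space \<A> p"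
        by (intro subspace_sum[OF subspace_tangent_space] subspace_scale[OF subspace_tangent_space] T)
      fix f assume "f \<in> smooth_fun \<A>"
      then have "\<Phi> f \<in> span S" unfolding S_def by (intro span_base) auto
      then have "c \<bullet> \<Phi> f = 0" using c by auto
      then show "(\<Sum>j\<in>UNIV. c $ j *\<^sub>R \<Lambda> j p) f = 0 f"
        by (simp add: sum_fun_apply scaleR_fun_def inner_vec_def \<Phi>_def)
    qed
    have "(\<Sum>v\<in>range (\<lambda>j. \<Lambda> j p). c $ (inv (\<lambda>j. \<Lambda> j p) v) *\<^sub>R v) = (\<Sum>j\<in>UNIV. c $ j *\<^sub>R \<Lambda> j p)"
      by (subst sum.reindex[OF inj]) (simp add: inv_f_f[OF inj])
    then have "c $ (inv (\<lambda>j. \<Lambda> j p) (\<Lambda> j p)) = 0" for j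
      using independentD[OF indep, of "range (\<lambda>j. \<Lambda> j p)" "\<lambda>v. c $ (inv (\<lambda>j. \<Lambda> j p) v)" "\<Lambda> j p"] 0 by simp
    then have "c $ j = 0" for j unfolding inv_f_f[OF inj] .
    then show False using c(1) by (simp add: vec_eq_iff)
  qed
  then have "\<exists>f. f \<in> smooth_fun \<A> \<and> \<Phi> f = axis i 1" for i unfolding S_def by (metis UNIV_I imageE)
  then obtain h where "\<And>i. h i \<in> smooth_fun \<A>" "\<And>i. \<Phi> (h i) = axis i 1" by metis
  then show ?thesis
    by (intro that[of h]) (auto simp: \<Phi>_def axis_def vec_eq_iff)
qed

text \<open>Near a point, Cramer's rule applied to functions dual to the frame there recovers the coefficients.\<close>

lemma frame_coeff_smooth:
  fixes \<Lambda> :: "'k::finite \<Rightarrow> 'b::{t2_space,second_countable_topology} vfield"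
    and \<N> :: "('n::{t2_space,second_countable_topology}, 'e::euclidean_space) atlas"
    and \<B> :: "('b, 'f::euclidean_space) atlas"
  assumes N: "smooth_manifold \<N>" and B: "smooth_manifold \<B>"
    and \<pi>: "\<And>f. f \<in> smooth_fun \<B> \<Longrightarrow> (\<lambda>q. f (\<pi> q)) \<in> smooth_fun \<N>"
    and \<Lambda>: "\<And>j. smooth_vfield \<B> (\<Lambda> j)"
    and frame: "\<And>p. inj (\<lambda>j. \<Lambda> j p)" "\<And>p. independent (range (\<lambda>j. \<Lambda> j p))"
    and a: "\<And>f. f \<in> smooth_fun \<B> \<Longrightarrow> (\<lambda>q. \<Sum>j\<in>UNIV. a j q * \<Lambda> j (\<pi> q) f) \<in> smooth_fun \<N>"
  shows "a k \<in> smooth_fun \<N>"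
proof -
  interpret N: manifold \<N> using N by unfold_locales
  interpret B: manifold \<B> using B by unfold_locales
  show ?thesis
  proof (rule N.smooth_fun_local)
    fix q0
    obtain h where h: "\<And>i. h i \<in> smooth_fun \<B>" "\<And>i j. \<Lambda> j (\<pi> q0) (h i) = (if i = j then 1 else 0)"
      using B.dual_functions[of \<Lambda> "\<pi> q0", OF B.vfield_tangent[OF \<Lambda>] frame] by blast
    define A where "A i j q = \<Lambda> j (\<pi> q) (h i)" for i j q
    define b where "b i q = (\<Sum>j\<in>UNIV. a j q * \<Lambda> j (\<pi> q) (h i))" for i q
    define Ak where "Ak i j q = (if j = k then b i q else A i j q)" for i j q
    have A: "A i j \<in> smooth_fun \<N>" for i j unfolding A_def by (rule \<pi>[OF B.vfield_smooth[OF \<Lambda> h(1)]])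
    have b: "b i \<in> smooth_fun \<N>" for i unfolding b_def by (rule a[OF h(1)])
    have Ak: "Ak i j \<in> smooth_fun \<N>" for i j using A b by (cases "j = k") (auto simp: Ak_def[abs_def])
    define D where "D q = det (\<chi> i j. A i j q)" for q
    define W where "W = D -` (- {0})"
    have D: "D \<in> smooth_fun \<N>" unfolding D_def
      using N.smooth_fun_on_det[OF open_UNIV, of A] A by (simp add: smooth_fun_on_UNIV)
    have W: "open W" unfolding W_def
      using continuous_on_open_vimage[of UNIV D] N.smooth_fun_continuous[OF D] by auto
    \<comment> \<open>By duality the coefficient matrix is the identity at \<open>q0\<close>, so its
      determinant stays nonzero on a neighbourhood.\<close>
    have "(\<chi> i j. A i j q0) = mat 1" by (simp add: A_def h(2) mat_def vec_eq_iff)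
    then have q0: "q0 \<in> W" by (simp add: W_def D_def)
    have sm: "(\<lambda>q. det (\<chi> i j. Ak i j q) * inverse (D q)) \<in> smooth_fun_on \<N> W"
      by (intro N.smooth_fun_on_mult N.smooth_fun_on_inverse N.smooth_fun_on_det W N.smooth_fun_on_smooth Ak D)
         (simp add: W_def)
    have eq: "det (\<chi> i j. Ak i j q) * inverse (D q) = a k q" if "q \<in> W" for q
    proof -
      have "(\<chi> i j. A i j q) *v (\<chi> j. a j q) = (\<chi> i. b i q)"
        by (simp add: matrix_vector_mult_def A_def b_def mult.commute)
      then have "(\<chi> j. a j q) = (\<chi> k. det (\<chi> i j. if j = k then (\<chi> i. b i q) $ i else (\<chi> i j. A i j q) $ i $ j) / det (\<chi> i j. A i j q))"
        using that cramer[of "\<chi> i j. A i j q"] by (simp add: W_def D_def)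
      then have "a k q = det (\<chi> i j. if j = k then b i q else A i j q) / D q"
        by (simp add: vec_eq_iff D_def cong: if_cong)
      then show ?thesis by (simp add: Ak_def divide_inverse)
    qed
    have "a k \<in> smooth_fun_on \<N> W" by (rule N.smooth_fun_on_cong[OF W eq sm])
    then show "\<exists>W'. open W' \<and> q0 \<in> W' \<and> a k \<in> smooth_fun_on \<N> W'" using W q0 by blast
  qed
qed

section \<open>The Nijenhuis tensor\<close>

inductive vfield_module ::
  "('m::topological_space, 'e::euclidean_space) atlas \<Rightarrow> 'm vfield set \<Rightarrow> 'm vfield \<Rightarrow> bool"
  for \<A> S where
  zero: "vfield_module \<A> S 0"
| base: "X \<in> S \<Longrightarrow> vfield_module \<A> S X"
| add: "vfield_module \<A> S X \<Longrightarrow> vfield_module \<A> S Y \<Longrightarrow> vfield_module \<A> S (X + Y)"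
| scale: "vfield_module \<A> S X \<Longrightarrow> a \<in> smooth_fun \<A> \<Longrightarrow> vfield_module \<A> S (\<lambda>p. a p *\<^sub>R X p)"

text \<open>Generation up to a function factor that may depend on the point. A function-linear
  statement about \<open>X\<close> at \<open>p\<close> still follows from the family, by dividing by
  \<open>a p\<close>.\<close>

definition generates :: "('m::topological_space, 'e::euclidean_space) atlas \<Rightarrow> 'm vfield set \<Rightarrow> bool" where
  "generates \<A> S \<longleftrightarrow> (\<forall>X\<in>S. smooth_vfield \<A> X) \<and>
     (\<forall>X p. smooth_vfield \<A> X \<longrightarrow>
       (\<exists>a\<in>smooth_fun \<A>. a p \<noteq> 0 \<and> vfield_module \<A> S (\<lambda>q. a q *\<^sub>R X q)))"

lemma vfield_module_sum:
  "(\<And>i. i \<in> I \<Longrightarrow> vfield_module \<A> S (X i)) \<Longrightarrow> vfield_module \<A> S (\<Sum>i\<in>I. X i)"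
  by (induction I rule: infinite_finite_induct) (auto intro: vfield_module.zero vfield_module.add)

context manifold
begin

lemma vfield_module_smooth:
  assumes "\<And>X. X \<in> S \<Longrightarrow> smooth_vfield \<A> X" "vfield_module \<A> S X"
  shows "smooth_vfield \<A> X"
  using assms(2) by (rule vfield_module.induct) (rule vfield_zero vfield_add vfield_scale assms(1); assumption)+

text \<open>Makes smoothness of a pointwise linear tensor checkable on a generating family:
  pointwise linearity carries it to the module, and division by \<open>a\<close> near a point
  carries it to any field.\<close>

lemma smooth_tensor11_generators:
  assumes gen: "generates \<A> S" and S: "\<And>X. X \<in> S \<Longrightarrow> smooth_vfield \<A> (J \<cdot> X)"
    and J: "\<And>p u. u \<in> tangent_space \<A> p \<Longrightarrow> J p u \<in> tangent_space \<A> p"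
      "\<And>p u v. u \<in> tangent_space \<A> p \<Longrightarrow> v \<in> tangent_space \<A> p \<Longrightarrow> J p (u + v) = J p u + J p v"
      "\<And>p c u. u \<in> tangent_space \<A> p \<Longrightarrow> J p (c *\<^sub>R u) = c *\<^sub>R J p u"
  shows "smooth_tensor11 \<A> J"
proof -
  have sm: "\<And>X. X \<in> S \<Longrightarrow> smooth_vfield \<A> X" using gen by (auto simp: generates_def)
  have module: "smooth_vfield \<A> (J \<cdot> X)" if "vfield_module \<A> S X" for X
    using that
  proof (induction rule: vfield_module.induct)
    case zero
    have "J p 0 = 0" for p using J(3)[OF subspace_0[OF subspace_tangent_space], of p 0] by simp
    then have "J \<cdot> (0 :: 'm vfield) = 0" by (auto simp: apply_tensor_def fun_eq_iff)
    with vfield_zero have "smooth_vfield \<A> (J \<cdot> (0 :: 'm vfield))" by metis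
    then show ?case by (rule back_subst[of "smooth_vfield \<A>"]) (rule refl)
  next
    case (base X) then show ?case by (rule S)
  next
    case (add X Y)
    have "J \<cdot> (X + Y) = (J \<cdot> X) + (J \<cdot> Y)"
      using vfield_module_smooth[OF sm add.hyps(1)] vfield_module_smooth[OF sm add.hyps(2)] by (auto simp: apply_tensor_def fun_eq_iff J(2) vfield_tangent)
    with vfield_add[OF add.IH] have "smooth_vfield \<A> (J \<cdot> (X + Y))" by metis
    then show ?case by (rule back_subst[of "smooth_vfield \<A>"]) (rule refl)
  next
    case (scale X a)
    have "J \<cdot> (\<lambda>p. a p *\<^sub>R X p) = (\<lambda>p. a p *\<^sub>R (J \<cdot> X) p)"
      using vfield_module_smooth[OF sm scale.hyps(1)] by (auto simp: apply_tensor_def fun_eq_iff J(3) vfield_tangent)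
    then show ?case using vfield_scale scale by simp
  qed
  have "smooth_vfield \<A> (\<lambda>p. J p (X p))" if X: "smooth_vfield \<A> X" for X
    unfolding smooth_vfield_def
  proof (intro conjI allI ballI)
    show "J p (X p) \<in> tangent_space \<A> p" for p by (intro J vfield_tangent X)
    fix f assume f: "f \<in> smooth_fun \<A>"
    show "(\<lambda>p. J p (X p) f) \<in> smooth_fun \<A>"
    proof (rule smooth_fun_local)
      fix p
      obtain a where a: "a \<in> smooth_fun \<A>" "a p \<noteq> 0" "vfield_module \<A> S (\<lambda>q. a q *\<^sub>R X q)"
        using gen X unfolding generates_def by blast
      define W where "W = a -` (- {0})"
      have W: "open W" "p \<in> W"
        using a(2) continuous_on_open_vimage[of UNIV a] smooth_fun_continuous[OF a(1)] by (auto simp: W_def)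
      have "(\<lambda>q. inverse (a q) * (J \<cdot> (\<lambda>q. a q *\<^sub>R X q)) q f) \<in> smooth_fun_on \<A> W"
        by (intro smooth_fun_on_mult smooth_fun_on_inverse W smooth_fun_on_smooth a vfield_smooth[OF module[OF a(3)] f])
           (simp add: W_def)
      then have "(\<lambda>p. J p (X p) f) \<in> smooth_fun_on \<A> W"
        by (rule smooth_fun_on_cong[OF W(1), rotated])
           (simp add: apply_tensor_def J(3) vfield_tangent[OF X] W_def, simp add: scaleR_fun_def)
      then show "\<exists>W. open W \<and> p \<in> W \<and> (\<lambda>p. J p (X p) f) \<in> smooth_fun_on \<A> W" using W by blast
    qed
  qed
  then show ?thesis unfolding smooth_tensor11_def using J by auto
qed

end

section \<open>Function-bilinearity of the Nijenhuis tensor\<close>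

locale tensor_field = manifold \<A>
  for \<A> :: "('m::{t2_space,second_countable_topology}, 'e::euclidean_space) atlas" +
  fixes J :: "'m tensor11"
  assumes tensor: "smooth_tensor11 \<A> J"
begin

lemma tensor_tangent: "u \<in> tangent_space \<A> p \<Longrightarrow> J p u \<in> tangent_space \<A> p"
  and tensor_add: "u \<in> tangent_space \<A> p \<Longrightarrow> v \<in> tangent_space \<A> p \<Longrightarrow> J p (u + v) = J p u + J p v"
  and tensor_scale: "u \<in> tangent_space \<A> p \<Longrightarrow> J p (c *\<^sub>R u) = c *\<^sub>R J p u"
  and tensor_smooth: "smooth_vfield \<A> X \<Longrightarrow> smooth_vfield \<A> (J \<cdot> X)"
  using tensor by (auto simp: smooth_tensor11_def apply_tensor_def)

lemma tensor_0: "J p 0 = 0"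
  using tensor_scale[OF subspace_0[OF subspace_tangent_space], of p 0] by simp

lemma tensor_uminus: "u \<in> tangent_space \<A> p \<Longrightarrow> J p (- u) = - J p u"
  using tensor_scale[of u p "- 1"] by simp

lemma tensor_diff:
  "u \<in> tangent_space \<A> p \<Longrightarrow> v \<in> tangent_space \<A> p \<Longrightarrow> J p (u - v) = J p u - J p v"
  using tensor_add[of u p "- v"] tensor_uminus[of v p] subspace_neg[OF subspace_tangent_space, of v \<A> p] by simp

lemma apply_add: "smooth_vfield \<A> X \<Longrightarrow> smooth_vfield \<A> Y \<Longrightarrow> J \<cdot> (X + Y) = (J \<cdot> X) + (J \<cdot> Y)"
  and apply_diff: "smooth_vfield \<A> X \<Longrightarrow> smooth_vfield \<A> Y \<Longrightarrow> J \<cdot> (X - Y) = (J \<cdot> X) - (J \<cdot> Y)"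
  and apply_uminus: "smooth_vfield \<A> X \<Longrightarrow> J \<cdot> (- X) = - (J \<cdot> X)"
  and apply_scale: "smooth_vfield \<A> X \<Longrightarrow> J \<cdot> (\<lambda>p. a p *\<^sub>R X p) = (\<lambda>p. a p *\<^sub>R (J \<cdot> X) p)"
  by (auto simp: apply_tensor_def fun_eq_iff vfield_tangent tensor_add tensor_diff tensor_uminus tensor_scale)

lemma apply_0: "J \<cdot> (0 :: 'm vfield) = 0"
  by (auto simp: apply_tensor_def fun_eq_iff tensor_0)

lemma nijenhuis_smooth:
  "smooth_vfield \<A> X \<Longrightarrow> smooth_vfield \<A> Y \<Longrightarrow> smooth_vfield \<A> (nijenhuis J X Y)"
  unfolding nijenhuis_def by (intro vfield_diff vfield_add tensor_smooth bracket_smooth)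

lemma nijenhuis_skew:
  assumes "smooth_vfield \<A> X" "smooth_vfield \<A> Y"
  shows "nijenhuis J Y X = - nijenhuis J X Y"
  unfolding nijenhuis_def bracket_skew[of Y] bracket_skew[of "J \<cdot> Y"]
  using assms by (simp add: apply_uminus bracket_smooth tensor_smooth)

lemma nijenhuis_add_left:
  assumes "smooth_vfield \<A> X" "smooth_vfield \<A> X'" "smooth_vfield \<A> Y"
  shows "nijenhuis J (X + X') Y = nijenhuis J X Y + nijenhuis J X' Y"
  unfolding nijenhuis_def
  using assms by (simp add: apply_add bracket_add_left bracket_smooth tensor_smooth)

text \<open>The derivatives of \<open>a\<close> cancel in pairs: those along \<open>Y\<close>
  between the first and third term of the Nijenhuis tensor, those along \<open>J \<cdot> Y\<close>
  between the second and fourth.\<close>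

lemma nijenhuis_scale_left:
  assumes X: "smooth_vfield \<A> X" and Y: "smooth_vfield \<A> Y" and a: "a \<in> smooth_fun \<A>"
  shows "nijenhuis J (\<lambda>p. a p *\<^sub>R X p) Y = (\<lambda>p. a p *\<^sub>R nijenhuis J X Y p)"
proof -
  note s = X Y a tensor_smooth[OF X] tensor_smooth[OF Y] vfield_smooth[OF Y a] vfield_smooth[OF tensor_smooth[OF Y] a]
  show ?thesis unfolding nijenhuis_def
    by (simp add: s apply_scale bracket_scale_left apply_diff vfield_scale bracket_smooth tensor_smooth)
       (simp add: fun_eq_iff scaleR_fun_def algebra_simps)
qed

lemma nijenhuis_0_left: "smooth_vfield \<A> Y \<Longrightarrow> nijenhuis J 0 Y = 0"
  using nijenhuis_add_left[OF vfield_zero vfield_zero, of Y] by simp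

text \<open>The fields annihilated in the first slot form a function module, which therefore
  contains a multiple of \<open>X\<close> that is nontrivial at \<open>p\<close>.\<close>

lemma nijenhuis_vanish_left:
  assumes gen: "generates \<A> S" and Y: "smooth_vfield \<A> Y" and X: "smooth_vfield \<A> X"
    and S: "\<And>Z. Z \<in> S \<Longrightarrow> nijenhuis J Z Y = 0"
  shows "nijenhuis J X Y = 0"
proof
  fix p
  have sm: "\<And>X. X \<in> S \<Longrightarrow> smooth_vfield \<A> X" using gen by (auto simp: generates_def)
  obtain a where a: "a \<in> smooth_fun \<A>" "a p \<noteq> 0" "vfield_module \<A> S (\<lambda>q. a q *\<^sub>R X q)"
    using gen X unfolding generates_def by blast
  have "nijenhuis J Z Y = 0" if "vfield_module \<A> S Z" for Z
    using that
  proof (rule vfield_module.induct)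
    fix X X' assume *: "vfield_module \<A> S X" "nijenhuis J X Y = 0" "vfield_module \<A> S X'" "nijenhuis J X' Y = 0"
    then show "nijenhuis J (X + X') Y = 0"
      using nijenhuis_add_left[OF vfield_module_smooth[OF sm *(1)] vfield_module_smooth[OF sm *(3)] Y] by simp
  next
    fix X a assume *: "vfield_module \<A> S X" "nijenhuis J X Y = 0" "a \<in> smooth_fun \<A>"
    then show "nijenhuis J (\<lambda>p. a p *\<^sub>R X p) Y = 0"
      using nijenhuis_scale_left[OF vfield_module_smooth[OF sm *(1)] Y *(3)] by (simp add: fun_eq_iff scaleR_fun_def)
  next
    show "nijenhuis J 0 Y = 0" by (rule nijenhuis_0_left[OF Y])
  qed (rule S)
  from this[OF a(3)] have "a p *\<^sub>R nijenhuis J X Y p = 0"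
    using nijenhuis_scale_left[OF X Y a(1)] by (simp add: fun_eq_iff)
  then show "nijenhuis J X Y p = 0 p" using a(2) by (simp add: fun_eq_iff scaleR_fun_def)
qed

lemma nijenhuis_vanish:
  assumes gen: "generates \<A> S" and "smooth_vfield \<A> X" "smooth_vfield \<A> Y"
    and S: "\<And>Z Z'. Z \<in> S \<Longrightarrow> Z' \<in> S \<Longrightarrow> nijenhuis J Z Z' = 0"
  shows "nijenhuis J X Y = 0"
proof (rule nijenhuis_vanish_left[OF gen assms(3,2)])
  fix Z assume Z: "Z \<in> S"
  then have sZ: "smooth_vfield \<A> Z" using gen by (auto simp: generates_def)
  have "nijenhuis J Y Z = 0"
    by (rule nijenhuis_vanish_left[OF gen sZ assms(3)]) (rule S[OF _ Z])
  then show "nijenhuis J Z Y = 0" using nijenhuis_skew[OF sZ assms(3)] by simp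
qed

text \<open>Inserting J^2 = -1 permutes the four terms up to sign and a factor J. Consequently the
  fields annihilated in the first slot are closed under \<open>J\<close>.\<close>

lemma nijenhuis_apply_left:
  assumes J2: "\<And>X. smooth_vfield \<A> X \<Longrightarrow> J \<cdot> J \<cdot> X = - X"
    and X: "smooth_vfield \<A> X" and Y: "smooth_vfield \<A> Y"
  shows "nijenhuis J (J \<cdot> X) Y = - (J \<cdot> nijenhuis J X Y)"
proof -
  have neg: "lie_bracket (- X) Z = - lie_bracket X Z" if "smooth_vfield \<A> Z" for Z
  proof -
    have "lie_bracket (- X + X) Z = lie_bracket (- X) Z + lie_bracket X Z"
      by (rule bracket_add_left[OF vfield_uminus[OF X] X that])
    moreover have "lie_bracket (0 + 0) Z = lie_bracket 0 Z + lie_bracket 0 Z"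
      by (rule bracket_add_left[OF vfield_zero vfield_zero that])
    ultimately show ?thesis unfolding eq_neg_iff_add_eq_0 by (metis add.left_neutral add_cancel_right_left left_minus)
  qed
  note s = X Y tensor_smooth bracket_smooth vfield_add vfield_diff
  show ?thesis unfolding nijenhuis_def
    by (simp add: s J2 neg apply_diff apply_add apply_uminus)
qed

end

text \<open>The projections send \<open>X q\<close> to tangent vectors of the factors, where
  \<open>local_frame\<close> applies. Clearing both cut-off functions takes the product of their
  cubes, so each coefficient also carries the cube belonging to the other factor.\<close>

lemma (in two_manifolds) lifts_generate:
  "generates \<P> (lift_fst ` {X. smooth_vfield \<A> X} \<union> lift_snd ` {Y. smooth_vfield \<G> Y})"
  (is "generates _ ?S")
  unfolding generates_def
proof (intro conjI allI impI ballI)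
  fix X assume "X \<in> ?S" then show "smooth_vfield \<P> X" using lift_fst_smooth lift_snd_smooth by auto
next
  fix X z assume X: "smooth_vfield \<P> X"
  obtain U x V y where c: "(U, x) \<in> \<A>" "(V, y) \<in> \<G>" and z: "fst z \<in> U" "snd z \<in> V"
    using prod_chart_at .
  obtain \<beta> K where \<beta>: "\<beta> \<in> smooth_fun \<A>" "\<beta> (fst z) = 1" "closed K" "K \<subseteq> U" "\<And>q. q \<notin> K \<Longrightarrow> \<beta> q = 0"
    using M.bump_exists[OF M.chart_props(1)[OF c(1)] z(1)] by blast
  obtain \<delta> L where \<delta>: "\<delta> \<in> smooth_fun \<G>" "\<delta> (snd z) = 1" "closed L" "L \<subseteq> V" "\<And>q. q \<notin> L \<Longrightarrow> \<delta> q = 0"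
    using G.bump_exists[OF G.chart_props(1)[OF c(2)] z(2)] by blast
  define w1 where "w1 b r = \<beta> r * (x r \<bullet> b)" for b r
  define w2 where "w2 b r = \<delta> r * (y r \<bullet> b)" for b r
  have w1: "w1 b \<in> smooth_fun \<A>" for b
    unfolding w1_def by (rule M.bump_mult[OF \<beta>(1,3,4) M.chart_props(1)[OF c(1)] \<beta>(5) M.coordinate_smooth[OF c(1)]])
  have w2: "w2 b \<in> smooth_fun \<G>" for b
    unfolding w2_def by (rule G.bump_mult[OF \<delta>(1,3,4) G.chart_props(1)[OF c(2)] \<delta>(5) G.coordinate_smooth[OF c(2)]])
  let ?E = "coord_field \<A> U x \<beta>" and ?E' = "coord_field \<G> V y \<delta>"
  have E: "smooth_vfield \<A> (?E b)" for b by (rule M.coord_field_smooth[OF c(1) \<beta>(1,3,4,5)])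
  have E': "smooth_vfield \<G> (?E' b)" for b by (rule G.coord_field_smooth[OF c(2) \<delta>(1,3,4,5)])
  define a where "a q = (\<beta> (fst q))^3 * (\<delta> (snd q))^3" for q
  define A where "A b q = (\<delta> (snd q))^3 * (\<beta> (fst q) * X q (\<lambda>r. w1 b (fst r)) - w1 b (fst q) * X q (\<lambda>r. \<beta> (fst r)))" for b q
  define B where "B b q = (\<beta> (fst q))^3 * (\<delta> (snd q) * X q (\<lambda>r. w2 b (snd r)) - w2 b (snd q) * X q (\<lambda>r. \<delta> (snd r)))" for b q
  have a: "a \<in> smooth_fun \<P>" and A: "A b \<in> smooth_fun \<P>" and B: "B b' \<in> smooth_fun \<P>" for b b'
    unfolding a_def[abs_def] A_def[abs_def] B_def[abs_def] power3_eq_cube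
    by (intro P.smooth_fun_mult P.smooth_fun_diff P.vfield_smooth[OF X] smooth_fun_fst[OF \<beta>(1)]
        smooth_fun_snd[OF \<delta>(1)] smooth_fun_fst[OF w1] smooth_fun_snd[OF w2])+
  have "(\<lambda>q. a q *\<^sub>R X q) =
      (\<Sum>b\<in>Basis. (\<lambda>q. A b q *\<^sub>R lift_fst (?E b) q)) + (\<Sum>b\<in>Basis. (\<lambda>q. B b q *\<^sub>R lift_snd (?E' b) q))"
    (is "_ = ?R")
  proof
    fix q
    note Xq = P.vfield_tangent[OF X, of q]
    have R: "?R q = (\<Sum>b\<in>Basis. A b q *\<^sub>R lift_fst (?E b) q) + (\<Sum>b\<in>Basis. B b q *\<^sub>R lift_snd (?E' b) q)"
      by (simp add: sum_fun_apply)
    have dz: "dfst 0 = 0" "dsnd 0 = 0" by (auto simp: differential_def fun_eq_iff)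
    have dsum: "dfst (\<Sum>b\<in>I. u b) = (\<Sum>b\<in>I. dfst (u b))" "dsnd (\<Sum>b\<in>I. u b) = (\<Sum>b\<in>I. dsnd (u b))" for u and I :: "'z set"
      by (induction I rule: infinite_finite_induct) (auto simp: dz dfst_add dsnd_add)
    have 1: "(\<beta> (fst q))^3 *\<^sub>R dfst (X q) = (\<Sum>b\<in>Basis. (\<beta> (fst q) * dfst (X q) (w1 b) - w1 b (fst q) * dfst (X q) \<beta>) *\<^sub>R ?E b (fst q))"
      unfolding w1_def by (rule M.local_frame[OF c(1) \<beta>(1,3,4,5) dfst_tangent[OF Xq]])
    have 2: "(\<delta> (snd q))^3 *\<^sub>R dsnd (X q) = (\<Sum>b\<in>Basis. (\<delta> (snd q) * dsnd (X q) (w2 b) - w2 b (snd q) * dsnd (X q) \<delta>) *\<^sub>R ?E' b (snd q))"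
      unfolding w2_def by (rule G.local_frame[OF c(2) \<delta>(1,3,4,5) dsnd_tangent[OF Xq]])
    have "a q *\<^sub>R X q = ?R q"
    proof (rule tangent_prod_eqI)
      show "a q *\<^sub>R X q \<in> tangent_space \<P> q" by (intro subspace_scale[OF subspace_tangent_space] Xq)
      show "?R q \<in> tangent_space \<P> q"
        unfolding R by (intro subspace_add subspace_sum subspace_scale subspace_tangent_space
            P.vfield_tangent lift_fst_smooth lift_snd_smooth E E')
      have "dfst (a q *\<^sub>R X q) = (\<delta> (snd q))^3 *\<^sub>R ((\<beta> (fst q))^3 *\<^sub>R dfst (X q))"
        by (simp add: dfst_scale a_def mult.commute)
      then show "dfst (a q *\<^sub>R X q) = dfst (?R q)"
        unfolding R 1 by (simp add: dfst_add dsum dfst_scale dfst_lift_fst[OF E] dfst_lift_snd[OF E'] A_def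
            dfst_apply w1 \<beta>(1) scaleR_sum_right)
      have "dsnd (a q *\<^sub>R X q) = (\<beta> (fst q))^3 *\<^sub>R ((\<delta> (snd q))^3 *\<^sub>R dsnd (X q))"
        by (simp add: dsnd_scale a_def)
      then show "dsnd (a q *\<^sub>R X q) = dsnd (?R q)"
        unfolding R 2 by (simp add: dsnd_add dsum dsnd_scale dsnd_lift_fst[OF E] dsnd_lift_snd[OF E'] B_def
            dsnd_apply w2 \<delta>(1) scaleR_sum_right)
    qed
    then show "a q *\<^sub>R X q = ?R q" .
  qed
  moreover have "vfield_module \<P> ?S ?R"
    by (intro vfield_module.add vfield_module_sum vfield_module.scale A B vfield_module.base) (use E E' in auto)
  ultimately show "\<exists>a\<in>smooth_fun \<P>. a z \<noteq> 0 \<and> vfield_module \<P> ?S (\<lambda>q. a q *\<^sub>R X q)"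
    using a \<beta>(2) \<delta>(2) by (intro bexI[of _ a]) (auto simp: a_def)
qed

section \<open>Products of almost contact manifolds\<close>

text \<open>An almost contact structure with characteristic field \<open>Z\<close>. Since a one-form
  is just a pointwise functional here, its smoothness is expressed through its values on smooth
  fields.\<close>

locale almost_contact = tensor_field \<A> F
  for \<A> :: "('m::{t2_space,second_countable_topology}, 'e::euclidean_space) atlas" and F :: "'m tensor11" +
  fixes \<eta> :: "'m form1" and Z :: "'m vfield"
  assumes Z_smooth: "smooth_vfield \<A> Z"
    and form_add: "u \<in> tangent_space \<A> p \<Longrightarrow> v \<in> tangent_space \<A> p \<Longrightarrow> \<eta> p (u + v) = \<eta> p u + \<eta> p v"
    and form_scale: "u \<in> tangent_space \<A> p \<Longrightarrow> \<eta> p (c *\<^sub>R u) = c * \<eta> p u"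
    and form_smooth: "smooth_vfield \<A> X \<Longrightarrow> (\<lambda>p. \<eta> p (X p)) \<in> smooth_fun \<A>"
    and tensor_square: "u \<in> tangent_space \<A> p \<Longrightarrow> F p (F p u) = - u + \<eta> p u *\<^sub>R Z p"
    and form_tensor: "u \<in> tangent_space \<A> p \<Longrightarrow> \<eta> p (F p u) = 0"
    and tensor_Z: "F p (Z p) = 0"
    and form_Z: "\<eta> p (Z p) = 1"
begin

lemma form_0: "\<eta> p 0 = 0"
  using form_scale[OF subspace_0[OF subspace_tangent_space], of p 0] by simp

lemma form_uminus: "u \<in> tangent_space \<A> p \<Longrightarrow> \<eta> p (- u) = - \<eta> p u"
  using form_scale[of u p "- 1"] by simp

lemma form_diff:
  "u \<in> tangent_space \<A> p \<Longrightarrow> v \<in> tangent_space \<A> p \<Longrightarrow> \<eta> p (u - v) = \<eta> p u - \<eta> p v"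
  using form_add[of u p "- v"] form_uminus[of v p] subspace_neg[OF subspace_tangent_space, of v \<A> p] by simp

lemma Z_tangent: "Z p \<in> tangent_space \<A> p"
  by (rule vfield_tangent[OF Z_smooth])

lemma Z_nonzero: "Z p \<noteq> 0"
  using form_Z[of p] form_0[of p] by auto

text \<open>The tensor N^(1) of almost contact geometry, whose vanishing is normality in the sense
  of Sasaki and Hatakeyama. The customary factor 2 is absent because \<open>ext_deriv\<close>
  carries no factor 1/2.\<close>

definition normality :: "'m vfield \<Rightarrow> 'm vfield \<Rightarrow> 'm vfield" where
  "normality X Y = nijenhuis F X Y + (\<lambda>p. ext_deriv \<eta> X Y p *\<^sub>R Z p)"

text \<open>The tensor N^(2) of almost contact geometry: the Lie derivative of \<eta> along FX
  evaluated on Y, minus the one along FY evaluated on X.\<close>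

definition normality_form :: "'m vfield \<Rightarrow> 'm vfield \<Rightarrow> 'm \<Rightarrow> real" where
  "normality_form X Y p = (F \<cdot> X) p (\<lambda>q. \<eta> q (Y q)) - (F \<cdot> Y) p (\<lambda>q. \<eta> q (X q))
     - \<eta> p (lie_bracket (F \<cdot> X) Y p) - \<eta> p (lie_bracket X (F \<cdot> Y) p)"

lemma normality_smooth:
  assumes X: "smooth_vfield \<A> X" and Y: "smooth_vfield \<A> Y"
  shows "smooth_vfield \<A> (normality X Y)"
  unfolding normality_def ext_deriv_def
  by (intro vfield_add nijenhuis_smooth vfield_scale smooth_fun_diff Z_smooth
      vfield_smooth[OF X] vfield_smooth[OF Y] form_smooth bracket_smooth X Y)

text \<open>The term \<open>\<eta> p (lie_bracket X Y p)\<close> of the exterior derivative cancels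
  against the one that \<open>tensor_square\<close> produces.\<close>

lemma normality_eq:
  assumes X: "smooth_vfield \<A> X" and Y: "smooth_vfield \<A> Y"
  shows "normality X Y p = - lie_bracket X Y p + lie_bracket (F \<cdot> X) (F \<cdot> Y) p
     - F p (lie_bracket (F \<cdot> X) Y p) - F p (lie_bracket X (F \<cdot> Y) p)
     + (X p (\<lambda>q. \<eta> q (Y q)) - Y p (\<lambda>q. \<eta> q (X q))) *\<^sub>R Z p"
  using tensor_square[OF vfield_tangent[OF bracket_smooth[OF X Y]], of p]
  by (simp add: normality_def nijenhuis_def apply_tensor_def ext_deriv_def algebra_simps)

lemma normality_form_skew:
  assumes X: "smooth_vfield \<A> X" and Y: "smooth_vfield \<A> Y"
  shows "normality_form Y X p = - normality_form X Y p"
  unfolding normality_form_def bracket_skew[of "F \<cdot> Y"] bracket_skew[of Y]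
  using form_uminus[OF vfield_tangent[OF bracket_smooth[OF tensor_smooth[OF X] Y]], of p]
    form_uminus[OF vfield_tangent[OF bracket_smooth[OF X tensor_smooth[OF Y]]], of p]
  by simp

end

section \<open>The almost complex structure on a product of almost contact manifolds\<close>

locale contact_product = M: almost_contact \<A> F \<eta> Z + G: almost_contact \<G> \<psi> \<theta> W
  for \<A> :: "('m::{t2_space,second_countable_topology}, 'e::euclidean_space) atlas" and F \<eta> Z
    and \<G> :: "('g::{t2_space,second_countable_topology}, 'f::euclidean_space) atlas" and \<psi> \<theta> W
begin

sublocale two_manifolds \<A> \<G> by unfold_locales

text \<open>Morimoto's construction: the two tensors act on the kernels of the forms, and the
  remaining plane is turned by Z to W and W to -Z.\<close>

definition prodJ :: "('m \<times> 'g) tensor11" where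
  "prodJ z u = pair z (F (fst z) (dfst u) - \<theta> (snd z) (dsnd u) *\<^sub>R Z (fst z))
     (\<psi> (snd z) (dsnd u) + \<eta> (fst z) (dfst u) *\<^sub>R W (snd z))"

lemma prodJ_parts:
  assumes u: "u \<in> tangent_space \<P> z"
  shows "F (fst z) (dfst u) - \<theta> (snd z) (dsnd u) *\<^sub>R Z (fst z) \<in> tangent_space \<A> (fst z)"
    "\<psi> (snd z) (dsnd u) + \<eta> (fst z) (dfst u) *\<^sub>R W (snd z) \<in> tangent_space \<G> (snd z)"
  by (intro subspace_diff subspace_add subspace_scale subspace_tangent_space M.tensor_tangent G.tensor_tangent
      dfst_tangent[OF u] dsnd_tangent[OF u] M.Z_tangent G.Z_tangent)+

lemma prodJ_tangent: "u \<in> tangent_space \<P> z \<Longrightarrow> prodJ z u \<in> tangent_space \<P> z"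
  unfolding prodJ_def by (intro pair_tangent prodJ_parts)

lemma dfst_prodJ: "u \<in> tangent_space \<P> z \<Longrightarrow>
    dfst (prodJ z u) = F (fst z) (dfst u) - \<theta> (snd z) (dsnd u) *\<^sub>R Z (fst z)"
  and dsnd_prodJ: "u \<in> tangent_space \<P> z \<Longrightarrow>
    dsnd (prodJ z u) = \<psi> (snd z) (dsnd u) + \<eta> (fst z) (dfst u) *\<^sub>R W (snd z)"
  unfolding prodJ_def by (simp_all add: dfst_pair dsnd_pair prodJ_parts)

lemma prodJ_add:
  assumes "u \<in> tangent_space \<P> z" "v \<in> tangent_space \<P> z"
  shows "prodJ z (u + v) = prodJ z u + prodJ z v"
  unfolding prodJ_def pair_add[symmetric]
  using assms[THEN dfst_tangent] assms[THEN dsnd_tangent]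
  by (simp add: dfst_add dsnd_add M.tensor_add G.tensor_add M.form_add G.form_add algebra_simps)

lemma prodJ_scale:
  assumes "u \<in> tangent_space \<P> z" shows "prodJ z (c *\<^sub>R u) = c *\<^sub>R prodJ z u"
  unfolding prodJ_def pair_scale[symmetric]
  using assms[THEN dfst_tangent] assms[THEN dsnd_tangent]
  by (simp add: dfst_scale dsnd_scale M.tensor_scale G.tensor_scale M.form_scale G.form_scale algebra_simps)

text \<open>The multiples of Z and W left over from the squares of the two tensors cancel against
  the turn in the plane of Z and W.\<close>

lemma prodJ_square:
  assumes u: "u \<in> tangent_space \<P> z" shows "prodJ z (prodJ z u) = - u"
proof (rule tangent_prod_eqI[OF prodJ_tangent[OF prodJ_tangent[OF u]] subspace_neg[OF subspace_tangent_space u]])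
  note t = dfst_tangent[OF u] dsnd_tangent[OF u]
  have neg: "dfst (- u) = - dfst u" "dsnd (- u) = - dsnd u"
    using dfst_scale[of "- 1" u] dsnd_scale[of "- 1" u] by simp_all
  note s = M.tensor_tangent[OF t(1)] G.tensor_tangent[OF t(2)]
    subspace_scale[OF subspace_tangent_space M.Z_tangent] subspace_scale[OF subspace_tangent_space G.Z_tangent]
  show "dfst (prodJ z (prodJ z u)) = dfst (- u)"
    by (simp add: dfst_prodJ dsnd_prodJ prodJ_tangent u neg M.tensor_diff s M.tensor_square t M.tensor_scale M.Z_tangent
        M.tensor_Z G.form_add G.form_tensor G.form_scale G.Z_tangent G.form_Z)
  show "dsnd (prodJ z (prodJ z u)) = dsnd (- u)"
    by (simp add: dfst_prodJ dsnd_prodJ prodJ_tangent u neg G.tensor_add s G.tensor_square t G.tensor_scale G.Z_tangent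
        G.tensor_Z M.form_diff M.form_tensor M.form_scale M.Z_tangent M.form_Z)
qed

lemma prodJ_lift_fst:
  assumes X: "smooth_vfield \<A> X"
  shows "prodJ \<cdot> lift_fst X = lift_fst (F \<cdot> X) + (\<lambda>z. \<eta> (fst z) (X (fst z)) *\<^sub>R lift_snd W z)"
proof
  fix z
  have "(prodJ \<cdot> lift_fst X) z = pair z (F (fst z) (X (fst z)) + 0) (0 + \<eta> (fst z) (X (fst z)) *\<^sub>R W (snd z))"
    by (simp add: apply_tensor_def prodJ_def dfst_lift_fst[OF X] dsnd_lift_fst[OF X] G.form_0 G.tensor_0)
  also have "\<dots> = (lift_fst (F \<cdot> X) + (\<lambda>z. \<eta> (fst z) (X (fst z)) *\<^sub>R lift_snd W z)) z"
    unfolding pair_add using pair_scale[of z _ 0] by (simp add: lift_fst_def lift_snd_def apply_tensor_def)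
  finally show "(prodJ \<cdot> lift_fst X) z = \<dots>" .
qed

lemma prodJ_lift_snd:
  assumes Y: "smooth_vfield \<G> Y"
  shows "prodJ \<cdot> lift_snd Y = lift_snd (\<psi> \<cdot> Y) + (\<lambda>z. - \<theta> (snd z) (Y (snd z)) *\<^sub>R lift_fst Z z)"
proof
  fix z
  have "(prodJ \<cdot> lift_snd Y) z = pair z (0 + - \<theta> (snd z) (Y (snd z)) *\<^sub>R Z (fst z)) (\<psi> (snd z) (Y (snd z)) + 0)"
    by (simp add: apply_tensor_def prodJ_def dfst_lift_snd[OF Y] dsnd_lift_snd[OF Y] M.form_0 M.tensor_0)
  also have "\<dots> = (lift_snd (\<psi> \<cdot> Y) + (\<lambda>z. - \<theta> (snd z) (Y (snd z)) *\<^sub>R lift_fst Z z)) z"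
    unfolding pair_add using pair_scale[of z "- \<theta> (snd z) (Y (snd z))" _ 0]
    by (simp add: lift_fst_def lift_snd_def apply_tensor_def)
  finally show "(prodJ \<cdot> lift_snd Y) z = \<dots>" .
qed

sublocale J: tensor_field \<P> prodJ
proof
  show "smooth_tensor11 \<P> prodJ"
  proof (rule P.smooth_tensor11_generators[OF lifts_generate])
    fix V assume "V \<in> lift_fst ` {X. smooth_vfield \<A> X} \<union> lift_snd ` {Y. smooth_vfield \<G> Y}"
    then consider X where "smooth_vfield \<A> X" "V = lift_fst X" | Y where "smooth_vfield \<G> Y" "V = lift_snd Y"
      by auto
    then show "smooth_vfield \<P> (prodJ \<cdot> V)"
    proof cases
      case 1
      then show ?thesis unfolding 1(2) prodJ_lift_fst[OF 1(1)]
        by (intro P.vfield_add P.vfield_scale lift_fst_smooth lift_snd_smooth M.tensor_smooth G.Z_smooth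
            smooth_fun_fst[OF M.form_smooth])
    next
      case 2
      have "(\<lambda>z. - \<theta> (snd z) (Y (snd z))) \<in> smooth_fun \<P>"
        using P.smooth_fun_scale[OF smooth_fun_snd[OF G.form_smooth[OF 2(1)]], of "- 1"] by simp
      then show ?thesis unfolding 2(2) prodJ_lift_snd[OF 2(1)]
        by (intro P.vfield_add P.vfield_scale lift_fst_smooth lift_snd_smooth G.tensor_smooth M.Z_smooth 2)
    qed
  qed (rule prodJ_tangent prodJ_add prodJ_scale; assumption)+
qed

lemma prodJ_almost_complex: "almost_complex \<P> prodJ"
  unfolding almost_complex_def using J.tensor prodJ_square by blast

lemma prodJ_prodJ: "smooth_vfield \<P> V \<Longrightarrow> prodJ \<cdot> prodJ \<cdot> V = - V"
  by (auto simp: apply_tensor_def fun_eq_iff prodJ_square P.vfield_tangent)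

lemma prodJ_lift_Z: "prodJ \<cdot> lift_fst Z = lift_snd W"
proof -
  have "F \<cdot> Z = 0" by (auto simp: apply_tensor_def fun_eq_iff M.tensor_Z)
  moreover have "lift_fst 0 = 0" using lift_fst_add[of 0 0] by simp
  ultimately show ?thesis unfolding prodJ_lift_fst[OF M.Z_smooth] by (simp add: M.form_Z)
qed

text \<open>Only fields V + c W occur, with V a lift from M and c a function on M. W commutes with V
  and annihilates c, and J sends V + c W to FV - c Z + \<eta>(V) W. The components along M collect
  to \<open>normality\<close>, those along W to \<open>normality_form\<close>.\<close>

lemma nijenhuis_lift_fst:
  assumes X: "smooth_vfield \<A> X" and Y: "smooth_vfield \<A> Y"
  shows "nijenhuis prodJ (lift_fst X) (lift_fst Y) =
    lift_fst (M.normality X Y) + (\<lambda>z. M.normality_form X Y (fst z) *\<^sub>R lift_snd W z)"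
proof
  fix z
  let ?FX = "F \<cdot> X" and ?FY = "F \<cdot> Y" and ?R = "lift_snd W"
  let ?a = "\<lambda>p. \<eta> p (X p)" and ?b = "\<lambda>p. \<eta> p (Y p)"
  let ?N = "nijenhuis prodJ (lift_fst X) (lift_fst Y) z"
  note FX = M.tensor_smooth[OF X] and FY = M.tensor_smooth[OF Y] and W = G.Z_smooth
  note a = M.form_smooth[OF X] and b = M.form_smooth[OF Y]
  note a' = smooth_fun_fst[OF a] and b' = smooth_fun_fst[OF b]
  note s = X Y FX FY W lift_fst_smooth lift_snd_smooth
  have RR: "lie_bracket ?R ?R = 0" by (simp add: lie_bracket_def fun_eq_iff)
  have RL: "lie_bracket ?R (lift_fst V) = 0" if "smooth_vfield \<A> V" for V
    using bracket_lift_fst_snd[OF that W] by (simp add: P.bracket_skew[of ?R])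
  have aR: "lie_bracket (\<lambda>z. c (fst z) *\<^sub>R ?R z) (lift_fst V) = (\<lambda>z. - V (fst z) c *\<^sub>R ?R z)"
    if "smooth_vfield \<A> V" "c \<in> smooth_fun \<A>" for c V
    using P.bracket_scale_left[OF lift_snd_smooth[OF W] lift_fst_smooth[OF that(1)] smooth_fun_fst[OF that(2)]]
    by (simp add: RL[OF that(1)] lift_fst_on_fst[OF that(2)] fun_eq_iff)
  have Ra: "lie_bracket (lift_fst V) (\<lambda>z. c (fst z) *\<^sub>R ?R z) = (\<lambda>z. V (fst z) c *\<^sub>R ?R z)"
    if "smooth_vfield \<A> V" "c \<in> smooth_fun \<A>" for c V
    using aR[OF that] by (simp add: P.bracket_skew[of "lift_fst V"] fun_eq_iff)
  have bR: "smooth_vfield \<P> (\<lambda>z. c (fst z) *\<^sub>R ?R z)" if "c \<in> smooth_fun \<A>" for c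
    by (intro P.vfield_scale smooth_fun_fst that lift_snd_smooth W)
  have aRbR: "lie_bracket (\<lambda>z. ?a (fst z) *\<^sub>R ?R z) (\<lambda>z. ?b (fst z) *\<^sub>R ?R z) = 0"
    using P.bracket_scale_left[OF lift_snd_smooth[OF W] bR[OF b] a']
      P.bracket_scale_right[OF lift_snd_smooth[OF W] lift_snd_smooth[OF W] b']
    by (simp add: RR lift_snd_on_fst[OF W a] lift_snd_on_fst[OF W b] scaleR_fun_def fun_eq_iff)
  have B1: "lie_bracket (prodJ \<cdot> lift_fst X) (prodJ \<cdot> lift_fst Y) =
      lift_fst (lie_bracket ?FX ?FY) + (\<lambda>z. (?FX (fst z) ?b - ?FY (fst z) ?a) *\<^sub>R ?R z)"
    unfolding prodJ_lift_fst[OF X] prodJ_lift_fst[OF Y]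
    by (simp add: P.bracket_add_left P.bracket_add_right P.vfield_add s bR[OF a] bR[OF b] aR[OF FY a] Ra[OF FX b] aRbR
        bracket_lift_fst fun_eq_iff algebra_simps)
  have B2: "lie_bracket (prodJ \<cdot> lift_fst X) (lift_fst Y) =
      lift_fst (lie_bracket ?FX Y) + (\<lambda>z. - Y (fst z) ?a *\<^sub>R ?R z)"
    unfolding prodJ_lift_fst[OF X] by (simp add: P.bracket_add_left s bR[OF a] aR[OF Y a] bracket_lift_fst)
  have B3: "lie_bracket (lift_fst X) (prodJ \<cdot> lift_fst Y) =
      lift_fst (lie_bracket X ?FY) + (\<lambda>z. X (fst z) ?b *\<^sub>R ?R z)"
    unfolding prodJ_lift_fst[OF Y] by (simp add: P.bracket_add_right s bR[OF b] Ra[OF X b] bracket_lift_fst)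
  have tan: "lift_fst V z + c *\<^sub>R ?R z \<in> tangent_space \<P> z" if "smooth_vfield \<A> V" for V c
    by (intro subspace_add subspace_scale subspace_tangent_space P.vfield_tangent lift_fst_smooth lift_snd_smooth that W)
  have d1: "dfst (lift_fst V z + c *\<^sub>R ?R z) = V (fst z)" if "smooth_vfield \<A> V" for V c
    by (simp add: dfst_add dfst_scale dfst_lift_fst[OF that] dfst_lift_snd[OF W])
  have d2: "dsnd (lift_fst V z + c *\<^sub>R ?R z) = c *\<^sub>R W (snd z)" if "smooth_vfield \<A> V" for V c
    by (simp add: dsnd_add dsnd_scale dsnd_lift_fst[OF that] dsnd_lift_snd[OF W])
  \<comment> \<open>Simplification turns a negative coefficient into a subtraction, so the three
    facts are needed in this shape too.\<close>
  have tan': "lift_fst V z - c *\<^sub>R ?R z \<in> tangent_space \<P> z"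
    and d1': "dfst (lift_fst V z - c *\<^sub>R ?R z) = V (fst z)"
    and d2': "dsnd (lift_fst V z - c *\<^sub>R ?R z) = - c *\<^sub>R W (snd z)" if "smooth_vfield \<A> V" for V c
    using tan[OF that, of "- c"] d1[OF that, of "- c"] d2[OF that, of "- c"] by simp_all
  have JJ: "prodJ z (prodJ z (lift_fst (lie_bracket X Y) z)) = - lift_fst (lie_bracket X Y) z"
    by (intro prodJ_square P.vfield_tangent lift_fst_smooth M.bracket_smooth X Y)
  have N: "?N = - lift_fst (lie_bracket X Y) z
      + (lift_fst (lie_bracket ?FX ?FY) z + (?FX (fst z) ?b - ?FY (fst z) ?a) *\<^sub>R ?R z)
      - prodJ z (lift_fst (lie_bracket ?FX Y) z + - Y (fst z) ?a *\<^sub>R ?R z)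
      - prodJ z (lift_fst (lie_bracket X ?FY) z + X (fst z) ?b *\<^sub>R ?R z)"
    unfolding nijenhuis_def B1 B2 B3 bracket_lift_fst[OF X Y] by (simp add: apply_tensor_def JJ)
  note bs = M.bracket_smooth[OF X Y] M.bracket_smooth[OF FX FY] M.bracket_smooth[OF FX Y] M.bracket_smooth[OF X FY]
  have Wt: "W (snd z) \<in> tangent_space \<G> (snd z)" by (rule G.Z_tangent)
  have neg: "dfst (- u) = - dfst u" "dsnd (- u) = - dsnd u" for u
    using dfst_scale[of "- 1" u] dsnd_scale[of "- 1" u] by simp_all
  have rhs: "(lift_fst (M.normality X Y) + (\<lambda>z. M.normality_form X Y (fst z) *\<^sub>R lift_snd W z)) z =
      lift_fst (M.normality X Y) z + M.normality_form X Y (fst z) *\<^sub>R ?R z" by simp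
  show "?N = (lift_fst (M.normality X Y) + (\<lambda>z. M.normality_form X Y (fst z) *\<^sub>R lift_snd W z)) z"
  proof (rule tangent_prod_eqI)
    show "?N \<in> tangent_space \<P> z"
      by (intro P.vfield_tangent J.nijenhuis_smooth lift_fst_smooth X Y)
    show "(lift_fst (M.normality X Y) + (\<lambda>z. M.normality_form X Y (fst z) *\<^sub>R lift_snd W z)) z \<in> tangent_space \<P> z"
      using tan[OF M.normality_smooth[OF X Y]] by simp
    show "dfst ?N = dfst ((lift_fst (M.normality X Y) + (\<lambda>z. M.normality_form X Y (fst z) *\<^sub>R lift_snd W z)) z)"
      unfolding N rhs d1[OF M.normality_smooth[OF X Y]]
      by (simp add: dfst_diff dfst_add neg dfst_prodJ tan tan' bs d1 d1' d2 d2' dfst_lift_fst G.form_scale[OF Wt] G.form_Z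
          G.form_uminus[OF subspace_scale[OF subspace_tangent_space Wt]]
          M.normality_eq[OF X Y] dfst_scale dfst_lift_snd[OF W] algebra_simps)
    show "dsnd ?N = dsnd ((lift_fst (M.normality X Y) + (\<lambda>z. M.normality_form X Y (fst z) *\<^sub>R lift_snd W z)) z)"
      unfolding N rhs d2[OF M.normality_smooth[OF X Y]]
      by (simp add: dsnd_diff dsnd_add neg dsnd_prodJ tan tan' bs d1 d1' d2 d2' dsnd_lift_fst G.tensor_scale[OF Wt] G.tensor_Z
          G.tensor_uminus[OF subspace_scale[OF subspace_tangent_space Wt]]
          M.normality_form_def dsnd_scale dsnd_lift_snd[OF W] algebra_simps)
  qed
qed

lemma nijenhuis_prodJ_left:
  "smooth_vfield \<P> U \<Longrightarrow> smooth_vfield \<P> V \<Longrightarrow>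
    nijenhuis prodJ (prodJ \<cdot> U) V = - (prodJ \<cdot> nijenhuis prodJ U V)"
  by (rule J.nijenhuis_apply_left[OF prodJ_prodJ])

text \<open>Compare the \<open>TM\<close>-parts in \<open>[J,J](J X, Y) = - J [J,J](X, Y)\<close>, using \<open>J Z = W\<close>.\<close>

lemma normality_form_eq_0:
  assumes S: "\<And>X Y. smooth_vfield \<A> X \<Longrightarrow> smooth_vfield \<A> Y \<Longrightarrow> M.normality X Y = 0"
    and X: "smooth_vfield \<A> X" and Y: "smooth_vfield \<A> Y"
  shows "M.normality_form X Y p = 0"
proof -
  note W = G.Z_smooth and Z = M.Z_smooth
  have l0: "lift_fst 0 = 0" using lift_fst_add[of 0 0] by simp
  have N: "nijenhuis prodJ (lift_fst X) (lift_fst Y) = (\<lambda>z. M.normality_form X Y (fst z) *\<^sub>R lift_snd W z)"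
    if "smooth_vfield \<A> X" "smooth_vfield \<A> Y" for X Y
    using nijenhuis_lift_fst[OF that] S[OF that] l0 by simp
  have JR: "dfst (prodJ z (c *\<^sub>R lift_snd W z)) = - c *\<^sub>R Z (fst z)" for z c
  proof -
    have "lift_snd W z \<in> tangent_space \<P> z" by (intro P.vfield_tangent lift_snd_smooth W)
    then show ?thesis
      by (simp add: prodJ_scale dfst_scale dfst_prodJ dfst_lift_snd[OF W] dsnd_lift_snd[OF W] M.tensor_0 G.form_Z)
  qed
  \<comment> \<open>On lifts JX = FX + \<eta>(X) JZ, so function-linearity splits the left side of
    the identity into a term for FX and \<eta>(X) times the term for JZ. The term for FX is a
    multiple of W and has no component along M; the remaining ones give multiples of
    \<open>Z p\<close>.\<close>
  have step: "M.normality_form X Y p = \<eta> p (X p) * M.normality_form Z Y p"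
    if X: "smooth_vfield \<A> X" and Y: "smooth_vfield \<A> Y" for X Y p
  proof -
    obtain z :: "'m \<times> 'g" where z: "fst z = p" by (metis fst_conv)
    note L = lift_fst_smooth[OF X] lift_fst_smooth[OF Y] lift_fst_smooth[OF Z]
    have "nijenhuis prodJ (prodJ \<cdot> lift_fst X) (lift_fst Y) =
      nijenhuis prodJ (lift_fst (F \<cdot> X)) (lift_fst Y) +
      (\<lambda>z. \<eta> (fst z) (X (fst z)) *\<^sub>R nijenhuis prodJ (prodJ \<cdot> lift_fst Z) (lift_fst Y) z)"
      unfolding prodJ_lift_fst[OF X] prodJ_lift_Z
      using L(2) lift_snd_smooth[OF W] smooth_fun_fst[OF M.form_smooth[OF X]]
      by (simp add: J.nijenhuis_add_left J.nijenhuis_scale_left lift_fst_smooth M.tensor_smooth X P.vfield_scale)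
    from fun_cong[OF this[unfolded nijenhuis_prodJ_left[OF L(1,2)] nijenhuis_prodJ_left[OF L(3,2)]], of z]
    have "- (prodJ z (M.normality_form X Y p *\<^sub>R lift_snd W z)) =
      M.normality_form (F \<cdot> X) Y p *\<^sub>R lift_snd W z
       + \<eta> p (X p) *\<^sub>R (- (prodJ z (M.normality_form Z Y p *\<^sub>R lift_snd W z)))"
      by (simp only: plus_fun_apply uminus_apply apply_tensor_def N[OF X Y] N[OF Z Y] N[OF M.tensor_smooth[OF X] Y] z
        N[OF M.tensor_smooth[OF X, unfolded apply_tensor_def] Y])
    then have "dfst (- (prodJ z (M.normality_form X Y p *\<^sub>R lift_snd W z))) =
      dfst (M.normality_form (F \<cdot> X) Y p *\<^sub>R lift_snd W z
       + \<eta> p (X p) *\<^sub>R (- (prodJ z (M.normality_form Z Y p *\<^sub>R lift_snd W z))))" by (rule arg_cong)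
    moreover have neg: "dfst (- u) = - dfst u" for u
      using dfst_scale[of "- 1" u] by simp
    ultimately have "M.normality_form X Y p *\<^sub>R Z p = (\<eta> p (X p) * M.normality_form Z Y p) *\<^sub>R Z p"
      by (simp only: neg dfst_add dfst_scale JR z dfst_lift_snd[OF W]) simp
    then show ?thesis using M.Z_nonzero[of p] by (simp del: scaleR_fun_def)
  qed
  \<comment> \<open>With Z in the second slot, \<open>step\<close> spreads the vanishing diagonal
    value to all pairs (Y, Z); skew symmetry then moves Z to the first slot, where
    \<open>step\<close> for (X, Y) refers to it.\<close>
  have "M.normality_form Z Z p = 0" using M.normality_form_skew[OF Z Z, of p] by simp
  then have "M.normality_form Y Z p = 0" using step[OF Y Z, of p] by simp
  then have "M.normality_form Z Y p = 0" using M.normality_form_skew[OF Y Z, of p] by simp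
  then show ?thesis using step[OF X Y, of p] by simp
qed

lemma normality_eq_0_if_integrable:
  assumes "integrable_structure \<P> prodJ" "smooth_vfield \<A> X" "smooth_vfield \<A> Y"
  shows "M.normality X Y = 0"
proof
  fix p
  obtain z :: "'m \<times> 'g" where z: "fst z = p" by (metis fst_conv)
  have "nijenhuis prodJ (lift_fst X) (lift_fst Y) z = 0"
    using assms lift_fst_smooth unfolding integrable_structure_def by auto
  then have "dfst (lift_fst (M.normality X Y) z + M.normality_form X Y p *\<^sub>R lift_snd W z) = dfst 0"
    unfolding nijenhuis_lift_fst[OF assms(2,3)] by (simp add: z)
  moreover have "dfst 0 = 0" by (auto simp: differential_def fun_eq_iff)
  ultimately show "M.normality X Y p = 0 p"
    by (simp add: dfst_add dfst_scale dfst_lift_fst[OF M.normality_smooth[OF assms(2,3)]] dfst_lift_snd[OF G.Z_smooth] z)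
qed

text \<open>As \<open>[J,J]\<close> is function-bilinear, \<open>[J,J](J U, V) = - J [J,J](U, V)\<close>, \<open>W = J Z\<close> and \<open>\<psi> B = J B\<close>,
  it suffices to evaluate \<open>[J,J]\<close> on the lifts from the first factor and on \<open>B\<close>.\<close>

lemma integrable_if_normality_eq_0:
  assumes S: "\<And>X Y. smooth_vfield \<A> X \<Longrightarrow> smooth_vfield \<A> Y \<Longrightarrow> M.normality X Y = 0"
    and B: "smooth_vfield \<G> B" "\<And>g. \<theta> g (B g) = 0"
    and span: "\<And>Y. smooth_vfield \<G> Y \<Longrightarrow> \<exists>a\<in>smooth_fun \<G>. \<exists>b\<in>smooth_fun \<G>. \<exists>c\<in>smooth_fun \<G>.
       Y = (\<lambda>g. a g *\<^sub>R B g) + (\<lambda>g. b g *\<^sub>R \<psi> g (B g)) + (\<lambda>g. c g *\<^sub>R W g)"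
    and comm: "prodJ \<cdot> lift_snd (lie_bracket W B) = lift_snd (lie_bracket W (\<psi> \<cdot> B))"
  shows "integrable_structure \<P> prodJ"
proof -
  note W = G.Z_smooth and Z = M.Z_smooth
  let ?N = "nijenhuis prodJ"
  have l0: "lift_fst 0 = 0" using lift_fst_add[of 0 0] by simp
  have LL: "?N (lift_fst X) (lift_fst Y) = 0" if "smooth_vfield \<A> X" "smooth_vfield \<A> Y" for X Y
    using nijenhuis_lift_fst[OF that] S[OF that] normality_form_eq_0[OF S that] by (simp add: l0 fun_eq_iff scaleR_fun_def)
  have JB: "prodJ \<cdot> lift_snd B = lift_snd (\<psi> \<cdot> B)"
    using prodJ_lift_snd[OF B(1)] B(2) by (simp add: fun_eq_iff scaleR_fun_def)
  \<comment> \<open>JX differs from the lift of FX by \<eta>(X) W. Only this part has a nonzero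
    bracket with lifts from G, and its coefficient is constant along them; \<open>comm\<close>
    cancels what is left.\<close>
  have LB: "?N (lift_fst X) (lift_snd B) = 0" if X: "smooth_vfield \<A> X" for X
  proof -
    let ?a = "\<lambda>z. \<eta> (fst z) (X (fst z))"
    note a = smooth_fun_fst[OF M.form_smooth[OF X]]
    note s = lift_fst_smooth lift_snd_smooth W B M.tensor_smooth[OF X] G.tensor_smooth[OF B(1)] P.vfield_scale[OF a]
    have *: "lie_bracket (prodJ \<cdot> lift_fst X) (lift_snd Y) = (\<lambda>z. ?a z *\<^sub>R lift_snd (lie_bracket W Y) z)"
      if Y: "smooth_vfield \<G> Y" for Y
      unfolding prodJ_lift_fst[OF X]
      by (simp add: P.bracket_add_left P.bracket_scale_left[OF _ _ a] s Y bracket_lift_fst_snd bracket_lift_snd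
          lift_snd_on_fst[OF Y M.form_smooth[OF X]] fun_eq_iff)
    have "prodJ \<cdot> (\<lambda>z. ?a z *\<^sub>R lift_snd (lie_bracket W B) z) = (\<lambda>z. ?a z *\<^sub>R lift_snd (lie_bracket W (\<psi> \<cdot> B)) z)"
      using J.apply_scale[of "lift_snd (lie_bracket W B)" ?a] comm by (simp add: s G.bracket_smooth)
    then show ?thesis
      unfolding nijenhuis_def JB
      by (simp add: * s bracket_lift_fst_snd X J.apply_0)
  qed
  \<comment> \<open>The second slot stays arbitrary because it is filled in turn by a lift from M,
    the lift of \<open>B\<close> and any lift from G, each case resting on the earlier ones.\<close>
  have RV: "?N (lift_snd Y) V = 0"
    if Y: "smooth_vfield \<G> Y" and V: "smooth_vfield \<P> V" and 0: "?N (lift_snd B) V = 0" "?N (lift_fst Z) V = 0" for Y V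
  proof -
    note s = lift_fst_smooth lift_snd_smooth W Z B G.tensor_smooth[OF B(1)] V P.vfield_scale P.vfield_add smooth_fun_snd
    have J0: "prodJ \<cdot> (\<lambda>a b. 0) = 0" using J.apply_0 by (simp add: zero_fun_def)
    have 1: "?N (lift_snd (\<psi> \<cdot> B)) V = 0"
      using nijenhuis_prodJ_left[OF lift_snd_smooth[OF B(1)] V] 0(1) J.apply_0 by (simp add: JB)
    have 2: "?N (lift_snd W) V = 0"
      using nijenhuis_prodJ_left[OF lift_fst_smooth[OF Z] V] 0(2) J.apply_0 by (simp add: prodJ_lift_Z)
    obtain a b c where abc: "a \<in> smooth_fun \<G>" "b \<in> smooth_fun \<G>" "c \<in> smooth_fun \<G>"
      and Yeq: "Y = (\<lambda>g. a g *\<^sub>R B g) + (\<lambda>g. b g *\<^sub>R (\<psi> \<cdot> B) g) + (\<lambda>g. c g *\<^sub>R W g)"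
      using span[OF Y] unfolding apply_tensor_def by blast
    have sc: "lift_snd (\<lambda>g. a g *\<^sub>R Y g) = (\<lambda>z. a (snd z) *\<^sub>R lift_snd Y z)" for a Y
      using pair_scale[of _ _ 0] by (auto simp: lift_snd_def fun_eq_iff)
    have z: "(\<lambda>z. d z *\<^sub>R (0 :: ('m \<times> 'g) vfield) z) = 0" for d by (simp add: fun_eq_iff scaleR_fun_def)
    show ?thesis unfolding Yeq lift_snd_add sc
      by (simp add: J.nijenhuis_add_left J.nijenhuis_scale_left s abc 0 1 2) (simp add: z fun_eq_iff scaleR_fun_def)
  qed
  have sk: "?N V U = 0" if "?N U V = 0" "smooth_vfield \<P> U" "smooth_vfield \<P> V" for U V
    using J.nijenhuis_skew[OF that(2,3)] that(1) by simp
  note sL = lift_fst_smooth and sR = lift_snd_smooth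
  have RL: "?N (lift_snd Y) (lift_fst X) = 0" if X: "smooth_vfield \<A> X" and Y: "smooth_vfield \<G> Y" for X Y
    by (rule RV[OF Y sL[OF X] sk[OF LB[OF X] sL[OF X] sR[OF B(1)]] LL[OF Z X]])
  have BB: "?N (lift_snd B) (lift_snd B) = 0"
    using J.nijenhuis_skew[OF sR[OF B(1)] sR[OF B(1)]] by (simp add: fun_eq_iff)
  have RB: "?N (lift_snd Y) (lift_snd B) = 0" if Y: "smooth_vfield \<G> Y" for Y
    by (rule RV[OF Y sR[OF B(1)] BB LB[OF Z]])
  have RR: "?N (lift_snd Y) (lift_snd Y') = 0" if Y: "smooth_vfield \<G> Y" and Y': "smooth_vfield \<G> Y'" for Y Y'
    by (rule RV[OF Y sR[OF Y'] sk[OF RB[OF Y'] sR[OF Y'] sR[OF B(1)]] sk[OF RL[OF Z Y'] sR[OF Y'] sL[OF Z]]])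
  have "?N X Y = 0" if "smooth_vfield \<P> X" "smooth_vfield \<P> Y" for X Y
  proof (rule J.nijenhuis_vanish[OF lifts_generate that])
    fix U V
    assume "U \<in> lift_fst ` {X. smooth_vfield \<A> X} \<union> lift_snd ` {Y. smooth_vfield \<G> Y}"
      "V \<in> lift_fst ` {X. smooth_vfield \<A> X} \<union> lift_snd ` {Y. smooth_vfield \<G> Y}"
    then show "?N U V = 0" using LL RL RR sk[OF RL] sL sR by auto
  qed
  then show ?thesis unfolding integrable_structure_def using prodJ_almost_complex by blast
qed

end

section \<open>Parallelisations by three vector fields\<close>

text \<open>Passes from a family without nontrivial relations to its range. Injectivity belongs to
  the conclusion since a repeated value is a relation with coefficients 1 and -1.\<close>

lemma frame_of_scalars:
  fixes v :: "'k::finite \<Rightarrow> 'a::real_vector"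
  assumes "\<And>c j. (\<Sum>j\<in>UNIV. c j *\<^sub>R v j) = 0 \<Longrightarrow> c j = (0::real)"
  shows "inj v" "independent (range v)"
proof -
  show inj: "inj v"
  proof (rule injI, rule ccontr)
    fix i j assume ij: "v i = v j" "i \<noteq> j"
    let ?c = "\<lambda>k. (if k = i then 1 else 0) - (if k = j then 1 else (0::real))"
    have "(\<Sum>k\<in>UNIV. ?c k *\<^sub>R v k) = v i - v j"
      by (simp add: scaleR_left_diff_distrib sum_subtractf if_distrib[of "\<lambda>a. a *\<^sub>R _"] cong: if_cong)
    then have "?c i = 0" using assms[of ?c i] ij by simp
    then show False using ij by simp
  qed
  show "independent (range v)"
  proof (rule independent_if_scalars_zero)
    fix f x assume "(\<Sum>x\<in>range v. f x *\<^sub>R x) = 0" "x \<in> range v"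
    then show "f x = 0" using assms[of "\<lambda>j. f (v j)"] by (auto simp: sum.reindex[OF inj])
  qed simp
qed

locale parallelised = manifold \<G>
  for \<G> :: "('g::{t2_space,second_countable_topology}, 'f::euclidean_space) atlas" +
  fixes \<Lambda> :: "3 \<Rightarrow> 'g vfield"
  assumes frame_smooth: "smooth_vfield \<G> (\<Lambda> i)"
    and frame_inj: "inj (\<lambda>i. \<Lambda> i g)"
    and frame_indep: "independent (range (\<lambda>i. \<Lambda> i g))"
    and frame_span: "v \<in> tangent_space \<G> g \<Longrightarrow> \<exists>c. v = (\<Sum>j\<in>UNIV. c j *\<^sub>R \<Lambda> j g)"
begin

lemma lambda_sum: "lambda \<Lambda> i g (\<Sum>j\<in>UNIV. c j *\<^sub>R \<Lambda> j g) = c i"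
  unfolding lambda_def
  by (rule coframe_eqI[OF frame_inj frame_indep]) (auto simp: subspace_def span_0)

lemma lambda_decomp: "v \<in> tangent_space \<G> g \<Longrightarrow> (\<Sum>j\<in>UNIV. lambda \<Lambda> j g v *\<^sub>R \<Lambda> j g) = v"
proof -
  assume "v \<in> tangent_space \<G> g"
  then obtain c where c: "v = (\<Sum>j\<in>UNIV. c j *\<^sub>R \<Lambda> j g)" using frame_span by blast
  show ?thesis unfolding c lambda_sum ..
qed

lemma lambda_add:
  assumes "u \<in> tangent_space \<G> g" "v \<in> tangent_space \<G> g"
  shows "lambda \<Lambda> i g (u + v) = lambda \<Lambda> i g u + lambda \<Lambda> i g v"
proof -
  have "u + v = (\<Sum>j\<in>UNIV. (lambda \<Lambda> j g u + lambda \<Lambda> j g v) *\<^sub>R \<Lambda> j g)"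
    by (simp add: scaleR_left_distrib sum.distrib lambda_decomp assms)
  then have "lambda \<Lambda> i g (u + v) = lambda \<Lambda> i g \<dots>" by (rule arg_cong)
  then show ?thesis unfolding lambda_sum .
qed

lemma lambda_scale:
  assumes "u \<in> tangent_space \<G> g" shows "lambda \<Lambda> i g (c *\<^sub>R u) = c * lambda \<Lambda> i g u"
proof -
  have "c *\<^sub>R u = (\<Sum>j\<in>UNIV. (c * lambda \<Lambda> j g u) *\<^sub>R \<Lambda> j g)"
    by (simp add: scaleR_scaleR[symmetric] scaleR_sum_right[symmetric] lambda_decomp assms del: scaleR_scaleR)
  then have "lambda \<Lambda> i g (c *\<^sub>R u) = lambda \<Lambda> i g \<dots>" by (rule arg_cong)
  then show ?thesis unfolding lambda_sum .
qed

lemma lambda_frame: "lambda \<Lambda> i g (\<Lambda> j g) = (if i = j then 1 else 0)"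
proof -
  have "(\<Sum>l\<in>UNIV. (if l = j then 1 else 0) *\<^sub>R \<Lambda> l g) = \<Lambda> j g"
    by (simp add: if_distrib[of "\<lambda>a. a *\<^sub>R _"] cong: if_cong)
  then show ?thesis using lambda_sum[of i g "\<lambda>l. if l = j then 1 else 0"] by simp
qed

lemma lambda_smooth: assumes "smooth_vfield \<G> Y" shows "(\<lambda>g. lambda \<Lambda> i g (Y g)) \<in> smooth_fun \<G>"
proof (rule frame_coeff_smooth[OF manifold manifold _ frame_smooth frame_inj frame_indep])
  fix f assume f: "f \<in> smooth_fun \<G>"
  have "(\<lambda>q. \<Sum>j\<in>UNIV. lambda \<Lambda> j q (Y q) * \<Lambda> j q f) = (\<lambda>q. (\<Sum>j\<in>UNIV. lambda \<Lambda> j q (Y q) *\<^sub>R \<Lambda> j q) f)"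
    by (simp add: sum_fun_apply scaleR_fun_def)
  also have "\<dots> = (\<lambda>q. Y q f)" by (simp add: lambda_decomp vfield_tangent[OF assms])
  finally show "(\<lambda>q. \<Sum>j\<in>UNIV. lambda \<Lambda> j q (Y q) * \<Lambda> j q f) \<in> smooth_fun \<G>"
    using vfield_smooth[OF assms f] by simp
qed

lemma frame_tangent: "\<Lambda> i g \<in> tangent_space \<G> g"
  by (rule vfield_tangent[OF frame_smooth])

lemma psi_almost_contact: "almost_contact \<G> (psi \<Lambda>) (lambda \<Lambda> 3) (\<Lambda> 3)"
proof
  show "smooth_tensor11 \<G> (psi \<Lambda>)"
    unfolding smooth_tensor11_def
  proof (intro conjI allI impI ballI)
    fix g u v assume u: "u \<in> tangent_space \<G> g"
    show "psi \<Lambda> g u \<in> tangent_space \<G> g"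
      unfolding psi_def by (intro subspace_diff subspace_scale subspace_tangent_space frame_tangent)
    show "psi \<Lambda> g (c *\<^sub>R u) = c *\<^sub>R psi \<Lambda> g u" for c
      unfolding psi_def by (simp add: lambda_scale u algebra_simps)
    assume v: "v \<in> tangent_space \<G> g"
    show "psi \<Lambda> g (u + v) = psi \<Lambda> g u + psi \<Lambda> g v"
      unfolding psi_def by (simp add: lambda_add u v algebra_simps)
  next
    fix Y assume Y: "smooth_vfield \<G> Y"
    have "(\<lambda>g. psi \<Lambda> g (Y g)) = (\<lambda>g. lambda \<Lambda> 1 g (Y g) *\<^sub>R \<Lambda> 2 g) - (\<lambda>g. lambda \<Lambda> 2 g (Y g) *\<^sub>R \<Lambda> 1 g)"
      by (simp add: psi_def fun_eq_iff)
    then show "smooth_vfield \<G> (\<lambda>g. psi \<Lambda> g (Y g))"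
      using vfield_diff[OF vfield_scale[OF lambda_smooth[OF Y, of 1] frame_smooth[of 2]]
          vfield_scale[OF lambda_smooth[OF Y, of 2] frame_smooth[of 1]]] by simp
  qed
  note s = subspace_scale[OF subspace_tangent_space frame_tangent]
  have diff: "lambda \<Lambda> i g (a *\<^sub>R \<Lambda> j g - b *\<^sub>R \<Lambda> k g) = a * lambda \<Lambda> i g (\<Lambda> j g) - b * lambda \<Lambda> i g (\<Lambda> k g)" for a b i j k g
  proof -
    have "a *\<^sub>R \<Lambda> j g - b *\<^sub>R \<Lambda> k g = a *\<^sub>R \<Lambda> j g + - b *\<^sub>R \<Lambda> k g" by simp
    then show ?thesis by (simp only: lambda_add[OF s s] lambda_scale[OF frame_tangent])
  qed
  fix g u assume u: "u \<in> tangent_space \<G> g"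
  have "u = lambda \<Lambda> 1 g u *\<^sub>R \<Lambda> 1 g + lambda \<Lambda> 2 g u *\<^sub>R \<Lambda> 2 g + lambda \<Lambda> 3 g u *\<^sub>R \<Lambda> 3 g"
    using lambda_decomp[OF u] by (simp add: sum_3)
  then show "psi \<Lambda> g (psi \<Lambda> g u) = - u + lambda \<Lambda> 3 g u *\<^sub>R \<Lambda> 3 g"
    by (simp add: psi_def diff lambda_frame algebra_simps)
  show "lambda \<Lambda> 3 g (psi \<Lambda> g u) = 0" by (simp add: psi_def diff lambda_frame)
qed (auto intro: frame_smooth lambda_smooth simp: lambda_add lambda_scale psi_def lambda_frame)

end

section \<open>Left-invariant vector fields\<close>

text \<open>Freeze the coefficients of \<open>local_frame\<close> at \<open>p\<close>. There the
  cut-off has value 1, so its cube disappears.\<close>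

lemma (in manifold) tangent_extends:
  assumes v: "v \<in> tangent_space \<A> p"
  obtains Y where "smooth_vfield \<A> Y" "Y p = v"
proof -
  obtain U x where c: "(U, x) \<in> \<A>" "p \<in> U" using chart_at .
  obtain \<beta> K where \<beta>: "\<beta> \<in> smooth_fun \<A>" "\<beta> p = 1" "closed K" "K \<subseteq> U" "\<And>q. q \<notin> K \<Longrightarrow> \<beta> q = 0"
    using bump_exists[OF chart_props(1)[OF c(1)] c(2)] by blast
  let ?c = "\<lambda>b. \<beta> p * v (\<lambda>r. \<beta> r * (x r \<bullet> b)) - \<beta> p * (x p \<bullet> b) * v \<beta>"
  let ?Y = "\<Sum>b\<in>Basis. (\<lambda>q. ?c b *\<^sub>R coord_field \<A> U x \<beta> b q)"
  show ?thesis
  proof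
    show "smooth_vfield \<A> ?Y"
      by (intro vfield_sum vfield_scale smooth_fun_const coord_field_smooth[OF c(1) \<beta>(1,3,4,5)])
    show "?Y p = v"
      using local_frame[OF c(1) \<beta>(1,3,4,5) v] \<beta>(2) by (simp add: sum_fun_apply)
  qed
qed

lemma smooth_map_pullback:
  assumes A: "smooth_manifold \<A>" and B: "smooth_manifold \<B>" and F: "smooth_map \<A> \<B> F"
    and f: "f \<in> smooth_fun \<B>"
  shows "(\<lambda>p. f (F p)) \<in> smooth_fun \<A>"
proof -
  interpret A: manifold \<A> using A by unfold_locales
  interpret B: manifold \<B> using B by unfold_locales
  show ?thesis
  proof (rule A.smooth_fun_local)
    fix p
    obtain U x where U: "(U, x) \<in> \<A>" "p \<in> U" using A.chart_at .
    obtain V y where V: "(V, y) \<in> \<B>" "F p \<in> V" using B.chart_at .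
    define W where "W = U \<inter> F -` V"
    have cont: "continuous_on UNIV F" using F by (simp add: smooth_map_def)
    have W: "open W" "p \<in> W" "W \<subseteq> U"
      using A.chart_props(1)[OF U(1)] open_vimage[OF B.chart_props(1)[OF V(1)] cont] U V by (auto simp: W_def)
    have xW: "open (x ` W)" using A.chart_open[OF U(1) W(1)] W(3) by (simp add: inf_absorb2)
    have s: "smooth_on (x ` W) (y \<circ> F \<circ> inv_into U x)"
      using F U V unfolding smooth_map_def W_def by blast
    have "smooth_on (y ` V) (f \<circ> inv_into V y)" using f V by (auto simp: smooth_fun_def)
    from smooth_on_compose[OF xW B.chart_props(2)[OF V(1)] _ this s]
    have "smooth_on (x ` W) (\<lambda>z. (f \<circ> inv_into V y) ((y \<circ> F \<circ> inv_into U x) z))"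
      using U(1) by (force simp: W_def)
    then have "smooth_on (x ` W) ((\<lambda>p. f (F p)) \<circ> inv_into U x)"
      by (rule smooth_on_cong[OF xW, THEN iffD1, rotated]) (use U(1) V(1) in \<open>auto simp: W_def\<close>)
    then have "(\<lambda>p. f (F p)) \<in> smooth_fun_on \<A> W" by (rule A.smooth_fun_onI_chart[OF U(1) W(1,3)])
    then show "\<exists>W. open W \<and> p \<in> W \<and> (\<lambda>p. f (F p)) \<in> smooth_fun_on \<A> W" using W by blast
  qed
qed

lemma linear_sum_scale:
  assumes "linear h" shows "h (\<Sum>j\<in>UNIV. c j *\<^sub>R x j) = (\<Sum>j\<in>UNIV. c j *\<^sub>R h (x j))"
  unfolding linear_sum[OF assms] linear_scale[OF assms] ..

lemma basis_expand:
  fixes \<xi> :: "'k::finite \<Rightarrow> 'l::real_vector"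
  assumes "is_basis \<xi>" obtains c where "a = (\<Sum>j\<in>UNIV. c j *\<^sub>R \<xi> j)"
proof -
  have "a \<in> span (range \<xi>)" using assms by (simp add: is_basis_def)
  then obtain k where "a = (\<Sum>x\<in>range \<xi>. k x *\<^sub>R x)" by (auto simp: span_finite)
  then have "a = (\<Sum>j\<in>UNIV. k (\<xi> j) *\<^sub>R \<xi> j)"
    using assms by (subst (asm) sum.reindex) (auto simp: is_basis_def)
  then show ?thesis using that[of "\<lambda>j. k (\<xi> j)"] by blast
qed

lemma basis_scalars_0:
  fixes \<xi> :: "'k::finite \<Rightarrow> 'l::real_vector"
  assumes "is_basis \<xi>" "(\<Sum>j\<in>UNIV. c j *\<^sub>R \<xi> j) = 0" shows "c i = 0"
proof -
  have inj: "inj \<xi>" using assms(1) by (simp add: is_basis_def)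
  have "(\<Sum>x\<in>range \<xi>. c (inv \<xi> x) *\<^sub>R x) = 0"
    using assms(2) by (simp add: sum.reindex[OF inj] inv_f_f[OF inj])
  then have "c (inv \<xi> (\<xi> i)) = 0"
    using assms(1) independentD[of "range \<xi>" "range \<xi>" "\<lambda>x. c (inv \<xi> x)" "\<xi> i"] by (simp add: is_basis_def)
  then show ?thesis by (simp add: inv_f_f[OF inj])
qed

text \<open>Evaluation at \<open>g\<close> identifies the Lie algebra with the tangent space. A
  vector at \<open>g\<close> is carried to the unit and spread by left translations, which gives
  surjectivity; a left-invariant field with one zero vanishes everywhere, which gives
  injectivity.\<close>

lemma lie_group_parallelised:
  fixes \<G> :: "('g::{t2_space,second_countable_topology}, 'f::euclidean_space) atlas" and \<xi> :: "3 \<Rightarrow> 'l::real_vector"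
  assumes lie: "lie_group \<G> mul e iv" and alg: "has_lie_algebra \<G> mul br \<iota>" and basis: "is_basis \<xi>"
  shows "parallelised \<G> (\<lambda>i. \<iota> (\<xi> i))"
proof -
  interpret G: manifold \<G> using lie by unfold_locales (simp add: lie_group_def)
  interpret GG: two_manifolds \<G> \<G> by unfold_locales
  interpret gr: group mul e iv using lie by (simp add: lie_group_def)
  have lin: "linear \<iota>" and sm: "smooth_vfield \<G> (\<iota> a)" and bij: "bij_betw \<iota> UNIV (left_invariant_fields \<G> mul)" for a
    using alg by (auto simp: has_lie_algebra_def lie_algebra_hom_def)
  have left: "differential \<G> \<G> (mul g) (\<iota> a h) = \<iota> a (mul g h)" for a g h
    using bij by (auto simp: bij_betw_def left_invariant_fields_def)
  have mul_smooth: "(\<lambda>z. f (mul (fst z) (snd z))) \<in> smooth_fun (prod_atlas \<G> \<G>)" if "f \<in> smooth_fun \<G>" for f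
    using smooth_map_pullback[OF GG.P.manifold G.manifold _ that, of "\<lambda>(g, h). mul g h"] lie
    by (simp add: lie_group_def split_beta)
  have mul_g: "(\<lambda>h. f (mul g h)) \<in> smooth_fun \<G>" if "f \<in> smooth_fun \<G>" for f g
    using GG.smooth_fun_section'[OF mul_smooth[OF that], of g] by simp
  have dmul: "differential \<G> \<G> (mul g) v f = v (\<lambda>h. f (mul g h))" if "f \<in> smooth_fun \<G>" for v f g
    using that by (simp add: differential_def comp_def)
  have dmul_tangent: "differential \<G> \<G> (mul g) v \<in> tangent_space \<G> (mul g h)" if v: "v \<in> tangent_space \<G> h" for v g h
    unfolding tangent_space_def
    by (auto simp: differential_def comp_def tangent_add[OF v] tangent_scale[OF v] tangent_mult[OF v]
      mul_g G.smooth_fun_add G.smooth_fun_mult G.smooth_fun_scale)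
  have dmul_comp: "differential \<G> \<G> (mul g) (differential \<G> \<G> (mul h) v) = differential \<G> \<G> (mul (mul g h)) v" for g h v
    by (auto simp: differential_def comp_def fun_eq_iff mul_g gr.assoc)
  have surj: "\<exists>a. \<iota> a g = v" if v: "v \<in> tangent_space \<G> g" for v g
  proof -
    define v' where "v' = differential \<G> \<G> (mul (iv g)) v"
    have v': "v' \<in> tangent_space \<G> e"
      using dmul_tangent[OF v, of "iv g"] by (simp add: v'_def gr.left_inverse)
    define X where "X h = differential \<G> \<G> (mul h) v'" for h
    \<comment> \<open>The extension \<open>Y\<close> of the vector at the unit serves to prove
      \<open>X\<close> smooth: \<open>X h f\<close> is the derivative along \<open>Y\<close> of the
      multiplication followed by \<open>f\<close>, taken in the second variable at the unit.\<close>
    obtain Y where Y: "smooth_vfield \<G> Y" "Y e = v'" using G.tangent_extends[OF v'] .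
    have "smooth_vfield \<G> X"
      unfolding smooth_vfield_def
    proof (intro conjI allI ballI)
      show "X h \<in> tangent_space \<G> h" for h
        using dmul_tangent[OF v', of h] by (simp add: X_def gr.right_neutral)
      fix f assume f: "f \<in> smooth_fun \<G>"
      have "(\<lambda>z. Y (snd z) (\<lambda>h. f (mul (fst z) h))) \<in> smooth_fun (prod_atlas \<G> \<G>)"
        using GG.smooth_fun_partial_vfield'[OF Y(1) mul_smooth[OF f]] by simp
      from GG.smooth_fun_section[OF this, of e] show "(\<lambda>h. X h f) \<in> smooth_fun \<G>"
        by (simp add: X_def dmul[OF f] Y(2))
    qed
    then have "X \<in> left_invariant_fields \<G> mul"
      by (simp add: left_invariant_fields_def X_def dmul_comp)
    then obtain a where "X = \<iota> a" using bij by (auto simp: bij_betw_def)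
    \<comment> \<open>Translation by \<open>e\<close> fixes \<open>v\<close>; smooth functions
      suffice for the comparison because both sides vanish on the others.\<close>
    moreover have "X g = v"
      unfolding X_def v'_def dmul_comp gr.right_inverse
      by (rule tangent_space_eqI[OF _ v])
         (use dmul_tangent[OF v, of e] in \<open>auto simp: gr.left_neutral dmul\<close>)
    ultimately show ?thesis by auto
  qed
  have inj: "a = 0" if "\<iota> a g = 0" for a g
  proof -
    have "\<iota> a h = 0" for h
    proof -
      have "\<iota> a h = differential \<G> \<G> (mul (mul h (iv g))) (\<iota> a g)"
        unfolding left by (simp add: gr.assoc gr.left_inverse gr.right_neutral)
      then show ?thesis unfolding that by (auto simp: differential_def fun_eq_iff)
    qed
    then have "\<iota> a = \<iota> 0" by (simp add: linear_0[OF lin] fun_eq_iff)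
    then show ?thesis using bij by (auto simp: bij_betw_def inj_def)
  qed
  have sum: "\<iota> (\<Sum>j\<in>UNIV. c j *\<^sub>R \<xi> j) g = (\<Sum>j\<in>UNIV. c j *\<^sub>R \<iota> (\<xi> j) g)" for c g
    by (simp add: linear_sum_scale[OF lin] sum_fun_apply[where I = "UNIV :: 3 set"] scaleR_fun_def[of _ "\<iota> _"])
  have scal: "c j = 0" if "(\<Sum>j\<in>UNIV. c j *\<^sub>R \<iota> (\<xi> j) g) = 0" for c j g
    using basis_scalars_0[OF basis, of c j] inj[of "\<Sum>j\<in>UNIV. c j *\<^sub>R \<xi> j" g] that sum by simp
  show ?thesis
  proof
    show "inj (\<lambda>i. \<iota> (\<xi> i) g)" "independent (range (\<lambda>i. \<iota> (\<xi> i) g))" for g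
      by (rule frame_of_scalars; erule scal)+
    fix v g assume "v \<in> tangent_space \<G> g"
    then obtain a where a: "\<iota> a g = v" using surj by blast
    obtain c where "a = (\<Sum>j\<in>UNIV. c j *\<^sub>R \<xi> j)" using basis_expand[OF basis] .
    then show "\<exists>c. v = (\<Sum>j\<in>UNIV. c j *\<^sub>R \<iota> (\<xi> j) g)" using a sum by blast
  qed (rule sm)
qed

section \<open>f-structures with three-dimensional parallelised kernel\<close>

locale f_pk3 = manifold \<A>
  for \<A> :: "('m::{t2_space,second_countable_topology}, 'e::euclidean_space) atlas" +
  fixes \<phi> :: "'m tensor11" and \<Xi> :: "3 \<Rightarrow> 'm vfield"
  assumes fpk: "f_pk_structure \<A> \<phi> \<Xi>"
begin

sublocale phi: tensor_field \<A> \<phi>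
  using fpk by unfold_locales (simp add: f_pk_structure_def f_structure_def)

abbreviation "\<eta> \<equiv> eta \<A> \<phi> \<Xi>"

lemma Xi_smooth: "smooth_vfield \<A> (\<Xi> i)"
  using fpk by (simp add: f_pk_structure_def)

lemma Xi_tangent: "\<Xi> i p \<in> tangent_space \<A> p"
  by (rule vfield_tangent[OF Xi_smooth])

lemma phi_Xi: "\<phi> p (\<Xi> i p) = 0"
  using span_base[of "\<Xi> i p" "range (\<lambda>i. \<Xi> i p)"] fpk_facts(3)[OF fpk, of p] by (auto simp: ker_at_def)

lemma eta_sum: "\<eta> i p (\<Sum>j\<in>UNIV. c j *\<^sub>R \<Xi> j p) = c i"
  by (rule eta_eqI[OF fpk]) (simp add: subspace_0[OF subspace_im_at[OF fpk]])

lemma eta_add: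
  assumes "u \<in> tangent_space \<A> p" "v \<in> tangent_space \<A> p"
  shows "\<eta> i p (u + v) = \<eta> i p u + \<eta> i p v"
proof (rule eta_eqI[OF fpk])
  have "(u + v) - (\<Sum>j\<in>UNIV. (\<eta> j p u + \<eta> j p v) *\<^sub>R \<Xi> j p) =
      (u - (\<Sum>j\<in>UNIV. \<eta> j p u *\<^sub>R \<Xi> j p)) + (v - (\<Sum>j\<in>UNIV. \<eta> j p v *\<^sub>R \<Xi> j p))"
    by (simp add: scaleR_left_distrib sum.distrib)
  then show "(u + v) - (\<Sum>j\<in>UNIV. (\<eta> j p u + \<eta> j p v) *\<^sub>R \<Xi> j p) \<in> im_at \<A> \<phi> p"
    using subspace_add[OF subspace_im_at[OF fpk] eta_decomp[OF fpk assms(1)] eta_decomp[OF fpk assms(2)]] by metis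
qed

lemma eta_scale:
  assumes "u \<in> tangent_space \<A> p" shows "\<eta> i p (c *\<^sub>R u) = c * \<eta> i p u"
  by (rule eta_eqI[OF fpk])
     (use subspace_scale[OF subspace_im_at[OF fpk] eta_decomp[OF fpk assms(1)], of c]
      in \<open>simp add: scaleR_right_diff_distrib scaleR_sum_right\<close>)

lemma eta_phi: "v \<in> tangent_space \<A> p \<Longrightarrow> \<eta> i p (\<phi> p v) = 0"
  by (rule eta_im[OF fpk]) (simp add: im_at_def)

text \<open>From \<phi>^3 = -\<phi>, the map -\<phi>^2 is the projection onto the image along the
  kernel, so 1 + \<phi>^2 is the projection onto the kernel.\<close>

lemma kernel_part:
  assumes v: "v \<in> tangent_space \<A> p"
  shows "v + \<phi> p (\<phi> p v) = (\<Sum>j\<in>UNIV. \<eta> j p v *\<^sub>R \<Xi> j p)"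
proof -
  let ?S = "\<Sum>j\<in>UNIV. \<eta> j p v *\<^sub>R \<Xi> j p"
  obtain u where u: "u \<in> tangent_space \<A> p" "v - ?S = \<phi> p u"
    using eta_decomp[OF fpk v] by (auto simp: im_at_def)
  have "?S \<in> span (range (\<lambda>i. \<Xi> i p))" by (intro span_sum span_scale span_base) auto
  then have S: "?S \<in> tangent_space \<A> p" "\<phi> p ?S = 0"
    unfolding fpk_facts(3)[OF fpk] ker_at_def by blast+
  have vu: "v = \<phi> p u + ?S" using u(2) by (simp add: algebra_simps)
  have "\<phi> p v = \<phi> p (\<phi> p u)"
    by (subst vu) (simp add: phi.tensor_add phi.tensor_tangent u(1) S)
  then have "\<phi> p (\<phi> p v) = - \<phi> p u"
    using fpk_facts(7)[OF fpk u(1)] by (simp add: eq_neg_iff_add_eq_0)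
  then show ?thesis using vu by (simp add: algebra_simps)
qed

text \<open>The frame spans only the kernel, so the coefficients are recovered from the kernel part
  of \<open>X\<close>, the smooth field X + \<phi>(\<phi> X).\<close>

lemma eta_smooth: assumes X: "smooth_vfield \<A> X" shows "(\<lambda>p. \<eta> i p (X p)) \<in> smooth_fun \<A>"
proof (rule frame_coeff_smooth[OF manifold manifold _ Xi_smooth fpk_facts(1,2)[OF fpk]])
  fix f assume f: "f \<in> smooth_fun \<A>"
  have "(\<lambda>q. \<Sum>j\<in>UNIV. \<eta> j q (X q) * \<Xi> j q f) = (\<lambda>q. (\<Sum>j\<in>UNIV. \<eta> j q (X q) *\<^sub>R \<Xi> j q) f)"
    by (simp add: sum_fun_apply scaleR_fun_def)
  also have "\<dots> = (\<lambda>q. X q f + (\<phi> \<cdot> \<phi> \<cdot> X) q f)"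
    by (simp add: kernel_part[OF vfield_tangent[OF X], symmetric] apply_tensor_def)
  finally show "(\<lambda>q. \<Sum>j\<in>UNIV. \<eta> j q (X q) * \<Xi> j q f) \<in> smooth_fun \<A>"
    using smooth_fun_add[OF vfield_smooth[OF X f] vfield_smooth[OF phi.tensor_smooth[OF phi.tensor_smooth[OF X]] f]]
    by simp
qed

text \<open>In the square, \<phi>^2 contributes -u plus the kernel part of u, and the rotation
  removes its components along \<open>\<Xi> 1\<close> and \<open>\<Xi> 2\<close>. Only the component
  along \<open>\<Xi> 3\<close> remains.\<close>

lemma phi_hat_almost_contact: "almost_contact \<A> (phi_hat \<A> \<phi> \<Xi>) (\<eta> 3) (\<Xi> 3)"
proof
  let ?F = "phi_hat \<A> \<phi> \<Xi>"
  show "smooth_tensor11 \<A> ?F"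
    unfolding smooth_tensor11_def
  proof (intro conjI allI impI ballI)
    fix p u v assume u: "u \<in> tangent_space \<A> p"
    show "?F p u \<in> tangent_space \<A> p"
      unfolding phi_hat_def
      by (intro subspace_diff subspace_add subspace_scale subspace_tangent_space Xi_tangent phi.tensor_tangent u)
    show "?F p (c *\<^sub>R u) = c *\<^sub>R ?F p u" for c
      unfolding phi_hat_def by (simp add: eta_scale phi.tensor_scale u algebra_simps)
    assume v: "v \<in> tangent_space \<A> p"
    show "?F p (u + v) = ?F p u + ?F p v"
      unfolding phi_hat_def by (simp add: eta_add phi.tensor_add u v algebra_simps)
  next
    fix X assume X: "smooth_vfield \<A> X"
    have "(\<lambda>p. ?F p (X p)) = (\<phi> \<cdot> X) + (\<lambda>p. \<eta> 1 p (X p) *\<^sub>R \<Xi> 2 p) - (\<lambda>p. \<eta> 2 p (X p) *\<^sub>R \<Xi> 1 p)"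
      by (simp add: phi_hat_def fun_eq_iff apply_tensor_def)
    then show "smooth_vfield \<A> (\<lambda>p. ?F p (X p))"
      using vfield_diff[OF vfield_add[OF phi.tensor_smooth[OF X] vfield_scale[OF eta_smooth[OF X, of 1] Xi_smooth[of 2]]]
          vfield_scale[OF eta_smooth[OF X, of 2] Xi_smooth[of 1]]] by simp
  qed
  fix p u assume u: "u \<in> tangent_space \<A> p"
  let ?a = "\<eta> 1 p u" and ?b = "\<eta> 2 p u"
  note s = subspace_scale[OF subspace_tangent_space Xi_tangent]
  have F: "?F p u = \<phi> p u + (?a *\<^sub>R \<Xi> 2 p + - ?b *\<^sub>R \<Xi> 1 p)" by (simp add: phi_hat_def)
  have t: "?a *\<^sub>R \<Xi> 2 p + - ?b *\<^sub>R \<Xi> 1 p \<in> tangent_space \<A> p"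
    by (rule subspace_add[OF subspace_tangent_space s s])
  have etaF: "\<eta> i p (?F p u) = ?a * \<eta> i p (\<Xi> 2 p) + - ?b * \<eta> i p (\<Xi> 1 p)" for i
    unfolding F eta_add[OF phi.tensor_tangent[OF u] t] eta_add[OF s s] eta_scale[OF Xi_tangent] eta_phi[OF u] by simp
  have phiF: "\<phi> p (?F p u) = \<phi> p (\<phi> p u)"
    unfolding F phi.tensor_add[OF phi.tensor_tangent[OF u] t] phi.tensor_add[OF s s] phi.tensor_scale[OF Xi_tangent] phi_Xi
    by simp
  have FF: "?F p (?F p u) = \<phi> p (\<phi> p u) - ?b *\<^sub>R \<Xi> 2 p - ?a *\<^sub>R \<Xi> 1 p"
    by (simp add: phi_hat_def[of \<A> \<phi> \<Xi> p "?F p u"] etaF phiF eta_frame[OF fpk])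
  show "?F p (?F p u) = - u + \<eta> 3 p u *\<^sub>R \<Xi> 3 p"
  proof -
    have "\<phi> p (\<phi> p u) = (\<Sum>j\<in>UNIV. \<eta> j p u *\<^sub>R \<Xi> j p) - u"
      unfolding kernel_part[OF u, symmetric] by simp
    then show ?thesis using FF by (simp add: sum_3)
  qed
  show "\<eta> 3 p (?F p u) = 0" unfolding etaF by (simp add: eta_frame[OF fpk])
qed (auto intro: Xi_smooth eta_smooth simp: eta_add eta_scale phi_hat_frame[OF fpk] eta_frame[OF fpk])

end

theorem theorem3:
  fixes \<A> :: "('m::{t2_space,second_countable_topology}, 'e::euclidean_space) atlas"
    and \<G> :: "('g::{t2_space,second_countable_topology}, 'f::euclidean_space) atlas"
    and mul :: "'g \<Rightarrow> 'g \<Rightarrow> 'g" and e :: 'g and iv :: "'g \<Rightarrow> 'g"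
    and br :: "'l::real_vector \<Rightarrow> 'l \<Rightarrow> 'l" and \<xi> :: "3 \<Rightarrow> 'l"
    and \<iota> :: "'l \<Rightarrow> 'g vfield" and star :: "'l \<Rightarrow> 'm vfield"
    and \<phi> :: "'m tensor11" and \<Xi> :: "3 \<Rightarrow> 'm vfield" and n :: nat
  assumes "lie_algebra br" and "is_basis \<xi>"
    and "lie_group \<G> mul e iv" and "simply_connected (UNIV :: 'g set)"
    and "has_lie_algebra \<G> mul br \<iota>"
    and "smooth_manifold \<A>" and "DIM('e) = 2 * n + 3"
    and "f_pk_g_structure \<A> \<phi> br \<xi> star \<Xi>"
  shows "integrable_structure (prod_atlas \<A> \<G>) (J_hat \<A> \<G> \<phi> \<Xi> (\<lambda>i. \<iota> (\<xi> i))) \<longleftrightarrow>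
    (\<forall>X Y. smooth_vfield \<A> X \<longrightarrow> smooth_vfield \<A> Y \<longrightarrow>
      nijenhuis (phi_hat \<A> \<phi> \<Xi>) X Y
        + (\<lambda>p. ext_deriv (eta \<A> \<phi> \<Xi> 3) X Y p *\<^sub>R \<Xi> 3 p) = 0)"
proof -
  define \<Lambda> where "\<Lambda> i = \<iota> (\<xi> i)" for i
  interpret M: f_pk3 \<A> \<phi> \<Xi>
    using assms(6,8) by unfold_locales (simp_all add: f_pk_g_structure_def)
  interpret G: parallelised \<G> \<Lambda>
    unfolding \<Lambda>_def[abs_def] by (rule lie_group_parallelised[OF assms(3,5,2)])
  let ?F = "phi_hat \<A> \<phi> \<Xi>" and ?\<eta> = "eta \<A> \<phi> \<Xi>"
  interpret C: contact_product \<A> ?F "?\<eta> 3" "\<Xi> 3" \<G> "psi \<Lambda>" "lambda \<Lambda> 3" "\<Lambda> 3"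
    using M.phi_hat_almost_contact G.psi_almost_contact by (simp add: contact_product_def)
  have J: "J_hat \<A> \<G> \<phi> \<Xi> (\<lambda>i. \<iota> (\<xi> i)) = C.prodJ"
    unfolding \<Lambda>_def[symmetric] by (auto simp: J_hat_def C.prodJ_def Let_def fun_eq_iff)
  have normality: "nijenhuis ?F X Y + (\<lambda>p. ext_deriv (?\<eta> 3) X Y p *\<^sub>R \<Xi> 3 p) = C.M.normality X Y" for X Y
    by (simp add: C.M.normality_def)
  show ?thesis unfolding J normality
  proof (intro iffI allI impI)
    fix X Y assume "integrable_structure (prod_atlas \<A> \<G>) C.prodJ" "smooth_vfield \<A> X" "smooth_vfield \<A> Y"
    then show "C.M.normality X Y = 0" by (rule C.normality_eq_0_if_integrable)
  next
    assume S: "\<forall>X Y. smooth_vfield \<A> X \<longrightarrow> smooth_vfield \<A> Y \<longrightarrow> C.M.normality X Y = 0"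
    have psi_frame: "psi \<Lambda> g (\<Lambda> 1 g) = \<Lambda> 2 g" for g by (simp add: psi_def G.lambda_frame)
    then have psi_field: "psi \<Lambda> \<cdot> \<Lambda> 1 = \<Lambda> 2" by (simp add: apply_tensor_def fun_eq_iff)
    show "integrable_structure (prod_atlas \<A> \<G>) C.prodJ"
    proof (rule C.integrable_if_normality_eq_0[of "\<Lambda> 1"])
      show "C.M.normality X Y = 0" if "smooth_vfield \<A> X" "smooth_vfield \<A> Y" for X Y using S that by blast
      show "smooth_vfield \<G> (\<Lambda> 1)" by (rule G.frame_smooth)
      show "lambda \<Lambda> 3 g (\<Lambda> 1 g) = 0" for g by (simp add: G.lambda_frame)
    next
      fix Y assume Y: "smooth_vfield \<G> Y"
      have "Y = (\<lambda>g. lambda \<Lambda> 1 g (Y g) *\<^sub>R \<Lambda> 1 g) + (\<lambda>g. lambda \<Lambda> 2 g (Y g) *\<^sub>R psi \<Lambda> g (\<Lambda> 1 g))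
          + (\<lambda>g. lambda \<Lambda> 3 g (Y g) *\<^sub>R \<Lambda> 3 g)"
      proof
        fix g show "Y g = ((\<lambda>g. lambda \<Lambda> 1 g (Y g) *\<^sub>R \<Lambda> 1 g) + (\<lambda>g. lambda \<Lambda> 2 g (Y g) *\<^sub>R psi \<Lambda> g (\<Lambda> 1 g))
          + (\<lambda>g. lambda \<Lambda> 3 g (Y g) *\<^sub>R \<Lambda> 3 g)) g"
          using G.lambda_decomp[OF G.vfield_tangent[OF Y], of g] by (simp add: psi_frame sum_3)
      qed
      then show "\<exists>a\<in>smooth_fun \<G>. \<exists>b\<in>smooth_fun \<G>. \<exists>c\<in>smooth_fun \<G>.
          Y = (\<lambda>g. a g *\<^sub>R \<Lambda> 1 g) + (\<lambda>g. b g *\<^sub>R psi \<Lambda> g (\<Lambda> 1 g)) + (\<lambda>g. c g *\<^sub>R \<Lambda> 3 g)"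
        by (intro bexI[of _ "\<lambda>g. lambda \<Lambda> 1 g (Y g)"] bexI[of _ "\<lambda>g. lambda \<Lambda> 2 g (Y g)"]
            bexI[of _ "\<lambda>g. lambda \<Lambda> 3 g (Y g)"] G.lambda_smooth[OF Y])
    next
      \<comment> \<open>The coefficients describe ad \<open>\<xi>\<^sub>3\<close> on
        \<open>\<xi>\<^sub>1\<close> and \<open>\<xi>\<^sub>2\<close>. Both homomorphisms carry them
        over, so the brackets on M and on G have the same constant coefficients.\<close>
      obtain a where a: "br (\<xi> 3) (\<xi> 1) = (\<Sum>j\<in>UNIV. a j *\<^sub>R \<xi> j)" using basis_expand[OF assms(2)] .
      obtain b where b: "br (\<xi> 3) (\<xi> 2) = (\<Sum>j\<in>UNIV. b j *\<^sub>R \<xi> j)" using basis_expand[OF assms(2)] .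
      have star: "linear star" "star (br x y) = lie_bracket (star x) (star y)" "star (\<xi> i) = \<Xi> i" for x y i
        using assms(8) by (auto simp: f_pk_g_structure_def lie_algebra_hom_def)
      have iota: "linear \<iota>" "\<iota> (br x y) = lie_bracket (\<iota> x) (\<iota> y)" for x y
        using assms(5) by (auto simp: has_lie_algebra_def lie_algebra_hom_def)
      have pw: "(\<Sum>j\<in>UNIV. c j *\<^sub>R X j) q = (\<Sum>j\<in>UNIV. c j *\<^sub>R X j q)"
        for c :: "3 \<Rightarrow> real" and X :: "3 \<Rightarrow> 'z vfield" and q
        by (simp add: sum_fun_apply[where I = "UNIV :: 3 set"] scaleR_fun_def[of _ "X _"])
      have "lie_bracket (\<Xi> 3) (\<Xi> 1) = (\<Sum>j\<in>UNIV. a j *\<^sub>R \<Xi> j)"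
        "lie_bracket (\<Xi> 3) (\<Xi> 2) = (\<Sum>j\<in>UNIV. b j *\<^sub>R \<Xi> j)"
        unfolding star(3)[symmetric] star(2)[symmetric] a b by (rule linear_sum_scale[OF star(1)])+
      then have Ma: "lie_bracket (\<Xi> 3) (\<Xi> 1) p = (\<Sum>j\<in>UNIV. a j *\<^sub>R \<Xi> j p)"
        and Mb: "lie_bracket (\<Xi> 3) (\<Xi> 2) p = (\<Sum>j\<in>UNIV. b j *\<^sub>R \<Xi> j p)" for p
        by (simp_all only: pw)
      have "lie_bracket (\<Lambda> 3) (\<Lambda> 1) = (\<Sum>j\<in>UNIV. a j *\<^sub>R \<Lambda> j)"
        "lie_bracket (\<Lambda> 3) (\<Lambda> 2) = (\<Sum>j\<in>UNIV. b j *\<^sub>R \<Lambda> j)"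
        unfolding \<Lambda>_def iota(2)[symmetric] a b by (rule linear_sum_scale[OF iota(1)])+
      then have Ga: "lie_bracket (\<Lambda> 3) (\<Lambda> 1) g = (\<Sum>j\<in>UNIV. a j *\<^sub>R \<Lambda> j g)"
        and Gb: "lie_bracket (\<Lambda> 3) (\<Lambda> 2) g = (\<Sum>j\<in>UNIV. b j *\<^sub>R \<Lambda> j g)" for g
        by (simp_all only: pw)
      \<comment> \<open>One point of M is enough, because the unknowns \<open>a\<close> and
        \<open>b\<close> are constants.\<close>
      obtain p :: 'm where True by simp
      have F: "?F \<cdot> \<Xi> 1 = \<Xi> 2" "?F \<cdot> \<Xi> 2 = - \<Xi> 1" "?F \<cdot> \<Xi> 3 = 0"
        by (auto simp: apply_tensor_def fun_eq_iff phi_hat_frame[OF M.fpk])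
      have Fsum: "?F p (\<Sum>j\<in>UNIV. c j *\<^sub>R \<Xi> j p) = c 1 *\<^sub>R \<Xi> 2 p - c 2 *\<^sub>R \<Xi> 1 p" for c
      proof -
        have "(\<Sum>j\<in>UNIV. c j *\<^sub>R \<Xi> j p) \<in> ker_at \<A> \<phi> p"
          unfolding fpk_facts(3)[OF M.fpk, symmetric] by (intro span_sum span_scale span_base) auto
        then have "\<phi> p (\<Sum>j\<in>UNIV. c j *\<^sub>R \<Xi> j p) = 0" by (simp add: ker_at_def)
        then show ?thesis unfolding phi_hat_def M.eta_sum by simp
      qed
      have br0: "lie_bracket 0 V = 0" if "smooth_vfield \<A> V" for V
        using M.bracket_add_left[OF M.vfield_zero M.vfield_zero that] by simp
      have brm: "lie_bracket (\<Xi> 3) (- \<Xi> 1) = - lie_bracket (\<Xi> 3) (\<Xi> 1)"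
        using M.bracket_add_right[of "\<Xi> 1" "- \<Xi> 1" "\<Xi> 3", OF M.Xi_smooth M.vfield_uminus[OF M.Xi_smooth] M.Xi_smooth]
          br0[OF M.Xi_smooth] M.bracket_skew[of 0 "\<Xi> 3"] by (simp add: eq_neg_iff_add_eq_0 add.commute)
      have const: "\<Xi> i p (\<lambda>q. ?\<eta> 3 q (\<Xi> j q)) = 0" for i j
        by (simp add: eta_frame[OF M.fpk] M.tangent_const[OF M.Xi_tangent])
      have neg: "?F p (- u) = - ?F p u" if "u \<in> tangent_space \<A> p" for u
        by (rule C.M.tensor_uminus[OF that])
      \<comment> \<open>As F annihilates \<open>\<Xi> 3\<close> and the functions
        \<open>?\<eta> 3 q (\<Xi> j q)\<close> are constant, normality of (\<open>\<Xi> 3\<close>,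
        \<open>\<Xi> 1\<close>) reduces to two terms: minus the bracket with \<open>\<Xi> 1\<close>
        and minus F of the bracket with \<open>\<Xi> 2\<close>.\<close>
      have e1: "- (\<Sum>j\<in>UNIV. a j *\<^sub>R \<Xi> j p) - (b 1 *\<^sub>R \<Xi> 2 p - b 2 *\<^sub>R \<Xi> 1 p) = 0"
        using C.M.normality_eq[OF M.Xi_smooth M.Xi_smooth, of 3 1 p] S M.Xi_smooth
        by (simp add: F br0 const Ma Mb Fsum M.Xi_smooth C.M.tensor_0)
      have e2: "- (\<Sum>j\<in>UNIV. b j *\<^sub>R \<Xi> j p) + (a 1 *\<^sub>R \<Xi> 2 p - a 2 *\<^sub>R \<Xi> 1 p) = 0"
        using C.M.normality_eq[OF M.Xi_smooth M.Xi_smooth, of 3 2 p] S M.Xi_smooth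
          neg[OF M.vfield_tangent[OF M.bracket_smooth[OF M.Xi_smooth M.Xi_smooth]], of 3 1]
        by (simp add: F br0 const Ma Mb Fsum M.Xi_smooth C.M.tensor_0 brm M.vfield_uminus)
      have coeff: "c 1 = 0 \<and> c 2 = 0 \<and> c 3 = 0" if "c 1 *\<^sub>R \<Xi> 1 p + c 2 *\<^sub>R \<Xi> 2 p + c 3 *\<^sub>R \<Xi> 3 p = 0" for c :: "3 \<Rightarrow> real"
      proof -
        have "(\<Sum>j\<in>UNIV. c j *\<^sub>R \<Xi> j p) = (\<Sum>j\<in>UNIV. 0 *\<^sub>R \<Xi> j p)" using that by (simp add: sum_3)
        then have "c i = 0" for i using M.eta_sum[of i p c] M.eta_sum[of i p "\<lambda>_. 0"] by simp
        then show ?thesis by simp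
      qed
      \<comment> \<open>The witness lists the coefficients of \<open>e1\<close> in the frame. The
        relations say that the matrix of ad \<open>\<xi>\<^sub>3\<close> on the plane is that of a
        complex number; \<open>b 3 = 0\<close>, which completes the invariance of the plane, comes
        from \<open>e2\<close>.\<close>
      have c1: "a 1 = b 2" "a 2 = - b 1" "a 3 = 0"
        using coeff[of "\<lambda>i. if i = 1 then b 2 - a 1 else if i = 2 then - a 2 - b 1 else - a 3"] e1
        by (simp_all add: sum_3 algebra_simps)
      have c2: "b 3 = 0"
        using coeff[of "\<lambda>i. if i = 1 then - b 1 - a 2 else if i = 2 then a 1 - b 2 else - b 3"] e2
        by (simp add: sum_3 algebra_simps)
      have br: "smooth_vfield \<G> (lie_bracket (\<Lambda> 3) (\<Lambda> 1))" by (intro G.bracket_smooth G.frame_smooth)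
      \<comment> \<open>With \<open>a 3 = 0\<close> the bracket has no component along
        \<open>\<Lambda> 3\<close>, so J acts on its lift through \<open>psi \<Lambda>\<close>
        alone.\<close>
      have th: "lambda \<Lambda> 3 g (lie_bracket (\<Lambda> 3) (\<Lambda> 1) g) = 0" for g
        unfolding Ga G.lambda_sum by (rule c1)
      have "psi \<Lambda> g (lie_bracket (\<Lambda> 3) (\<Lambda> 1) g) = lie_bracket (\<Lambda> 3) (\<Lambda> 2) g" for g
        unfolding Ga Gb psi_def G.lambda_sum by (simp add: sum_3 c1 c2)
      then have psi_br: "psi \<Lambda> \<cdot> lie_bracket (\<Lambda> 3) (\<Lambda> 1) = lie_bracket (\<Lambda> 3) (\<Lambda> 2)"
        by (simp add: apply_tensor_def fun_eq_iff)
      then show "C.prodJ \<cdot> C.lift_snd (lie_bracket (\<Lambda> 3) (\<Lambda> 1)) = C.lift_snd (lie_bracket (\<Lambda> 3) (psi \<Lambda> \<cdot> \<Lambda> 1))"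
        unfolding C.prodJ_lift_snd[OF br] th psi_field psi_br by (simp add: fun_eq_iff scaleR_fun_def)
    qed
  qed
qed

end
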